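(* Let $\mathcal{T}=(\mathbb{T},V,\xi)$ be a strict topological theory with $T1=1$. For every $\mathcal{T}$-category $X=(X,a)$, $\mathrm{pt}(\Omega(X))$ has the same objects as the Cauchy completion $\tilde X$ of $X$. In fact, there is an isomorphism of ordered sets $$\mathrm{Map}(\mathcal{T}\text{-}\mathrm{Dist})(E,X)\longrightarrow \mathcal{T}\text{-}\mathrm{Frm}(\Omega(X),V)$$ from the set of left adjoint $\mathcal{T}$-distributors from $E$ to $X$ to the set of $\mathcal{T}$-frame homomorphisms $\Omega(X)\to V$, whose composite with the map $(-)_*\colon X\to \mathrm{Map}(\mathcal{T}\text{-}\mathrm{Dist})(E,X)$, $x\mapsto x_*$, is the map $\eta_X\colon X\to\mathcal{T}\text{-}\mathrm{Frm}(\Omega(X),V)$, $x\mapsto \mathrm{ev}_{X,x}$, where $\mathrm{ev}_{X,x}(\varphi)=\varphi(x)$. Hence $X$ is Cauchy complete if and only if $\eta_X$ is surjective.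
   Context: **Quantales and theories.** $V=(V,\bigvee,\otimes,k)$ is a commutative quantale: a complete lattice with a commutative associative operation $\otimes$ with unit $k$, preserving suprema in each variable; $\hom$ is defined by $x\otimes y\le z\iff x\le\hom(y,z)$. A strict topological theory $\mathcal{T}=(\mathbb{T},V,\xi)$ consists of a monad $\mathbb{T}=(T,m,e)$ on $\mathrm{Set}$, a commutative quantale $V$ and a map $\xi\colon TV\to V$ such that: (a) $T$ sends pullbacks to weak pullbacks and every naturality square of $m$ is a weak pullback; (b) $(V,\xi)$ is an Eilenberg–Moore $\mathbb{T}$-algebra, and $\otimes\colon V\times V\to V$ and $k\colon 1\to V$ are $\mathbb{T}$-homomorphisms, i.e. $\xi(T(\otimes)(w))=\xi(T\pi_1(w))\otimes\xi(T\pi_2(w))$ for $w\in T(V\times V)$ and $\xi(T(k)(t))=k$ for $t\in T1$; (c) the maps $\xi_X\colon V^X\to V^{TX}$, $\varphi\mapsto\xi\cdot T\varphi$ (on sets of functions, pointwise order) are monotone and natural: for $f\colon X\to Y$ and $\varphi\colon X\to V$, with $(P_Vf)(\varphi)(y)=\bigvee_{f(x)=y}\varphi(x)$, one has $\xi_Y(P_Vf(\varphi))=P_V(Tf)(\xi_X(\varphi))$. Here $T1=1$ means that $T$ of a one-element set is a one-element set. **Matrices.** A $V$-matrix $r\colon X\to Y$ is a map $r\colon Y\times X\to V$; matrices are ordered pointwise. Put $T_\xi r(\mathfrak{y},\mathfrak{x})=\bigvee\{\xi(Tr(w))\mid w\in T(Y\times X),T\pi_1(w)=\mathfrak{y},T\pi_2(w)=\mathfrak{x}\}$.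 A $\mathcal{T}$-matrix $\alpha$ from $X$ to $Y$ is a map $\alpha\colon TY\times X\to V$. For $\alpha$ from $X$ to $Y$ and $\beta$ from $Y$ to $Z$, the Kleisli composite is $(\beta\circ\alpha)(\mathfrak{z},x)=\bigvee\{T_\xi\beta(\mathfrak{Z},\mathfrak{y})\otimes\alpha(\mathfrak{y},x)\mid \mathfrak{y}\in TY,\mathfrak{Z}\in TTZ,m_Z(\mathfrak{Z})=\mathfrak{z}\}$. **$\mathcal{T}$-graphs, categories, functors.** A $\mathcal{T}$-graph $(X,a)$ is a set with $a\colon TX\times X\to V$ such that $k\le a(e_X(x),x)$ for all $x$; it is a $\mathcal{T}$-category if also $a\circ a\le a$. A $\mathcal{T}$-graph morphism ($\mathcal{T}$-functor, between $\mathcal{T}$-categories) $f\colon(X,a)\to(Y,b)$ is a map with $a(\mathfrak{x},x)\le b(Tf(\mathfrak{x}),f(x))$. The underlying $V$-graph of $(X,a)$ is $SX=X$ with $SX(x',x)=a(e_X(x'),x)$; it is a $V$-category if $X$ is a $\mathcal{T}$-category. A $\mathbb{T}$-algebra $(I,\alpha)$ is viewed as a $\mathcal{T}$-category with structure $(\mathfrak{i},i)\mapsto k$ if $\alpha(\mathfrak{i})=i$, $\bot$ otherwise. $V$ is a $\mathcal{T}$-category with structure $(\mathfrak{v},v)\mapsto\hom(\xi(\mathfrak{v}),v)$. $E$ is the one-element set with structure constant $k$. **Distributors and Cauchy completeness.** A $\mathcal{T}$-distributor $\varphi\colon(X,a)\to(Y,b)$ is a $\mathcal{T}$-matrix from $X$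 to $Y$ with $\varphi\circ a\le\varphi$ and $b\circ\varphi\le\varphi$. They form a locally ordered category $\mathcal{T}\text{-}\mathrm{Dist}$ with Kleisli composition, identity $a$ on $(X,a)$, and pointwise order. $\varphi\colon X\to Y$ is left adjoint to $\psi\colon Y\to X$ ($\varphi\dashv\psi$) if $a\le\psi\circ\varphi$ and $\varphi\circ\psi\le b$. For a $\mathcal{T}$-functor $f\colon(X,a)\to(Y,b)$, $f_*(\mathfrak{y},x)=b(\mathfrak{y},f(x))$ and $f^*(\mathfrak{x},y)=b(Tf(\mathfrak{x}),y)$, and $f_*\dashv f^*$. An element $x\in X$ is identified with the $\mathcal{T}$-functor $E\to X$ picking it, so $x_*(\mathfrak{x},* )=a(\mathfrak{x},x)$. $X$ is Cauchy complete if every adjunction $\varphi\dashv\psi$ of $\mathcal{T}$-distributors $\varphi\colon Y\to X$, $\psi\colon X\to Y$ ($Y$ any $\mathcal{T}$-category) equals $f_*\dashv f^*$ for some $\mathcal{T}$-functor $f\colon Y\to X$. The objects of the Cauchy completion $\tilde X$ are the left adjoint $\mathcal{T}$-distributors $E\to X$. $\mathrm{Map}(\mathcal{T}\text{-}\mathrm{Dist})(E,X)$ is this set, with the pointwise order. **$V$-categorical notions.** For $V$-categories (hom-objects $A(x,y)\in V$), a $V$-distributor $1\to A$ is a map $\varphi\colon A\to V$ with $A(x,y)\otimes\varphi(y)\le\varphi(x)$; $PA$ is the $V$-category of these with $PA(\varphi,\varphi')=\bigwedge_x\hom(\varphi(x),\varphi'(x))$. A $V$-distributor $I\to1$ is a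 map $\varphi\colon I\to V$ with $\varphi(i)\otimes I(i,j)\le\varphi(j)$. $\sup_A\varphi$ is an object with $A(\sup_A\varphi,y)=\bigwedge_x\hom(\varphi(x),A(x,y))$. For $\psi\colon1\to I$ and a $V$-functor $h\colon I\to A$, the colimit $c$ satisfies $A(c,y)=\bigwedge_i\hom(\psi(i),A(h(i),y))$; for $\varphi\colon I\to1$, $\lim(\varphi,h)$ satisfies $A(y,\lim(\varphi,h))=\bigwedge_i\hom(\varphi(i),A(y,h(i)))$. The tensor $v\otimes x$ satisfies $A(v\otimes x,y)=\hom(v,A(x,y))$. Such objects are unique up to isomorphism, and equalities between them are meant up to isomorphism. Complete means having all weighted limits (hence all weighted colimits). **$\mathcal{T}$-frames.** Let $A$ be a $\mathcal{T}$-graph whose underlying $V$-graph is a $V$-category with tensors (also denoted $A$). A $\mathcal{T}$-weighted diagram in $A$ is a set $I$ with a $\mathbb{T}$-algebra structure and a $V$-category structure, a $V$-functor $h\colon I\to A$ and a $V$-distributor $\psi\colon 1\to I$ such that $i\mapsto\psi(i)\otimes h(i)$ (for some choice of tensors) is a $\mathcal{T}$-graph morphism $I\to A$; its colimit is a $\mathcal{T}$-weighted colimit. A $V$-distributor $\varphi\colon1\to A$ is $\mathcal{T}$-generated if $\varphi(x)=\bigvee_iA(x,h(i))\otimes\psi(i)$ for such $h,\psi$. A $\mathcal{T}$-frame is a $\mathcal{T}$-graph $A$ whose underlying $V$-graph is a complete $V$-category such that for any $V$-category $I$, $V$-distributor $\varphi\colon I\to1$ and $V$-functor $h\colon I\to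 PA$ with all $h(i)$ $\mathcal{T}$-generated: if $\lim(\varphi,h)$ is $\mathcal{T}$-generated then $\sup_A(\lim(\varphi,h))=\lim(\varphi,\sup_A\cdot h)$. A $V$-functor $f\colon A\to B$ is $\mathcal{T}$-compatible if for each $\mathbb{T}$-algebra $I$ and $\mathcal{T}$-graph morphism $h\colon I\to A$, $f\cdot h$ is a $\mathcal{T}$-graph morphism. A $\mathcal{T}$-frame homomorphism is a $\mathcal{T}$-compatible $V$-functor between the underlying $V$-categories preserving weighted limits and $\mathcal{T}$-weighted colimits. $\mathcal{T}\text{-}\mathrm{Frm}(A,V)$, for the $\mathcal{T}$-frame $V$ (with the $\mathcal{T}$-graph structure $TV\times V\to V$, $(\mathfrak{v},v)\mapsto\hom(\xi(\mathfrak{v}),v)$), is ordered pointwise. **$\Omega$ and $\mathrm{pt}$.** For a $\mathcal{T}$-category $X=(X,a)$, $\Omega(X)=V^X$ is the $\mathcal{T}$-frame whose elements are the $\mathcal{T}$-functors $X\to V$, with $\mathcal{T}$-graph structure $(\mathfrak{p},\varphi)\mapsto\bigwedge\{\hom(a(T\pi_1(\mathfrak{q}),x),\hom(\xi(T\mathrm{ev}(\mathfrak{q})),\varphi(x)))\mid x\in X,\mathfrak{q}\in T(X\times V^X),T\pi_2(\mathfrak{q})=\mathfrak{p}\}$, $\mathrm{ev}\colon X\times V^X\to V$ being evaluation; its underlying $V$-category has $[\varphi',\varphi]=\bigwedge_x\hom(\varphi'(x),\varphi(x))$. For a $\mathcal{T}$-frame $A$, $\mathrm{pt}(A)$ is the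 set $\mathcal{T}\text{-}\mathrm{Frm}(A,V)$ with the largest $\mathcal{T}$-category structure making all evaluation maps $h\mapsto h(x)$ ($x\in A$) $\mathcal{T}$-functors to $V$. *)

theory Defs
  imports Main "HOL-Library.FuncSet"
begin

text \<open>
  HOL has no type of all functors on Set, so Set is taken relative to a universe: its objects are
  the small subsets of a type \<open>'u\<close>, its morphisms are the functions between them.
  The element \<open>code A\<close> represents the small set \<open>A\<close> inside \<open>'u\<close>. The axioms are the closure
  properties of a Grothendieck universe (subsets, replacement, unions, power sets); a type whose
  cardinality is strongly inaccessible, with ``small'' meaning ``of smaller cardinality'', is a
  model. An infinite small set is not demanded, as nothing below depends on it.
\<close>

class set_universe =
  fixes small :: "'a set \<Rightarrow> bool"
    and code :: "'a set \<Rightarrow> 'a"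
  assumes small_finite: "finite A \<Longrightarrow> small A"
    and small_subset: "small B \<Longrightarrow> A \<subseteq> B \<Longrightarrow> small A"
    and small_image: "small A \<Longrightarrow> small (f ` A)"
    and small_UN: "small A \<Longrightarrow> (\<And>x. x \<in> A \<Longrightarrow> small (F x)) \<Longrightarrow> small (\<Union>x\<in>A. F x)"
    and small_Pow: "small A \<Longrightarrow> small (code ` Pow A)"
    and inj_on_code: "inj_on code {A. small A}"

text \<open>Kuratowski pairs, binary products, and the chosen one-element set.\<close>

definition cpair :: "'u::set_universe \<Rightarrow> 'u \<Rightarrow> 'u" where
  "cpair x y = code {code {x}, code {x, y}}"

definition cfst :: "'u::set_universe \<Rightarrow> 'u" where
  "cfst p = (THE x. \<exists>y. p = cpair x y)"

definition csnd :: "'u::set_universe \<Rightarrow> 'u" where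
  "csnd p = (THE y. \<exists>x. p = cpair x y)"

definition cprod :: "'u::set_universe set \<Rightarrow> 'u set \<Rightarrow> 'u set" where
  "cprod X Y = {cpair x y | x y. x \<in> X \<and> y \<in> Y}"

definition one_set :: "'u::set_universe set" where
  "one_set = {code {}}"

lemma code_eq_iff: "small A \<Longrightarrow> small B \<Longrightarrow> code A = code B \<longleftrightarrow> A = B"
  using inj_on_code by (auto dest: inj_onD)

lemma cpair_eq_iff [simp]: "cpair x y = cpair x' y' \<longleftrightarrow> x = x' \<and> y = y'"
  by (auto simp: cpair_def code_eq_iff small_finite doubleton_eq_iff)

lemma cfst_cpair [simp]: "cfst (cpair x y) = x"
  and csnd_cpair [simp]: "csnd (cpair x y) = y"
  by (auto simp: cfst_def csnd_def)


section \<open>Commutative quantales\<close>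

text \<open>The tensor is written \<open>*\<close> and its unit \<open>k\<close> is written \<open>1\<close>.\<close>

class comm_quantale = complete_lattice + comm_monoid_mult +
  assumes mult_Sup: "x * Sup A = Sup ((\<lambda>y. x * y) ` A)"

definition qhom :: "'v::comm_quantale \<Rightarrow> 'v \<Rightarrow> 'v" where
  "qhom y z = Sup {x. x * y \<le> z}"

lemma le_qhom_iff: "x * y \<le> z \<longleftrightarrow> x \<le> qhom y (z::'v::comm_quantale)"
proof
  assume "x * y \<le> z"
  then show "x \<le> qhom y z" by (auto simp: qhom_def intro: Sup_upper)
next
  assume x: "x \<le> qhom y z"
  have "y * qhom y z \<le> z"
    unfolding qhom_def mult_Sup by (auto intro!: SUP_least simp: mult.commute)
  moreover have "y * Sup {x, qhom y z} = Sup ((\<lambda>u. y * u) ` {x, qhom y z})"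
    by (rule mult_Sup)
  with x have "y * x \<le> y * qhom y z"
    by (simp add: sup_absorb2 le_iff_sup)
  ultimately show "x * y \<le> z" by (simp add: mult.commute)
qed


section \<open>Strict topological theories\<close>

text \<open>
  The quantale is a type \<open>'v\<close>; \<open>val\<close> embeds it as an object \<open>Vset\<close> of Set. A morphism has a
  domain and a codomain, so the functor acts by \<open>Tmap X Y f\<close> for \<open>f : X \<rightarrow> Y\<close>.
\<close>

record ('u, 'v) theory_data =
  val :: "'v \<Rightarrow> 'u"
  Tob :: "'u set \<Rightarrow> 'u set"
  Tmap :: "'u set \<Rightarrow> 'u set \<Rightarrow> ('u \<Rightarrow> 'u) \<Rightarrow> 'u \<Rightarrow> 'u"
  mu :: "'u set \<Rightarrow> 'u \<Rightarrow> 'u"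
  eta :: "'u set \<Rightarrow> 'u \<Rightarrow> 'u"
  xi :: "'u \<Rightarrow> 'v"

definition Vset :: "('u::set_universe, 'v::comm_quantale) theory_data \<Rightarrow> 'u set" where
  "Vset \<T> = range (val \<T>)"

definition unval :: "('u::set_universe, 'v::comm_quantale) theory_data \<Rightarrow> 'u \<Rightarrow> 'v" where
  "unval \<T> = inv (val \<T>)"

text \<open>\<open>xiT \<T> X \<phi>\<close> is the composite of \<open>T \<phi> : T X \<rightarrow> T V\<close> with \<open>xi\<close>.\<close>

definition xiT ::
  "('u::set_universe, 'v::comm_quantale) theory_data \<Rightarrow> 'u set \<Rightarrow> ('u \<Rightarrow> 'v) \<Rightarrow> 'u \<Rightarrow> 'v" where
  "xiT \<T> X \<phi> w = xi \<T> (Tmap \<T> X (Vset \<T>) (\<lambda>x. val \<T> (\<phi> x)) w)"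

definition set_functor :: "('u::set_universe, 'v::comm_quantale) theory_data \<Rightarrow> bool" where
  "set_functor \<T> \<longleftrightarrow>
    (\<forall>X. small X \<longrightarrow> small (Tob \<T> X)) \<and>
    (\<forall>X Y f. small X \<and> small Y \<and> f \<in> X \<rightarrow> Y \<longrightarrow> Tmap \<T> X Y f \<in> Tob \<T> X \<rightarrow> Tob \<T> Y) \<and>
    (\<forall>X Y f g. small X \<and> small Y \<and> f \<in> X \<rightarrow> Y \<and> (\<forall>x\<in>X. f x = g x) \<longrightarrow>
      (\<forall>w\<in>Tob \<T> X. Tmap \<T> X Y f w = Tmap \<T> X Y g w)) \<and>
    (\<forall>X. small X \<longrightarrow> (\<forall>w\<in>Tob \<T> X. Tmap \<T> X X (\<lambda>x. x) w = w)) \<and>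
    (\<forall>X Y Z f g. small X \<and> small Y \<and> small Z \<and> f \<in> X \<rightarrow> Y \<and> g \<in> Y \<rightarrow> Z \<longrightarrow>
      (\<forall>w\<in>Tob \<T> X. Tmap \<T> X Z (\<lambda>x. g (f x)) w = Tmap \<T> Y Z g (Tmap \<T> X Y f w)))"

definition set_monad :: "('u::set_universe, 'v::comm_quantale) theory_data \<Rightarrow> bool" where
  "set_monad \<T> \<longleftrightarrow> set_functor \<T> \<and>
    (\<forall>X. small X \<longrightarrow> eta \<T> X \<in> X \<rightarrow> Tob \<T> X \<and> mu \<T> X \<in> Tob \<T> (Tob \<T> X) \<rightarrow> Tob \<T> X) \<and>
    (\<forall>X Y f. small X \<and> small Y \<and> f \<in> X \<rightarrow> Y \<longrightarrow>
      (\<forall>x\<in>X. eta \<T> Y (f x) = Tmap \<T> X Y f (eta \<T> X x)) \<and>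
      (\<forall>W\<in>Tob \<T> (Tob \<T> X).
        mu \<T> Y (Tmap \<T> (Tob \<T> X) (Tob \<T> Y) (Tmap \<T> X Y f) W) = Tmap \<T> X Y f (mu \<T> X W))) \<and>
    (\<forall>X. small X \<longrightarrow>
      (\<forall>w\<in>Tob \<T> X. mu \<T> X (eta \<T> (Tob \<T> X) w) = w) \<and>
      (\<forall>w\<in>Tob \<T> X. mu \<T> X (Tmap \<T> X (Tob \<T> X) (eta \<T> X) w) = w) \<and>
      (\<forall>W\<in>Tob \<T> (Tob \<T> (Tob \<T> X)).
        mu \<T> X (Tmap \<T> (Tob \<T> (Tob \<T> X)) (Tob \<T> X) (mu \<T> X) W) =
        mu \<T> X (mu \<T> (Tob \<T> X) W)))"

text \<open>A square \<open>P \<rightarrow> X \<rightarrow> Z\<close>, \<open>P \<rightarrow> Y \<rightarrow> Z\<close> of sets.\<close>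

definition commuting_square ::
  "'u set \<Rightarrow> 'u set \<Rightarrow> 'u set \<Rightarrow> 'u set \<Rightarrow>
   ('u \<Rightarrow> 'u) \<Rightarrow> ('u \<Rightarrow> 'u) \<Rightarrow> ('u \<Rightarrow> 'u) \<Rightarrow> ('u \<Rightarrow> 'u) \<Rightarrow> bool" where
  "commuting_square P X Y Z p q f g \<longleftrightarrow>
    p \<in> P \<rightarrow> X \<and> q \<in> P \<rightarrow> Y \<and> f \<in> X \<rightarrow> Z \<and> g \<in> Y \<rightarrow> Z \<and> (\<forall>w\<in>P. f (p w) = g (q w))"

definition pullback_square ::
  "'u set \<Rightarrow> 'u set \<Rightarrow> 'u set \<Rightarrow> 'u set \<Rightarrow>
   ('u \<Rightarrow> 'u) \<Rightarrow> ('u \<Rightarrow> 'u) \<Rightarrow> ('u \<Rightarrow> 'u) \<Rightarrow> ('u \<Rightarrow> 'u) \<Rightarrow> bool" where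
  "pullback_square P X Y Z p q f g \<longleftrightarrow> commuting_square P X Y Z p q f g \<and>
    (\<forall>x\<in>X. \<forall>y\<in>Y. f x = g y \<longrightarrow> (\<exists>!w. w \<in> P \<and> p w = x \<and> q w = y))"

definition weak_pullback_square ::
  "'u set \<Rightarrow> 'u set \<Rightarrow> 'u set \<Rightarrow> 'u set \<Rightarrow>
   ('u \<Rightarrow> 'u) \<Rightarrow> ('u \<Rightarrow> 'u) \<Rightarrow> ('u \<Rightarrow> 'u) \<Rightarrow> ('u \<Rightarrow> 'u) \<Rightarrow> bool" where
  "weak_pullback_square P X Y Z p q f g \<longleftrightarrow> commuting_square P X Y Z p q f g \<and>
    (\<forall>x\<in>X. \<forall>y\<in>Y. f x = g y \<longrightarrow> (\<exists>w. w \<in> P \<and> p w = x \<and> q w = y))"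

definition T_algebra ::
  "('u::set_universe, 'v::comm_quantale) theory_data \<Rightarrow> 'u set \<Rightarrow> ('u \<Rightarrow> 'u) \<Rightarrow> bool" where
  "T_algebra \<T> I \<alpha> \<longleftrightarrow> small I \<and> \<alpha> \<in> Tob \<T> I \<rightarrow> I \<and>
    (\<forall>i\<in>I. \<alpha> (eta \<T> I i) = i) \<and>
    (\<forall>W\<in>Tob \<T> (Tob \<T> I). \<alpha> (Tmap \<T> (Tob \<T> I) I \<alpha> W) = \<alpha> (mu \<T> I W))"

definition push_forward :: "'u set \<Rightarrow> ('u \<Rightarrow> 'u) \<Rightarrow> ('u \<Rightarrow> 'v::comm_quantale) \<Rightarrow> 'u \<Rightarrow> 'v" where
  "push_forward X f \<phi> y = Sup {\<phi> x | x. x \<in> X \<and> f x = y}"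

definition strict_topological_theory ::
  "('u::set_universe, 'v::comm_quantale) theory_data \<Rightarrow> bool" where
  "strict_topological_theory \<T> \<longleftrightarrow>
    inj (val \<T>) \<and> small (Vset \<T>) \<and> set_monad \<T> \<and>
    \<comment> \<open>\<open>T\<close> sends pullbacks to weak pullbacks; naturality squares of the multiplication\<close>
    (\<forall>P X Y Z p q f g.
      small P \<and> small X \<and> small Y \<and> small Z \<and> pullback_square P X Y Z p q f g \<longrightarrow>
      weak_pullback_square (Tob \<T> P) (Tob \<T> X) (Tob \<T> Y) (Tob \<T> Z)
        (Tmap \<T> P X p) (Tmap \<T> P Y q) (Tmap \<T> X Z f) (Tmap \<T> Y Z g)) \<and>
    (\<forall>X Y f. small X \<and> small Y \<and> f \<in> X \<rightarrow> Y \<longrightarrow>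
      weak_pullback_square (Tob \<T> (Tob \<T> X)) (Tob \<T> X) (Tob \<T> (Tob \<T> Y)) (Tob \<T> Y)
        (mu \<T> X) (Tmap \<T> (Tob \<T> X) (Tob \<T> Y) (Tmap \<T> X Y f))
        (Tmap \<T> X Y f) (mu \<T> Y)) \<and>
    \<comment> \<open>\<open>(V, \<xi>)\<close> is an algebra; tensor and unit are homomorphisms\<close>
    T_algebra \<T> (Vset \<T>) (\<lambda>w. val \<T> (xi \<T> w)) \<and>
    (\<forall>w\<in>Tob \<T> (cprod (Vset \<T>) (Vset \<T>)).
      xiT \<T> (cprod (Vset \<T>) (Vset \<T>)) (\<lambda>p. unval \<T> (cfst p) * unval \<T> (csnd p)) w =
      xi \<T> (Tmap \<T> (cprod (Vset \<T>) (Vset \<T>)) (Vset \<T>) cfst w) *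
      xi \<T> (Tmap \<T> (cprod (Vset \<T>) (Vset \<T>)) (Vset \<T>) csnd w)) \<and>
    (\<forall>t\<in>Tob \<T> one_set. xiT \<T> one_set (\<lambda>_. 1) t = 1) \<and>
    \<comment> \<open>monotonicity and naturality of \<open>\<phi> \<mapsto> \<xi> \<cdot> T \<phi>\<close>\<close>
    (\<forall>X \<phi> \<phi>'. small X \<and> (\<forall>x\<in>X. \<phi> x \<le> \<phi>' x) \<longrightarrow>
      (\<forall>w\<in>Tob \<T> X. xiT \<T> X \<phi> w \<le> xiT \<T> X \<phi>' w)) \<and>
    (\<forall>X Y f \<phi>. small X \<and> small Y \<and> f \<in> X \<rightarrow> Y \<longrightarrow>
      (\<forall>w\<in>Tob \<T> Y. xiT \<T> Y (push_forward X f \<phi>) w =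
        push_forward (Tob \<T> X) (Tmap \<T> X Y f) (xiT \<T> X \<phi>) w))"

definition T_one :: "('u::set_universe, 'v::comm_quantale) theory_data \<Rightarrow> bool" where
  "T_one \<T> \<longleftrightarrow> is_singleton (Tob \<T> one_set)"


section \<open>Matrices, graphs, categories\<close>

text \<open>
  A matrix with entries in \<open>Y \<times> X\<close> is a function on HOL pairs that is \<open>extensional\<close> on \<open>Y \<times> X\<close>;
  thus equality and the function order \<open>\<le>\<close> are equality and pointwise order of matrices.
\<close>

definition T_xi ::
  "('u::set_universe, 'v::comm_quantale) theory_data \<Rightarrow> 'u set \<Rightarrow> 'u set \<Rightarrow>
   ('u \<times> 'u \<Rightarrow> 'v) \<Rightarrow> 'u \<times> 'u \<Rightarrow> 'v" where
  "T_xi \<T> Y X r = (\<lambda>(y, x) \<in> Tob \<T> Y \<times> Tob \<T> X.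
     Sup {xiT \<T> (cprod Y X) (\<lambda>p. r (cfst p, csnd p)) w | w.
       w \<in> Tob \<T> (cprod Y X) \<and>
       Tmap \<T> (cprod Y X) Y cfst w = y \<and> Tmap \<T> (cprod Y X) X csnd w = x})"

text \<open>\<open>kcomp \<T> X Y Z \<beta> \<alpha>\<close> is the Kleisli composite of \<open>\<alpha>\<close> from \<open>X\<close> to \<open>Y\<close> and \<open>\<beta>\<close> from \<open>Y\<close> to \<open>Z\<close>.\<close>

definition kcomp ::
  "('u::set_universe, 'v::comm_quantale) theory_data \<Rightarrow> 'u set \<Rightarrow> 'u set \<Rightarrow> 'u set \<Rightarrow>
   ('u \<times> 'u \<Rightarrow> 'v) \<Rightarrow> ('u \<times> 'u \<Rightarrow> 'v) \<Rightarrow> 'u \<times> 'u \<Rightarrow> 'v" where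
  "kcomp \<T> X Y Z \<beta> \<alpha> = (\<lambda>(z, x) \<in> Tob \<T> Z \<times> X.
     Sup {T_xi \<T> (Tob \<T> Z) Y \<beta> (W, y) * \<alpha> (y, x) | y W.
       y \<in> Tob \<T> Y \<and> W \<in> Tob \<T> (Tob \<T> Z) \<and> mu \<T> Z W = z})"

text \<open>
  Used both for \<open>V\<close>-graphs, with \<open>str (x', x)\<close> for points \<open>x', x\<close>, and for \<open>\<T>\<close>-graphs, with
  \<open>str (w, x)\<close> for \<open>w \<in> T X\<close> and a point \<open>x\<close>.
\<close>

record ('a, 'v) graph =
  pts :: "'a set"
  str :: "'a \<times> 'a \<Rightarrow> 'v"

definition T_graph ::
  "('u::set_universe, 'v::comm_quantale) theory_data \<Rightarrow> ('u, 'v) graph \<Rightarrow> bool" where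
  "T_graph \<T> X \<longleftrightarrow> small (pts X) \<and> str X \<in> extensional (Tob \<T> (pts X) \<times> pts X) \<and>
    (\<forall>x\<in>pts X. 1 \<le> str X (eta \<T> (pts X) x, x))"

definition T_category ::
  "('u::set_universe, 'v::comm_quantale) theory_data \<Rightarrow> ('u, 'v) graph \<Rightarrow> bool" where
  "T_category \<T> X \<longleftrightarrow> T_graph \<T> X \<and>
    kcomp \<T> (pts X) (pts X) (pts X) (str X) (str X) \<le> str X"

definition T_morphism ::
  "('u::set_universe, 'v::comm_quantale) theory_data \<Rightarrow> ('u, 'v) graph \<Rightarrow> ('u, 'v) graph \<Rightarrow>
   ('u \<Rightarrow> 'u) \<Rightarrow> bool" where
  "T_morphism \<T> X Y f \<longleftrightarrow> f \<in> pts X \<rightarrow> pts Y \<and>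
    (\<forall>w\<in>Tob \<T> (pts X). \<forall>x\<in>pts X. str X (w, x) \<le> str Y (Tmap \<T> (pts X) (pts Y) f w, f x))"

definition underlying ::
  "('u::set_universe, 'v::comm_quantale) theory_data \<Rightarrow> ('u, 'v) graph \<Rightarrow> ('u, 'v) graph" where
  "underlying \<T> X =
    \<lparr>pts = pts X, str = (\<lambda>(x', x) \<in> pts X \<times> pts X. str X (eta \<T> (pts X) x', x))\<rparr>"

definition alg_graph ::
  "('u::set_universe, 'v::comm_quantale) theory_data \<Rightarrow> 'u set \<Rightarrow> ('u \<Rightarrow> 'u) \<Rightarrow> ('u, 'v) graph" where
  "alg_graph \<T> I \<alpha> =
    \<lparr>pts = I, str = (\<lambda>(w, i) \<in> Tob \<T> I \<times> I. if \<alpha> w = i then 1 else bot)\<rparr>"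

definition V_obj ::
  "('u::set_universe, 'v::comm_quantale) theory_data \<Rightarrow> ('u, 'v) graph" where
  "V_obj \<T> = \<lparr>pts = Vset \<T>,
    str = (\<lambda>(w, v) \<in> Tob \<T> (Vset \<T>) \<times> Vset \<T>. qhom (xi \<T> w) (unval \<T> v))\<rparr>"

definition E_obj ::
  "('u::set_universe, 'v::comm_quantale) theory_data \<Rightarrow> ('u, 'v) graph" where
  "E_obj \<T> = \<lparr>pts = one_set, str = (\<lambda>_ \<in> Tob \<T> one_set \<times> one_set. 1)\<rparr>"


section \<open>Distributors and Cauchy completeness\<close>

definition T_distributor ::
  "('u::set_universe, 'v::comm_quantale) theory_data \<Rightarrow> ('u, 'v) graph \<Rightarrow> ('u, 'v) graph \<Rightarrow>
   ('u \<times> 'u \<Rightarrow> 'v) \<Rightarrow> bool" where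
  "T_distributor \<T> X Y \<phi> \<longleftrightarrow> \<phi> \<in> extensional (Tob \<T> (pts Y) \<times> pts X) \<and>
    kcomp \<T> (pts X) (pts X) (pts Y) \<phi> (str X) \<le> \<phi> \<and>
    kcomp \<T> (pts X) (pts Y) (pts Y) (str Y) \<phi> \<le> \<phi>"

text \<open>\<open>\<phi> \<stileturn> \<psi>\<close> for \<open>\<phi>\<close> from \<open>X\<close> to \<open>Y\<close> and \<open>\<psi>\<close> from \<open>Y\<close> to \<open>X\<close>.\<close>

definition T_adjunction ::
  "('u::set_universe, 'v::comm_quantale) theory_data \<Rightarrow> ('u, 'v) graph \<Rightarrow> ('u, 'v) graph \<Rightarrow>
   ('u \<times> 'u \<Rightarrow> 'v) \<Rightarrow> ('u \<times> 'u \<Rightarrow> 'v) \<Rightarrow> bool" where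
  "T_adjunction \<T> X Y \<phi> \<psi> \<longleftrightarrow> T_distributor \<T> X Y \<phi> \<and> T_distributor \<T> Y X \<psi> \<and>
    str X \<le> kcomp \<T> (pts X) (pts Y) (pts X) \<psi> \<phi> \<and>
    kcomp \<T> (pts Y) (pts X) (pts Y) \<phi> \<psi> \<le> str Y"

definition lower_star ::
  "('u::set_universe, 'v::comm_quantale) theory_data \<Rightarrow> ('u, 'v) graph \<Rightarrow> ('u, 'v) graph \<Rightarrow>
   ('u \<Rightarrow> 'u) \<Rightarrow> 'u \<times> 'u \<Rightarrow> 'v" where
  "lower_star \<T> X Y f = (\<lambda>(w, x) \<in> Tob \<T> (pts Y) \<times> pts X. str Y (w, f x))"

definition upper_star ::
  "('u::set_universe, 'v::comm_quantale) theory_data \<Rightarrow> ('u, 'v) graph \<Rightarrow> ('u, 'v) graph \<Rightarrow>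
   ('u \<Rightarrow> 'u) \<Rightarrow> 'u \<times> 'u \<Rightarrow> 'v" where
  "upper_star \<T> X Y f =
    (\<lambda>(w, y) \<in> Tob \<T> (pts X) \<times> pts Y. str Y (Tmap \<T> (pts X) (pts Y) f w, y))"

definition Cauchy_complete ::
  "('u::set_universe, 'v::comm_quantale) theory_data \<Rightarrow> ('u, 'v) graph \<Rightarrow> bool" where
  "Cauchy_complete \<T> X \<longleftrightarrow> (\<forall>Y \<phi> \<psi>. T_category \<T> Y \<and> T_adjunction \<T> Y X \<phi> \<psi> \<longrightarrow>
    (\<exists>f. T_morphism \<T> Y X f \<and> \<phi> = lower_star \<T> Y X f \<and> \<psi> = upper_star \<T> Y X f))"

text \<open>\<open>Map(\<T>-Dist)(E, X)\<close>, which is also the set of objects of the Cauchy completion of \<open>X\<close>.\<close>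

definition Map_E ::
  "('u::set_universe, 'v::comm_quantale) theory_data \<Rightarrow> ('u, 'v) graph \<Rightarrow> ('u \<times> 'u \<Rightarrow> 'v) set" where
  "Map_E \<T> X = {\<phi>. \<exists>\<psi>. T_adjunction \<T> (E_obj \<T>) X \<phi> \<psi>}"

definition point_star ::
  "('u::set_universe, 'v::comm_quantale) theory_data \<Rightarrow> ('u, 'v) graph \<Rightarrow> 'u \<Rightarrow> 'u \<times> 'u \<Rightarrow> 'v" where
  "point_star \<T> X x = lower_star \<T> (E_obj \<T>) X (\<lambda>_. x)"


section \<open>Categories enriched in the quantale\<close>

definition V_category :: "('a, 'v::comm_quantale) graph \<Rightarrow> bool" where
  "V_category A \<longleftrightarrow> (\<forall>x\<in>pts A. 1 \<le> str A (x, x)) \<and>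
    (\<forall>x\<in>pts A. \<forall>y\<in>pts A. \<forall>z\<in>pts A. str A (x, y) * str A (y, z) \<le> str A (x, z))"

definition V_functor ::
  "('a, 'v::comm_quantale) graph \<Rightarrow> ('b, 'v) graph \<Rightarrow> ('a \<Rightarrow> 'b) \<Rightarrow> bool" where
  "V_functor A B f \<longleftrightarrow> f \<in> pts A \<rightarrow> pts B \<and>
    (\<forall>x\<in>pts A. \<forall>y\<in>pts A. str A (x, y) \<le> str B (f x, f y))"

definition V_dist_from_1 :: "('a, 'v::comm_quantale) graph \<Rightarrow> ('a \<Rightarrow> 'v) \<Rightarrow> bool" where
  "V_dist_from_1 A \<phi> \<longleftrightarrow> (\<forall>x\<in>pts A. \<forall>y\<in>pts A. str A (x, y) * \<phi> y \<le> \<phi> x)"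

definition V_dist_to_1 :: "('a, 'v::comm_quantale) graph \<Rightarrow> ('a \<Rightarrow> 'v) \<Rightarrow> bool" where
  "V_dist_to_1 A \<phi> \<longleftrightarrow> (\<forall>x\<in>pts A. \<forall>y\<in>pts A. \<phi> x * str A (x, y) \<le> \<phi> y)"

definition P_obj :: "('a, 'v::comm_quantale) graph \<Rightarrow> ('a \<Rightarrow> 'v, 'v) graph" where
  "P_obj A = \<lparr>pts = {\<phi> \<in> extensional (pts A). V_dist_from_1 A \<phi>},
    str = (\<lambda>(\<phi>, \<phi>'). INF x\<in>pts A. qhom (\<phi> x) (\<phi>' x))\<rparr>"

definition is_sup :: "('a, 'v::comm_quantale) graph \<Rightarrow> ('a \<Rightarrow> 'v) \<Rightarrow> 'a \<Rightarrow> bool" where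
  "is_sup A \<phi> s \<longleftrightarrow> s \<in> pts A \<and>
    (\<forall>y\<in>pts A. str A (s, y) = (INF x\<in>pts A. qhom (\<phi> x) (str A (x, y))))"

definition is_colim ::
  "('a, 'v::comm_quantale) graph \<Rightarrow> 'i set \<Rightarrow> ('i \<Rightarrow> 'v) \<Rightarrow> ('i \<Rightarrow> 'a) \<Rightarrow> 'a \<Rightarrow> bool" where
  "is_colim A I \<psi> h c \<longleftrightarrow> c \<in> pts A \<and>
    (\<forall>y\<in>pts A. str A (c, y) = (INF i\<in>I. qhom (\<psi> i) (str A (h i, y))))"

definition is_lim ::
  "('a, 'v::comm_quantale) graph \<Rightarrow> 'i set \<Rightarrow> ('i \<Rightarrow> 'v) \<Rightarrow> ('i \<Rightarrow> 'a) \<Rightarrow> 'a \<Rightarrow> bool" where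
  "is_lim A I \<phi> h c \<longleftrightarrow> c \<in> pts A \<and>
    (\<forall>y\<in>pts A. str A (y, c) = (INF i\<in>I. qhom (\<phi> i) (str A (y, h i))))"

definition is_tensor :: "('a, 'v::comm_quantale) graph \<Rightarrow> 'v \<Rightarrow> 'a \<Rightarrow> 'a \<Rightarrow> bool" where
  "is_tensor A v x t \<longleftrightarrow> t \<in> pts A \<and> (\<forall>y\<in>pts A. str A (t, y) = qhom v (str A (x, y)))"

text \<open>Data for a weighted limit in \<open>A\<close>, over a small index category.\<close>

definition limit_data ::
  "('u::set_universe, 'v::comm_quantale) graph \<Rightarrow> ('a, 'v) graph \<Rightarrow> ('u \<Rightarrow> 'v) \<Rightarrow> ('u \<Rightarrow> 'a) \<Rightarrow> bool" where
  "limit_data I A \<phi> h \<longleftrightarrow>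
    small (pts I) \<and> V_category I \<and> V_dist_to_1 I \<phi> \<and> V_functor I A h"

definition V_complete :: "('u::set_universe, 'v::comm_quantale) graph \<Rightarrow> bool" where
  "V_complete A \<longleftrightarrow> (\<forall>(I :: ('u, 'v) graph) \<phi> h. limit_data I A \<phi> h \<longrightarrow>
    (\<exists>c. is_lim A (pts I) \<phi> h c))"


section \<open>\<open>\<T>\<close>-frames\<close>

definition T_diagram ::
  "('u::set_universe, 'v::comm_quantale) theory_data \<Rightarrow> ('u, 'v) graph \<Rightarrow>
   ('u, 'v) graph \<Rightarrow> ('u \<Rightarrow> 'u) \<Rightarrow> ('u \<Rightarrow> 'u) \<Rightarrow> ('u \<Rightarrow> 'v) \<Rightarrow> bool" where
  "T_diagram \<T> A I \<alpha> h \<psi> \<longleftrightarrow>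
    T_algebra \<T> (pts I) \<alpha> \<and> V_category I \<and> V_functor I (underlying \<T> A) h \<and>
    V_dist_from_1 I \<psi> \<and>
    (\<exists>t. (\<forall>i\<in>pts I. is_tensor (underlying \<T> A) (\<psi> i) (h i) (t i)) \<and>
      T_morphism \<T> (alg_graph \<T> (pts I) \<alpha>) A t)"

definition T_generated ::
  "('u::set_universe, 'v::comm_quantale) theory_data \<Rightarrow> ('u, 'v) graph \<Rightarrow> ('u \<Rightarrow> 'v) \<Rightarrow> bool" where
  "T_generated \<T> A \<phi> \<longleftrightarrow> V_dist_from_1 (underlying \<T> A) \<phi> \<and>
    (\<exists>I \<alpha> h \<psi>. T_diagram \<T> A I \<alpha> h \<psi> \<and>
      (\<forall>x\<in>pts A. \<phi> x = (SUP i\<in>pts I. str (underlying \<T> A) (x, h i) * \<psi> i)))"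

text \<open>
  The last clause is the equality \<open>sup_A(lim(\<phi>, h)) = lim(\<phi>, sup_A \<cdot> h)\<close> up to isomorphism: every
  supremum of the limit \<open>L\<close> is a limit of (any choice \<open>t\<close> of) the suprema of the \<open>h i\<close>.
\<close>

definition T_frame ::
  "('u::set_universe, 'v::comm_quantale) theory_data \<Rightarrow> ('u, 'v) graph \<Rightarrow> bool" where
  "T_frame \<T> A \<longleftrightarrow> T_graph \<T> A \<and> V_category (underlying \<T> A) \<and> V_complete (underlying \<T> A) \<and>
    (\<forall>(I :: ('u, 'v) graph) \<phi> h L.
      limit_data I (P_obj (underlying \<T> A)) \<phi> h \<and> (\<forall>i\<in>pts I. T_generated \<T> A (h i)) \<and>
      is_lim (P_obj (underlying \<T> A)) (pts I) \<phi> h L \<and> T_generated \<T> A L \<longrightarrow>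
      (\<forall>s t. is_sup (underlying \<T> A) L s \<and>
        (\<forall>i\<in>pts I. is_sup (underlying \<T> A) (h i) (t i)) \<longrightarrow>
        is_lim (underlying \<T> A) (pts I) \<phi> t s))"

definition T_compatible ::
  "('u::set_universe, 'v::comm_quantale) theory_data \<Rightarrow> ('u, 'v) graph \<Rightarrow> ('u, 'v) graph \<Rightarrow>
   ('u \<Rightarrow> 'u) \<Rightarrow> bool" where
  "T_compatible \<T> A B f \<longleftrightarrow>
    (\<forall>I \<alpha> h. T_algebra \<T> I \<alpha> \<and> T_morphism \<T> (alg_graph \<T> I \<alpha>) A h \<longrightarrow>
      T_morphism \<T> (alg_graph \<T> I \<alpha>) B (\<lambda>i. f (h i)))"

definition T_frame_hom ::
  "('u::set_universe, 'v::comm_quantale) theory_data \<Rightarrow> ('u, 'v) graph \<Rightarrow> ('u, 'v) graph \<Rightarrow>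
   ('u \<Rightarrow> 'u) \<Rightarrow> bool" where
  "T_frame_hom \<T> A B f \<longleftrightarrow> T_frame \<T> A \<and> T_frame \<T> B \<and>
    V_functor (underlying \<T> A) (underlying \<T> B) f \<and> T_compatible \<T> A B f \<and>
    (\<forall>(I :: ('u, 'v) graph) \<phi> h c.
      limit_data I (underlying \<T> A) \<phi> h \<and> is_lim (underlying \<T> A) (pts I) \<phi> h c \<longrightarrow>
      is_lim (underlying \<T> B) (pts I) \<phi> (\<lambda>i. f (h i)) (f c)) \<and>
    (\<forall>(I :: ('u, 'v) graph) \<alpha> \<psi> h c.
      T_diagram \<T> A I \<alpha> h \<psi> \<and> is_colim (underlying \<T> A) (pts I) \<psi> h c \<longrightarrow>
      is_colim (underlying \<T> B) (pts I) \<psi> (\<lambda>i. f (h i)) (f c))"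

definition T_Frm ::
  "('u::set_universe, 'v::comm_quantale) theory_data \<Rightarrow> ('u, 'v) graph \<Rightarrow> ('u, 'v) graph \<Rightarrow>
   ('u \<Rightarrow> 'u) set" where
  "T_Frm \<T> A B = {f \<in> extensional (pts A). T_frame_hom \<T> A B f}"

text \<open>The pointwise order of maps \<open>A \<rightarrow> V\<close>.\<close>

definition frm_le ::
  "('u::set_universe, 'v::comm_quantale) theory_data \<Rightarrow> ('u, 'v) graph \<Rightarrow>
   ('u \<Rightarrow> 'u) \<Rightarrow> ('u \<Rightarrow> 'u) \<Rightarrow> bool" where
  "frm_le \<T> A f g \<longleftrightarrow> (\<forall>p\<in>pts A. unval \<T> (f p) \<le> unval \<T> (g p))"


section \<open>The frame of a category and the points of a frame\<close>

text \<open>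
  Functions \<open>X \<rightarrow> V\<close> become elements of the universe as (codes of) their graphs;
  \<open>fdec \<T> X\<close> recovers the function, extensional on \<open>X\<close>.
\<close>

definition fcode ::
  "('u::set_universe, 'v::comm_quantale) theory_data \<Rightarrow> 'u set \<Rightarrow> ('u \<Rightarrow> 'v) \<Rightarrow> 'u" where
  "fcode \<T> X \<phi> = code ((\<lambda>x. cpair x (val \<T> (\<phi> x))) ` X)"

definition fdec ::
  "('u::set_universe, 'v::comm_quantale) theory_data \<Rightarrow> 'u set \<Rightarrow> 'u \<Rightarrow> 'u \<Rightarrow> 'v" where
  "fdec \<T> X = inv_into (extensional X) (fcode \<T> X)"

definition Omega_pts ::
  "('u::set_universe, 'v::comm_quantale) theory_data \<Rightarrow> ('u, 'v) graph \<Rightarrow> 'u set" where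
  "Omega_pts \<T> X = fcode \<T> (pts X) `
    {\<phi> \<in> extensional (pts X). T_morphism \<T> X (V_obj \<T>) (\<lambda>x. val \<T> (\<phi> x))}"

definition Omega ::
  "('u::set_universe, 'v::comm_quantale) theory_data \<Rightarrow> ('u, 'v) graph \<Rightarrow> ('u, 'v) graph" where
  "Omega \<T> X = \<lparr>pts = Omega_pts \<T> X,
    str = (\<lambda>(\<pp>, p) \<in> Tob \<T> (Omega_pts \<T> X) \<times> Omega_pts \<T> X.
      Inf {qhom (str X (Tmap \<T> (cprod (pts X) (Omega_pts \<T> X)) (pts X) cfst \<qq>, x))
             (qhom (xiT \<T> (cprod (pts X) (Omega_pts \<T> X)) (\<lambda>r. fdec \<T> (pts X) (csnd r) (cfst r)) \<qq>)
               (fdec \<T> (pts X) p x)) | x \<qq>.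
           x \<in> pts X \<and> \<qq> \<in> Tob \<T> (cprod (pts X) (Omega_pts \<T> X)) \<and>
           Tmap \<T> (cprod (pts X) (Omega_pts \<T> X)) (Omega_pts \<T> X) csnd \<qq> = \<pp>})\<rparr>"

text \<open>The evaluation \<open>\<phi> \<mapsto> \<phi>(x)\<close> on the frame of \<open>X\<close>, i.e. the value at \<open>x\<close> of the unit.\<close>

definition eta_pt ::
  "('u::set_universe, 'v::comm_quantale) theory_data \<Rightarrow> ('u, 'v) graph \<Rightarrow> 'u \<Rightarrow> 'u \<Rightarrow> 'u" where
  "eta_pt \<T> X x = (\<lambda>p \<in> pts (Omega \<T> X). val \<T> (fdec \<T> (pts X) p x))"

definition hom_code ::
  "('u::set_universe, 'v::comm_quantale) theory_data \<Rightarrow> ('u, 'v) graph \<Rightarrow> ('u \<Rightarrow> 'u) \<Rightarrow> 'u" where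
  "hom_code \<T> A h = fcode \<T> (pts A) (\<lambda>x \<in> pts A. unval \<T> (h x))"

definition pt_pts ::
  "('u::set_universe, 'v::comm_quantale) theory_data \<Rightarrow> ('u, 'v) graph \<Rightarrow> 'u set" where
  "pt_pts \<T> A = hom_code \<T> A ` T_Frm \<T> A (V_obj \<T>)"

definition pt ::
  "('u::set_universe, 'v::comm_quantale) theory_data \<Rightarrow> ('u, 'v) graph \<Rightarrow> ('u, 'v) graph" where
  "pt \<T> A = \<lparr>pts = pt_pts \<T> A,
    str = (GREATEST b. T_category \<T> \<lparr>pts = pt_pts \<T> A, str = b\<rparr> \<and>
      (\<forall>x\<in>pts A. T_morphism \<T> \<lparr>pts = pt_pts \<T> A, str = b\<rparr> (V_obj \<T>)
        (\<lambda>c. val \<T> (fdec \<T> (pts A) c x))))\<rparr>"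

end

theory Submission
  imports Defs
begin

text \<open>
  Since \<open>T 1 = 1\<close>, the map \<open>V\<^sup>X \<rightarrow> V\<^bsup>T X\<^esup>\<close>, \<open>p \<mapsto> \<xi> \<cdot> T p\<close>, preserves constants, so the columns
  \<open>a(w, -)\<close> belong to \<open>\<Omega>(X)\<close> and evaluation at \<open>x\<close> is represented by \<open>a(e x, -)\<close>. Hence suprema of
  \<open>\<T>\<close>-generated distributors, which are pointwise, commute with limits: \<open>\<Omega>(X)\<close> is a frame.

  An adjunction \<open>f \<stileturn> g\<close> between \<open>E\<close> and \<open>X\<close> yields the homomorphism
  \<open>p \<mapsto> p \<circ> f = [g, p]\<close>, which preserves limits as it is representable and \<open>\<T>\<close>-weighted colimits as it is
  given by composition with \<open>f\<close>; \<open>f\<close> is recovered as its value on the columns. Conversely a frame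
  homomorphism \<open>F\<close> preserves limits, hence is \<open>[g, -]\<close> for some \<open>g \<in> \<Omega>(X)\<close>. With
  \<open>f(w) = F(a(w, -))\<close>, compatibility applied to the free algebra \<open>T X\<close> makes \<open>f\<close> a distributor, and
  the unit of \<open>f \<stileturn> g\<close> comes from the \<open>\<T>\<close>-weighted colimit \<open>g = \<Or>\<^sub>w \<xi>(T g(w)) \<otimes> a(w, -)\<close>.

  An adjunction \<open>\<phi> \<stileturn> \<psi>\<close> from \<open>Y\<close> to \<open>X\<close> restricts to \<open>\<phi>(-, y) \<stileturn> \<psi>(e y, -)\<close> for each \<open>y \<in> Y\<close>;
  this is why Cauchy completeness can be tested on \<open>E\<close> alone.
\<close>

section \<open>Quantales\<close>

text \<open>As T 1 has one element, a matrix out of E is a function on T X and a matrix into E is a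
  function on X, so an adjunction becomes a pair of functions (\<open>E_adj\<close>), and an element
  of \<open>Omega\<close> becomes a function satisfying one inequality (\<open>stable\<close>). The
  obstacle is the structure of \<open>Omega\<close>: it is an infimum over T(X x V^X), whose
  elements have no explicit description. Only two cases of it are ever evaluated. Elements over e(p)
  have the form T(-, p)(w), and elements over T g(w), for g from an algebra I, lift to T(X x I);
  both are weak pullback arguments. So a graph morphism from I to \<open>Omega\<close> is an
  inequality on T(X x I) (\<open>joint\<close>). Naturality of \<xi> turns suprema over I into
  suprema over T(X x I), and the algebra structure sends the I-component back to a single index;
  this is how algebra-indexed suprema stay in \<open>Omega\<close>. The g representing F is the
  limit of the identity of \<open>Omega\<close> weighted by F itself; preservation of that limit
  says k \<le> F(g). The weak pullback condition on m makes its fibre over e(y) trivial, which is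
  what lets the unit of an adjunction restrict to the point y.\<close>

lemma quantale_mult_mono:
  fixes a b c d :: "'v::comm_quantale"
  assumes "a \<le> b" "c \<le> d"
  shows "a * c \<le> b * d"
proof -
  have "b * d \<le> b * d" "a * d \<le> a * d" by simp_all
  then have "b \<le> qhom d (b * d)" "d \<le> qhom a (a * d)"
    by (simp_all add: le_qhom_iff[symmetric] mult.commute)
  with assms have "a * d \<le> b * d" "c * a \<le> a * d"
    by (metis le_qhom_iff order_trans)+
  then show ?thesis by (metis mult.commute order_trans)
qed

lemma quantale_mult_SUP: "(x::'v::comm_quantale) * (SUP i\<in>I. f i) = (SUP i\<in>I. x * f i)"
  by (simp add: mult_Sup image_image)

lemma quantale_SUP_mult: "(SUP i\<in>I. f i) * (x::'v::comm_quantale) = (SUP i\<in>I. f i * x)"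
  by (simp add: mult.commute[of _ x] quantale_mult_SUP)

lemma quantale_bot_mult [simp]: "bot * (x::'v::comm_quantale) = bot" "x * bot = bot"
  using mult_Sup[of x "{}"] by (simp_all add: mult.commute)

lemma one_le_qhom_iff [simp]: "1 \<le> qhom a b \<longleftrightarrow> a \<le> (b::'v::comm_quantale)"
  by (simp add: le_qhom_iff[symmetric])

lemma qhom_one [simp]: "qhom 1 b = (b::'v::comm_quantale)"
  by (rule order_antisym) (metis le_qhom_iff mult_1_right order_refl)+

lemma mult_qhom_le: "a * qhom a b \<le> (b::'v::comm_quantale)" "qhom a b * a \<le> b"
  by (metis le_qhom_iff mult.commute order_refl)+

lemma qhom_antimono: "a \<le> b \<Longrightarrow> qhom b c \<le> qhom a (c::'v::comm_quantale)"
  using quantale_mult_mono[OF order_refl, of a b "qhom b c"] mult_qhom_le(2)[of b c]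
  by (simp add: le_qhom_iff[symmetric])

lemma eq_by_lower_bounds:
  fixes a b :: "'v::order"
  assumes "\<And>z. z \<le> a \<longleftrightarrow> z \<le> b"
  shows "a = b"
  using assms by (meson order_antisym order_refl)


section \<open>The universe\<close>

lemma cprod_iff [simp]: "cpair x y \<in> cprod X Y \<longleftrightarrow> x \<in> X \<and> y \<in> Y"
  by (auto simp: cprod_def)

lemma cprodE:
  assumes "p \<in> cprod X Y"
  obtains x y where "p = cpair x y" "x \<in> X" "y \<in> Y"
  using assms by (auto simp: cprod_def)

lemma cfst_in [intro]: "p \<in> cprod X Y \<Longrightarrow> cfst p \<in> X"
  and csnd_in [intro]: "p \<in> cprod X Y \<Longrightarrow> csnd p \<in> Y"
  by (auto elim: cprodE)

lemma small_cprod: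
  assumes "small X" "small Y"
  shows "small (cprod X Y)"
proof -
  have "cprod X Y = (\<Union>x\<in>X. cpair x ` Y)" by (auto simp: cprod_def)
  then show ?thesis using assms by (simp add: small_UN small_image)
qed

lemma small_one_set [simp]: "small one_set"
  by (simp add: one_set_def small_finite)


section \<open>Calculus of a strict topological theory\<close>

locale strict_theory =
  fixes \<T> :: "('u::set_universe, 'v::comm_quantale) theory_data"
  assumes strict: "strict_topological_theory \<T>"
    and T_one: "T_one \<T>"
begin

lemmas strict_conjs = strict[unfolded strict_topological_theory_def]

lemma inj_val: "inj (val \<T>)"
  and small_Vset [simp]: "small (Vset \<T>)"
  and set_monad: "set_monad \<T>"
  using strict by (simp_all add: strict_topological_theory_def)

lemma set_functor: "set_functor \<T>"
  using set_monad by (simp add: set_monad_def)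

lemmas monad_conjs = set_monad[unfolded set_monad_def]
lemmas functor_conjs = set_functor[unfolded set_functor_def]

lemma unval_val [simp]: "unval \<T> (val \<T> v) = v"
  using inj_val by (simp add: unval_def)

lemma val_in [simp]: "val \<T> v \<in> Vset \<T>"
  by (simp add: Vset_def)

lemma val_unval [simp]: "u \<in> Vset \<T> \<Longrightarrow> val \<T> (unval \<T> u) = u"
  by (auto simp: Vset_def)

lemma small_T [simp]: "small X \<Longrightarrow> small (Tob \<T> X)"
  using set_functor by (simp add: set_functor_def)

lemma Tmap_in: "\<lbrakk>w \<in> Tob \<T> X; f \<in> X \<rightarrow> Y; small X; small Y\<rbrakk> \<Longrightarrow> Tmap \<T> X Y f w \<in> Tob \<T> Y"
  using functor_conjs[THEN conjunct2, THEN conjunct1] by blast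

lemma Tmap_cong:
  "\<lbrakk>\<And>x. x \<in> X \<Longrightarrow> f x = g x; f \<in> X \<rightarrow> Y; small X; small Y; w \<in> Tob \<T> X\<rbrakk>
   \<Longrightarrow> Tmap \<T> X Y f w = Tmap \<T> X Y g w"
  using functor_conjs[THEN conjunct2, THEN conjunct2, THEN conjunct1] by blast

lemma Tmap_ident: "\<lbrakk>small X; w \<in> Tob \<T> X\<rbrakk> \<Longrightarrow> Tmap \<T> X X (\<lambda>x. x) w = w"
  using functor_conjs[THEN conjunct2, THEN conjunct2, THEN conjunct2, THEN conjunct1] by blast

lemma Tmap_Tmap:
  "\<lbrakk>w \<in> Tob \<T> X; f \<in> X \<rightarrow> Y; g \<in> Y \<rightarrow> Z; small X; small Y; small Z\<rbrakk>
   \<Longrightarrow> Tmap \<T> Y Z g (Tmap \<T> X Y f w) = Tmap \<T> X Z (\<lambda>x. g (f x)) w"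
  using functor_conjs[THEN conjunct2, THEN conjunct2, THEN conjunct2, THEN conjunct2] by simp

lemma eta_in [simp]: "\<lbrakk>small X; x \<in> X\<rbrakk> \<Longrightarrow> eta \<T> X x \<in> Tob \<T> X"
  and mu_in: "\<lbrakk>W \<in> Tob \<T> (Tob \<T> X); small X\<rbrakk> \<Longrightarrow> mu \<T> X W \<in> Tob \<T> X"
  using set_monad by (auto simp: set_monad_def)

lemma Tmap_eta:
  "\<lbrakk>f \<in> X \<rightarrow> Y; small X; small Y; x \<in> X\<rbrakk> \<Longrightarrow> Tmap \<T> X Y f (eta \<T> X x) = eta \<T> Y (f x)"
  using monad_conjs[THEN conjunct2, THEN conjunct2, THEN conjunct1] by simp

lemma Tmap_mu:
  "\<lbrakk>f \<in> X \<rightarrow> Y; small X; small Y; W \<in> Tob \<T> (Tob \<T> X)\<rbrakk>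
   \<Longrightarrow> Tmap \<T> X Y f (mu \<T> X W) = mu \<T> Y (Tmap \<T> (Tob \<T> X) (Tob \<T> Y) (Tmap \<T> X Y f) W)"
  using monad_conjs[THEN conjunct2, THEN conjunct2, THEN conjunct1] by simp

lemma mu_eta [simp]: "\<lbrakk>small X; w \<in> Tob \<T> X\<rbrakk> \<Longrightarrow> mu \<T> X (eta \<T> (Tob \<T> X) w) = w"
  and mu_Tmap_eta: "\<lbrakk>small X; w \<in> Tob \<T> X\<rbrakk> \<Longrightarrow> mu \<T> X (Tmap \<T> X (Tob \<T> X) (eta \<T> X) w) = w"
  and mu_assoc: "\<lbrakk>small X; W \<in> Tob \<T> (Tob \<T> (Tob \<T> X))\<rbrakk> \<Longrightarrow>
      mu \<T> X (Tmap \<T> (Tob \<T> (Tob \<T> X)) (Tob \<T> X) (mu \<T> X) W) = mu \<T> X (mu \<T> (Tob \<T> X) W)"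
  using monad_conjs[THEN conjunct2, THEN conjunct2, THEN conjunct2] by blast+

lemma T_algebra_free: "small X \<Longrightarrow> T_algebra \<T> (Tob \<T> X) (mu \<T> X)"
  by (simp add: T_algebra_def mu_assoc) (blast intro: mu_in)

lemma T_algebra_Vset: "T_algebra \<T> (Vset \<T>) (\<lambda>w. val \<T> (xi \<T> w))"
  using strict by (simp add: strict_topological_theory_def)

lemma weak_pullback:
  assumes "pullback_square P X Y Z p q f g" "small P" "small X" "small Y" "small Z"
    and "x \<in> Tob \<T> X" "y \<in> Tob \<T> Y" "Tmap \<T> X Z f x = Tmap \<T> Y Z g y"
  obtains w where "w \<in> Tob \<T> P" "Tmap \<T> P X p w = x" "Tmap \<T> P Y q w = y"
proof -
  have "weak_pullback_square (Tob \<T> P) (Tob \<T> X) (Tob \<T> Y) (Tob \<T> Z)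
        (Tmap \<T> P X p) (Tmap \<T> P Y q) (Tmap \<T> X Z f) (Tmap \<T> Y Z g)"
    using strict_conjs[THEN conjunct2, THEN conjunct2, THEN conjunct2, THEN conjunct1] assms(1-5)
      by blast
  then show ?thesis using that assms(6-8) unfolding weak_pullback_square_def by blast
qed

lemma mu_weak_pullback:
  assumes "f \<in> X \<rightarrow> Y" "small X" "small Y"
    and "w \<in> Tob \<T> X" "W \<in> Tob \<T> (Tob \<T> Y)" "Tmap \<T> X Y f w = mu \<T> Y W"
  obtains U where "U \<in> Tob \<T> (Tob \<T> X)" "mu \<T> X U = w"
    "Tmap \<T> (Tob \<T> X) (Tob \<T> Y) (Tmap \<T> X Y f) U = W"
proof -
  have "weak_pullback_square (Tob \<T> (Tob \<T> X)) (Tob \<T> X) (Tob \<T> (Tob \<T> Y)) (Tob \<T> Y)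
        (mu \<T> X) (Tmap \<T> (Tob \<T> X) (Tob \<T> Y) (Tmap \<T> X Y f))
        (Tmap \<T> X Y f) (mu \<T> Y)"
    using strict_conjs[THEN conjunct2, THEN conjunct2, THEN conjunct2, THEN conjunct2, THEN
        conjunct1] assms(1-3)
      by blast
  then show ?thesis using that assms(4-6) unfolding weak_pullback_square_def by blast
qed

section \<open>Consequences of T 1 = 1 and of the weak pullback conditions\<close>

abbreviation pt1 :: 'u where "pt1 \<equiv> code {}"

lemma pt1_in [simp]: "pt1 \<in> one_set" by (simp add: one_set_def)

lemma one_setD: "x \<in> one_set \<Longrightarrow> x = pt1" by (simp add: one_set_def)

lemma Tob_one: "Tob \<T> one_set = {eta \<T> one_set pt1}"
proof -
  obtain t where "Tob \<T> one_set = {t}"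
    using T_one unfolding T_one_def is_singleton_def by blast
  with eta_in[OF small_one_set pt1_in] show ?thesis by simp
qed

text \<open>A constant map factors through the one-element set, and T of that set contains only the
  unit at its point. Through this equation T 1 = 1 lets constants pass through
  \<open>xiT\<close>.\<close>

lemma Tmap_const:
  assumes "w \<in> Tob \<T> X" "c \<in> Y" "small X" "small Y"
  shows "Tmap \<T> X Y (\<lambda>_. c) w = eta \<T> Y c"
proof -
  have 1: "(\<lambda>_. pt1) \<in> X \<rightarrow> one_set" "(\<lambda>_. c) \<in> one_set \<rightarrow> Y" using assms by auto
  then have "Tmap \<T> X one_set (\<lambda>_. pt1) w = eta \<T> one_set pt1"
    using Tmap_in[OF assms(1) 1(1)] assms Tob_one by auto
  then show ?thesis
    using Tmap_Tmap[OF assms(1) 1] Tmap_eta[OF 1(2)] assms by simp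
qed

lemma xiT_cong:
  assumes "\<And>x. x \<in> X \<Longrightarrow> \<phi> x = \<phi>' x" "small X" "w \<in> Tob \<T> X"
  shows "xiT \<T> X \<phi> w = xiT \<T> X \<phi>' w"
  unfolding xiT_def by (subst Tmap_cong[of X _ "\<lambda>x. val \<T> (\<phi>' x)"]) (use assms in auto)

lemma xiT_Tmap:
  assumes "w \<in> Tob \<T> X" "f \<in> X \<rightarrow> Y" "small X" "small Y"
  shows "xiT \<T> Y \<phi> (Tmap \<T> X Y f w) = xiT \<T> X (\<lambda>x. \<phi> (f x)) w"
  unfolding xiT_def by (subst Tmap_Tmap) (use assms in auto)

lemma xiT_mono:
  assumes "\<And>x. x \<in> X \<Longrightarrow> \<phi> x \<le> \<phi>' x" "small X" "w \<in> Tob \<T> X"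
  shows "xiT \<T> X \<phi> w \<le> xiT \<T> X \<phi>' w"
  using strict_conjs[THEN conjunct2, THEN conjunct2, THEN conjunct2, THEN conjunct2, THEN
      conjunct2, THEN conjunct2, THEN conjunct2, THEN conjunct2, THEN conjunct1] assms
      by blast

lemma xiT_eta [simp]:
  assumes "small X" "x \<in> X"
  shows "xiT \<T> X \<phi> (eta \<T> X x) = \<phi> x"
proof -
  have "val \<T> (xi \<T> (eta \<T> (Vset \<T>) (val \<T> (\<phi> x)))) = val \<T> (\<phi> x)"
    using T_algebra_Vset by (simp add: T_algebra_def)
  then show ?thesis using assms inj_val
    by (simp add: xiT_def Tmap_eta inj_eq)
qed

lemma xiT_const [simp]:
  assumes "small X" "w \<in> Tob \<T> X"
  shows "xiT \<T> X (\<lambda>_. v) w = v"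
proof -
  have "xiT \<T> X (\<lambda>_. v) w = xiT \<T> one_set (\<lambda>_. v) (Tmap \<T> X one_set (\<lambda>_. pt1) w)"
    using assms by (simp add: xiT_Tmap)
  also have "\<dots> = v" using assms by (simp add: Tmap_const)
  finally show ?thesis .
qed

text \<open>The algebra law of \<open>xi\<close> and naturality of m make \<xi> . T \<phi> a
  homomorphism from the free algebra T X to V.\<close>

lemma xiT_mu:
  assumes "small X" "W \<in> Tob \<T> (Tob \<T> X)"
  shows "xiT \<T> X \<phi> (mu \<T> X W) = xiT \<T> (Tob \<T> X) (xiT \<T> X \<phi>) W"
proof -
  let ?f = "\<lambda>x. val \<T> (\<phi> x)" and ?V = "Vset \<T>"
  let ?W = "Tmap \<T> (Tob \<T> X) (Tob \<T> ?V) (Tmap \<T> X ?V ?f) W"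
  have f: "?f \<in> X \<rightarrow> ?V" by simp
  have Tf: "Tmap \<T> X ?V ?f \<in> Tob \<T> X \<rightarrow> Tob \<T> ?V" using assms Tmap_in by auto
  have "?W \<in> Tob \<T> (Tob \<T> ?V)" using assms Tf by (intro Tmap_in) auto
  then have "val \<T> (xi \<T> (Tmap \<T> (Tob \<T> ?V) ?V (\<lambda>w. val \<T> (xi \<T> w)) ?W)) =
    val \<T> (xi \<T> (mu \<T> ?V ?W))"
    using T_algebra_Vset by (simp add: T_algebra_def)
  then have "xi \<T> (Tmap \<T> (Tob \<T> ?V) ?V (\<lambda>w. val \<T> (xi \<T> w)) ?W) = xi \<T> (mu \<T> ?V ?W)"
    using inj_val by (simp add: inj_eq)
  then show ?thesis
    using assms f Tf by (simp add: xiT_def Tmap_mu Tmap_Tmap)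
qed

lemma xiT_mult:
  assumes "small X" "w \<in> Tob \<T> X"
  shows "xiT \<T> X (\<lambda>x. \<phi> x * \<psi> x) w = xiT \<T> X \<phi> w * xiT \<T> X \<psi> w"
proof -
  let ?V = "Vset \<T>" let ?VV = "cprod ?V ?V"
  let ?f = "\<lambda>x. cpair (val \<T> (\<phi> x)) (val \<T> (\<psi> x))"
  let ?w = "Tmap \<T> X ?VV ?f w"
  have VV: "small ?VV" by (simp add: small_cprod)
  have f: "?f \<in> X \<rightarrow> ?VV" by simp
  have cf: "cfst \<in> ?VV \<rightarrow> ?V" "csnd \<in> ?VV \<rightarrow> ?V" by auto
  have "?w \<in> Tob \<T> ?VV" using assms f VV by (intro Tmap_in)
  then have "xiT \<T> ?VV (\<lambda>p. unval \<T> (cfst p) * unval \<T> (csnd p)) ?w =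
      xi \<T> (Tmap \<T> ?VV ?V cfst ?w) * xi \<T> (Tmap \<T> ?VV ?V csnd ?w)"
    using strict_conjs[THEN conjunct2, THEN conjunct2, THEN conjunct2, THEN conjunct2, THEN
        conjunct2, THEN conjunct2, THEN conjunct1] by blast
  then show ?thesis
    using assms VV f cf by (simp add: xiT_Tmap Tmap_Tmap) (simp add: xiT_def)
qed

lemma xiT_push:
  assumes "f \<in> X \<rightarrow> Y" "small X" "small Y" "w \<in> Tob \<T> Y"
  shows "xiT \<T> Y (\<lambda>y. Sup {\<phi> x |x. x \<in> X \<and> f x = y}) w =
    Sup {xiT \<T> X \<phi> u |u. u \<in> Tob \<T> X \<and> Tmap \<T> X Y f u = w}"
proof -
  have "xiT \<T> Y (push_forward X f \<phi>) w = push_forward (Tob \<T> X) (Tmap \<T> X Y f) (xiT \<T> X \<phi>) w"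
    using strict_conjs[THEN conjunct2, THEN conjunct2, THEN conjunct2, THEN conjunct2, THEN
        conjunct2, THEN conjunct2, THEN conjunct2, THEN conjunct2, THEN conjunct2] assms
      by blast
  then show ?thesis by (simp add: push_forward_def[abs_def])
qed

abbreviation xm :: "'u set \<Rightarrow> 'u set \<Rightarrow> ('u \<times> 'u \<Rightarrow> 'v) \<Rightarrow> 'u \<Rightarrow> 'v" where
  "xm A B r \<equiv> xiT \<T> (cprod A B) (\<lambda>p. r (cfst p, csnd p))"

abbreviation T1 :: "'u set \<Rightarrow> 'u set \<Rightarrow> 'u \<Rightarrow> 'u" where
  "T1 A B \<equiv> Tmap \<T> (cprod A B) A cfst"

abbreviation T2 :: "'u set \<Rightarrow> 'u set \<Rightarrow> 'u \<Rightarrow> 'u" where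
  "T2 A B \<equiv> Tmap \<T> (cprod A B) B csnd"

text \<open>The slice {a} x B is the pullback of \<open>cfst\<close> along the point a, so the weak
  pullback yields an element of T B mapped to W by T(a, -). Applying the second projection
  identifies that element.\<close>

lemma T_cprod_eta_fst:
  assumes W: "W \<in> Tob \<T> (cprod A B)" and a: "a \<in> A" and s: "small A" "small B"
    and e: "Tmap \<T> (cprod A B) A cfst W = eta \<T> A a"
  shows "W = Tmap \<T> B (cprod A B) (\<lambda>b. cpair a b) (Tmap \<T> (cprod A B) B csnd W)"
proof -
  have sq: "pullback_square B (cprod A B) one_set A (cpair a) (\<lambda>_. pt1) cfst (\<lambda>_. a)"
    using a unfolding pullback_square_def commuting_square_def
    by (auto elim!: cprodE dest!: one_setD)
  have "Tmap \<T> (cprod A B) A cfst W = Tmap \<T> one_set A (\<lambda>_. a) (eta \<T> one_set pt1)"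
    using e a s by (simp add: Tmap_const)
  then obtain w where w: "w \<in> Tob \<T> B" "Tmap \<T> B (cprod A B) (cpair a) w = W"
    using weak_pullback[OF sq] W s by (metis small_cprod small_one_set eta_in pt1_in)
  have "Tmap \<T> (cprod A B) B csnd W = w"
    unfolding w(2)[symmetric] using s a w(1) by (subst Tmap_Tmap) (auto simp: small_cprod Tmap_ident)
  then show ?thesis using w(2) by simp
qed

lemma T_cprod_eta_snd:
  assumes W: "W \<in> Tob \<T> (cprod A B)" and b: "b \<in> B" and s: "small A" "small B"
    and e: "Tmap \<T> (cprod A B) B csnd W = eta \<T> B b"
  shows "W = Tmap \<T> A (cprod A B) (\<lambda>a. cpair a b) (Tmap \<T> (cprod A B) A cfst W)"
proof -
  have sq: "pullback_square A (cprod A B) one_set B (\<lambda>a. cpair a b) (\<lambda>_. pt1) csnd (\<lambda>_. b)"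
    using b unfolding pullback_square_def commuting_square_def
    by (auto elim!: cprodE dest!: one_setD)
  have "Tmap \<T> (cprod A B) B csnd W = Tmap \<T> one_set B (\<lambda>_. b) (eta \<T> one_set pt1)"
    using e b s by (simp add: Tmap_const)
  then obtain w where w: "w \<in> Tob \<T> A" "Tmap \<T> A (cprod A B) (\<lambda>a. cpair a b) w = W"
    using weak_pullback[OF sq] W s by (metis small_cprod small_one_set eta_in pt1_in)
  have "Tmap \<T> (cprod A B) A cfst W = w"
    unfolding w(2)[symmetric] using s b w(1) by (subst Tmap_Tmap) (auto simp: small_cprod Tmap_ident)
  then show ?thesis using w(2) by simp
qed

text \<open>X x I is the pullback of the second projection of X x B along t, and T sends it to a
  weak pullback.\<close>

lemma T_cprod_lift_snd:
  assumes q: "q \<in> Tob \<T> (cprod X B)" and i: "i \<in> Tob \<T> I" and t: "t \<in> I \<rightarrow> B"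
    and s: "small X" "small B" "small I"
    and e: "Tmap \<T> (cprod X B) B csnd q = Tmap \<T> I B t i"
  obtains r where "r \<in> Tob \<T> (cprod X I)" "Tmap \<T> (cprod X I) I csnd r = i"
    "q = Tmap \<T> (cprod X I) (cprod X B) (\<lambda>z. cpair (cfst z) (t (csnd z))) r"
proof -
  have "\<exists>!w. w \<in> cprod X I \<and> cpair (cfst w) (t (csnd w)) = x \<and> csnd w = j"
    if "x \<in> cprod X B" "j \<in> I" "csnd x = t j" for x j
    using that by (intro ex1I[of _ "cpair (cfst x) j"]) (auto elim!: cprodE)
  then have sq: "pullback_square (cprod X I) (cprod X B) I B
      (\<lambda>z. cpair (cfst z) (t (csnd z))) csnd csnd t"
    using t by (auto simp: pullback_square_def commuting_square_def elim!: cprodE)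
  obtain r where "r \<in> Tob \<T> (cprod X I)" "T2 X I r = i"
    "Tmap \<T> (cprod X I) (cprod X B) (\<lambda>z. cpair (cfst z) (t (csnd z))) r = q"
    by (rule weak_pullback[OF sq _ _ _ _ q i e]) (use s in \<open>auto simp: small_cprod\<close>)
  then show ?thesis using that by blast
qed

text \<open>In the naturality square of m at the point y from 1 to Y, the weak pullback lifts W to T
  T 1. Since T 1 is a singleton, the map T y is constant with value e(y), so W is the unit at
  e(y).\<close>

lemma mu_eq_eta:
  assumes W: "W \<in> Tob \<T> (Tob \<T> Y)" and y: "y \<in> Y" and s: "small Y"
    and e: "mu \<T> Y W = eta \<T> Y y"
  shows "W = eta \<T> (Tob \<T> Y) (eta \<T> Y y)"
proof -
  let ?t = "eta \<T> one_set pt1"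
  have f: "(\<lambda>_. y) \<in> one_set \<rightarrow> Y" using y by simp
  have "Tmap \<T> one_set Y (\<lambda>_. y) ?t = mu \<T> Y W" using e y s by (simp add: Tmap_const)
  then obtain U where U: "U \<in> Tob \<T> (Tob \<T> one_set)"
    "Tmap \<T> (Tob \<T> one_set) (Tob \<T> Y) (Tmap \<T> one_set Y (\<lambda>_. y)) U = W"
    using mu_weak_pullback[OF f _ _ _ W] s by (metis eta_in pt1_in small_one_set)
  have "Tmap \<T> (Tob \<T> one_set) (Tob \<T> Y) (Tmap \<T> one_set Y (\<lambda>_. y)) U =
    Tmap \<T> (Tob \<T> one_set) (Tob \<T> Y) (\<lambda>_. eta \<T> Y y) U"
    using s y U(1) by (intro Tmap_cong) (auto simp: Tmap_const)
  also have "\<dots> = eta \<T> (Tob \<T> Y) (eta \<T> Y y)" using s y U(1) by (simp add: Tmap_const)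
  finally show ?thesis using U(2) by simp
qed

section \<open>Kleisli composition, tested on elements of T(A x B)\<close>

lemma T1_in: "\<lbrakk>U \<in> Tob \<T> (cprod A B); small A; small B\<rbrakk> \<Longrightarrow> T1 A B U \<in> Tob \<T> A"
  and T2_in: "\<lbrakk>U \<in> Tob \<T> (cprod A B); small A; small B\<rbrakk> \<Longrightarrow> T2 A B U \<in> Tob \<T> B"
  by (rule Tmap_in; auto simp: small_cprod)+

lemma pairing:
  assumes "w \<in> Tob \<T> C" "f \<in> C \<rightarrow> A" "g \<in> C \<rightarrow> B" "small A" "small B" "small C"
  shows "Tmap \<T> C (cprod A B) (\<lambda>c. cpair (f c) (g c)) w \<in> Tob \<T> (cprod A B)"
    and "T1 A B (Tmap \<T> C (cprod A B) (\<lambda>c. cpair (f c) (g c)) w) = Tmap \<T> C A f w"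
    and "T2 A B (Tmap \<T> C (cprod A B) (\<lambda>c. cpair (f c) (g c)) w) = Tmap \<T> C B g w"
    and "xm A B r (Tmap \<T> C (cprod A B) (\<lambda>c. cpair (f c) (g c)) w) =
      xiT \<T> C (\<lambda>c. r (f c, g c)) w"
proof -
  have fg: "(\<lambda>c. cpair (f c) (g c)) \<in> C \<rightarrow> cprod A B" using assms by auto
  show "Tmap \<T> C (cprod A B) (\<lambda>c. cpair (f c) (g c)) w \<in> Tob \<T> (cprod A B)"
    using assms fg by (intro Tmap_in) (auto simp: small_cprod)
  show "T1 A B (Tmap \<T> C (cprod A B) (\<lambda>c. cpair (f c) (g c)) w) = Tmap \<T> C A f w"
    "T2 A B (Tmap \<T> C (cprod A B) (\<lambda>c. cpair (f c) (g c)) w) = Tmap \<T> C B g w"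
    using assms fg by (subst Tmap_Tmap; auto simp: small_cprod)+
  show "xm A B r (Tmap \<T> C (cprod A B) (\<lambda>c. cpair (f c) (g c)) w) =
      xiT \<T> C (\<lambda>c. r (f c, g c)) w"
    using assms fg by (subst xiT_Tmap) (auto simp: small_cprod)
qed

text \<open>The supremum over pairs (W, y) and the inner supremum defining \<open>T_xi\<close>, over
  the U above such a pair, merge into one supremum over U, because the tensor distributes over
  suprema.\<close>

lemma kcomp_apply:
  assumes "z \<in> Tob \<T> Z" "x \<in> X" "small Y" "small Z"
  shows "kcomp \<T> X Y Z \<beta> \<alpha> (z, x) =
    (SUP U\<in>{U \<in> Tob \<T> (cprod (Tob \<T> Z) Y). mu \<T> Z (T1 (Tob \<T> Z) Y U) = z}.
      xm (Tob \<T> Z) Y \<beta> U * \<alpha> (T2 (Tob \<T> Z) Y U, x))" (is "_ = ?R")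
proof (rule order_antisym)
  have "T_xi \<T> (Tob \<T> Z) Y \<beta> (W, y) * \<alpha> (y, x) \<le> ?R"
    if W: "W \<in> Tob \<T> (Tob \<T> Z)" "y \<in> Tob \<T> Y" "mu \<T> Z W = z" for W y
  proof -
    have "T_xi \<T> (Tob \<T> Z) Y \<beta> (W, y) =
      (SUP U\<in>{U \<in> Tob \<T> (cprod (Tob \<T> Z) Y). T1 (Tob \<T> Z) Y U = W \<and> T2 (Tob \<T> Z) Y U = y}.
        xm (Tob \<T> Z) Y \<beta> U)"
      using W by (simp add: T_xi_def setcompr_eq_image)
    moreover have "xm (Tob \<T> Z) Y \<beta> U * \<alpha> (y, x) \<le> ?R"
      if "U \<in> Tob \<T> (cprod (Tob \<T> Z) Y)" "T1 (Tob \<T> Z) Y U = W" "T2 (Tob \<T> Z) Y U = y" for U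
      using that W by (intro SUP_upper2[of U]) auto
    ultimately show ?thesis by (auto simp: quantale_SUP_mult intro!: SUP_least)
  qed
  then show "kcomp \<T> X Y Z \<beta> \<alpha> (z, x) \<le> ?R"
    using assms by (auto simp: kcomp_def intro!: Sup_least)
  have "xm (Tob \<T> Z) Y \<beta> U * \<alpha> (T2 (Tob \<T> Z) Y U, x) \<le> kcomp \<T> X Y Z \<beta> \<alpha> (z, x)"
    if U: "U \<in> Tob \<T> (cprod (Tob \<T> Z) Y)" "mu \<T> Z (T1 (Tob \<T> Z) Y U) = z" for U
  proof -
    have i: "T1 (Tob \<T> Z) Y U \<in> Tob \<T> (Tob \<T> Z)" "T2 (Tob \<T> Z) Y U \<in> Tob \<T> Y"
      using U assms by (auto intro!: T1_in T2_in)
    have "xm (Tob \<T> Z) Y \<beta> U \<le> T_xi \<T> (Tob \<T> Z) Y \<beta> (T1 (Tob \<T> Z) Y U, T2 (Tob \<T> Z) Y U)"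
      using U i by (auto simp: T_xi_def intro!: Sup_upper)
    then have "xm (Tob \<T> Z) Y \<beta> U * \<alpha> (T2 (Tob \<T> Z) Y U, x) \<le>
      T_xi \<T> (Tob \<T> Z) Y \<beta> (T1 (Tob \<T> Z) Y U, T2 (Tob \<T> Z) Y U) * \<alpha> (T2 (Tob \<T> Z) Y U, x)"
      by (intro quantale_mult_mono) simp_all
    also have "\<dots> \<le> kcomp \<T> X Y Z \<beta> \<alpha> (z, x)"
      using assms i U(2) by (auto simp: kcomp_def intro!: Sup_upper)
    finally show ?thesis .
  qed
  then show "?R \<le> kcomp \<T> X Y Z \<beta> \<alpha> (z, x)" by (auto intro!: SUP_least)
qed

lemma extensional_le_iff:
  fixes f g :: "'a \<times> 'b \<Rightarrow> 'w::order"
  assumes "f \<in> extensional (A \<times> B)" "g \<in> extensional (A \<times> B)"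
  shows "f \<le> g \<longleftrightarrow> (\<forall>a\<in>A. \<forall>b\<in>B. f (a, b) \<le> g (a, b))"
  using assms unfolding le_fun_def extensional_def by fastforce

lemma kcomp_extensional: "kcomp \<T> X Y Z \<beta> \<alpha> \<in> extensional (Tob \<T> Z \<times> X)"
  by (simp add: kcomp_def)

text \<open>U determines the element of T Z at which the composite is tested, so a bound on the
  composite is one inequality for each U and x.\<close>

lemma kcomp_le_iff:
  assumes "\<gamma> \<in> extensional (Tob \<T> Z \<times> X)" "small Y" "small Z"
  shows "kcomp \<T> X Y Z \<beta> \<alpha> \<le> \<gamma> \<longleftrightarrow>
    (\<forall>U\<in>Tob \<T> (cprod (Tob \<T> Z) Y). \<forall>x\<in>X.
      xm (Tob \<T> Z) Y \<beta> U * \<alpha> (T2 (Tob \<T> Z) Y U, x) \<le> \<gamma> (mu \<T> Z (T1 (Tob \<T> Z) Y U), x))"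
proof -
  have "mu \<T> Z (T1 (Tob \<T> Z) Y U) \<in> Tob \<T> Z" if "U \<in> Tob \<T> (cprod (Tob \<T> Z) Y)" for U
    using that assms by (intro mu_in T1_in) auto
  then show ?thesis
    unfolding extensional_le_iff[OF kcomp_extensional assms(1)]
    using assms by (auto simp: kcomp_apply SUP_le_iff)
qed

lemma T_category_iff:
  "T_category \<T> X \<longleftrightarrow> T_graph \<T> X \<and>
    (\<forall>U\<in>Tob \<T> (cprod (Tob \<T> (pts X)) (pts X)). \<forall>x\<in>pts X.
      xm (Tob \<T> (pts X)) (pts X) (str X) U * str X (T2 (Tob \<T> (pts X)) (pts X) U, x) \<le>
      str X (mu \<T> (pts X) (T1 (Tob \<T> (pts X)) (pts X) U), x))"
  unfolding T_category_def by (auto simp: T_graph_def kcomp_le_iff)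

section \<open>The one-point category E and adjunctions between E and a graph\<close>

lemma T_category_E: "T_category \<T> (E_obj \<T>)"
proof -
  have "xm (Tob \<T> one_set) one_set (str (E_obj \<T>)) U = 1"
    if "U \<in> Tob \<T> (cprod (Tob \<T> one_set) one_set)" for U
  proof -
    have "xm (Tob \<T> one_set) one_set (str (E_obj \<T>)) U =
      xiT \<T> (cprod (Tob \<T> one_set) one_set) (\<lambda>_. 1) U"
      using that by (intro xiT_cong) (auto simp: E_obj_def small_cprod elim!: cprodE)
    then show ?thesis using that by (simp add: small_cprod)
  qed
  then show ?thesis
    unfolding T_category_iff T_graph_def by (simp add: E_obj_def T2_in mu_in T1_in)
qed

text \<open>
  \<open>E_adj X f g\<close> is the adjunction \<open>f \<stileturn> g\<close> between \<open>E\<close> and \<open>X\<close> with the trivial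
  components at \<open>E\<close> removed.
\<close>

definition stable :: "('u, 'v) graph \<Rightarrow> ('u \<Rightarrow> 'v) \<Rightarrow> bool" where
  "stable X p \<longleftrightarrow> (\<forall>w\<in>Tob \<T> (pts X). \<forall>x\<in>pts X. xiT \<T> (pts X) p w * str X (w, x) \<le> p x)"

definition E_adj :: "('u, 'v) graph \<Rightarrow> ('u \<Rightarrow> 'v) \<Rightarrow> ('u \<Rightarrow> 'v) \<Rightarrow> bool" where
  "E_adj X f g \<longleftrightarrow>
    (\<forall>W\<in>Tob \<T> (Tob \<T> (pts X)). xiT \<T> (Tob \<T> (pts X)) f W \<le> f (mu \<T> (pts X) W)) \<and>
    (\<forall>U\<in>Tob \<T> (cprod (Tob \<T> (pts X)) (pts X)).
      xm (Tob \<T> (pts X)) (pts X) (str X) U * f (T2 (Tob \<T> (pts X)) (pts X) U) \<le>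
      f (mu \<T> (pts X) (T1 (Tob \<T> (pts X)) (pts X) U))) \<and>
    stable X g \<and>
    1 \<le> (SUP w\<in>Tob \<T> (pts X). xiT \<T> (pts X) g w * f w) \<and>
    (\<forall>w\<in>Tob \<T> (pts X). \<forall>x\<in>pts X. f w * g x \<le> str X (w, x))"

text \<open>The first projection of A x 1 is a bijection, so its image under T is onto and the
  matrix value factors through it. The predicate P lets the same transfer serve several inequalities
  of \<open>T_adjunction\<close>.\<close>

lemma T_cprod_one:
  assumes "small A"
  shows "(\<forall>U\<in>Tob \<T> (cprod A one_set). P (xm A one_set r U) (T1 A one_set U)) \<longleftrightarrow>
    (\<forall>W\<in>Tob \<T> A. P (xiT \<T> A (\<lambda>a. r (a, pt1)) W) W)"
proof -
  have 1: "xm A one_set r U = xiT \<T> A (\<lambda>a. r (a, pt1)) (T1 A one_set U)"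
    if "U \<in> Tob \<T> (cprod A one_set)" for U
    using that assms
    by (subst xiT_Tmap) (auto simp: small_cprod elim!: cprodE dest!: one_setD intro!: xiT_cong)
  have 2: "\<exists>U\<in>Tob \<T> (cprod A one_set). T1 A one_set U = W" if "W \<in> Tob \<T> A" for W
    using pairing(1,2)[of W A "\<lambda>a. a" A "\<lambda>_. pt1" one_set] that assms
    by (auto simp: Tmap_ident)
  show ?thesis
  proof (intro iffI ballI)
    fix w assume *: "\<forall>U\<in>Tob \<T> (cprod A one_set). P (xm A one_set r U) (T1 A one_set U)" and "w \<in> Tob \<T> A"
    then obtain U where U: "U \<in> Tob \<T> (cprod A one_set)" "T1 A one_set U = w" using 2 by blast
    from * U(1) have "P (xm A one_set r U) (T1 A one_set U)" by blast
    then show "P (xiT \<T> A (\<lambda>a. r (a, pt1)) w) w" unfolding 1[OF U(1)] U(2) .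
  next
    fix U assume *: "\<forall>w\<in>Tob \<T> A. P (xiT \<T> A (\<lambda>a. r (a, pt1)) w) w" and U: "U \<in> Tob \<T> (cprod A one_set)"
    have "T1 A one_set U \<in> Tob \<T> A" using U assms by (intro T1_in) auto
    then show "P (xm A one_set r U) (T1 A one_set U)" unfolding 1[OF U] using * by blast
  qed
qed

lemma T_one_cprod:
  assumes "small A"
  shows "(\<forall>U\<in>Tob \<T> (cprod (Tob \<T> one_set) A).
      P (xm (Tob \<T> one_set) A r U) (T2 (Tob \<T> one_set) A U)) \<longleftrightarrow>
    (\<forall>w\<in>Tob \<T> A. P (xiT \<T> A (\<lambda>a. r (eta \<T> one_set pt1, a)) w) w)"
proof -
  let ?O = "Tob \<T> one_set" and ?t = "eta \<T> one_set pt1"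
  have t: "?t \<in> ?O" by simp
  have O: "x = ?t" if "x \<in> ?O" for x using that Tob_one by blast
  have 1: "xm ?O A r U = xiT \<T> A (\<lambda>a. r (?t, a)) (T2 ?O A U)"
    if "U \<in> Tob \<T> (cprod ?O A)" for U
    using that assms
    by (subst xiT_Tmap) (auto simp: small_cprod elim!: cprodE dest!: O intro!: xiT_cong)
  have 2: "\<exists>U\<in>Tob \<T> (cprod ?O A). T2 ?O A U = w" if "w \<in> Tob \<T> A" for w
    using pairing(1,3)[of w A "\<lambda>_. ?t" ?O "\<lambda>a. a" A] that assms t
    by (auto simp: Tmap_ident)
  show ?thesis
  proof (intro iffI ballI)
    fix w assume *: "\<forall>U\<in>Tob \<T> (cprod ?O A). P (xm ?O A r U) (T2 ?O A U)" and "w \<in> Tob \<T> A"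
    then obtain U where U: "U \<in> Tob \<T> (cprod ?O A)" "T2 ?O A U = w" using 2 by blast
    from * U(1) have "P (xm ?O A r U) (T2 ?O A U)" by blast
    then show "P (xiT \<T> A (\<lambda>a. r (?t, a)) w) w" unfolding 1[OF U(1)] U(2) .
  next
    fix U assume *: "\<forall>w\<in>Tob \<T> A. P (xiT \<T> A (\<lambda>a. r (?t, a)) w) w" and U: "U \<in> Tob \<T> (cprod ?O A)"
    have "T2 ?O A U \<in> Tob \<T> A" using U assms by (intro T2_in) auto
    then show "P (xm ?O A r U) (T2 ?O A U)" unfolding 1[OF U] using * by blast
  qed
qed

text \<open>Each composite inequality of the adjunction is tested by \<open>kcomp_le_iff\<close> and
  moved from T(A x 1) or T(T 1 x A) to T A. The action of E on \<psi> holds because its structure is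
  constantly k and T T 1 maps to the single element of T 1.\<close>

lemma T_adjunction_E_iff:
  assumes X: "T_graph \<T> X"
    and \<phi>: "\<phi> \<in> extensional (Tob \<T> (pts X) \<times> one_set)"
    and \<psi>: "\<psi> \<in> extensional (Tob \<T> one_set \<times> pts X)"
  shows "T_adjunction \<T> (E_obj \<T>) X \<phi> \<psi> \<longleftrightarrow>
    E_adj X (\<lambda>w. \<phi> (w, pt1)) (\<lambda>x. \<psi> (eta \<T> one_set pt1, x))"
proof -
  let ?O = "Tob \<T> one_set" and ?t = "eta \<T> one_set pt1" and ?X = "pts X"
  let ?TX = "Tob \<T> ?X" and ?f = "\<lambda>w. \<phi> (w, pt1)" and ?g = "\<lambda>x. \<psi> (eta \<T> one_set pt1, x)"
  have s: "small ?X" "small ?TX" "small ?O" and a: "str X \<in> extensional (?TX \<times> ?X)"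
    using X by (simp_all add: T_graph_def)
  have O: "x = ?t" if "x \<in> ?O" for x using that Tob_one by blast
  have E: "str (E_obj \<T>) (x, pt1) = 1" if "x \<in> ?O" for x
    using that by (simp add: E_obj_def)
  have Eext: "str (E_obj \<T>) \<in> extensional (?O \<times> one_set)" by (simp add: E_obj_def)
  have one: "(\<forall>x\<in>one_set. P x) \<longleftrightarrow> P pt1" for P by (auto simp: one_set_def)
  have "kcomp \<T> one_set one_set ?X \<phi> (str (E_obj \<T>)) \<le> \<phi> \<longleftrightarrow>
    (\<forall>U\<in>Tob \<T> (cprod ?TX one_set). xm ?TX one_set \<phi> U \<le> ?f (mu \<T> ?X (T1 ?TX one_set U)))"
    using \<phi> s by (simp add: kcomp_le_iff one E T2_in)
  then have 1: "kcomp \<T> one_set one_set ?X \<phi> (str (E_obj \<T>)) \<le> \<phi> \<longleftrightarrow>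
    (\<forall>W\<in>Tob \<T> ?TX. xiT \<T> ?TX ?f W \<le> ?f (mu \<T> ?X W))"
    using T_cprod_one[OF s(2), of "\<lambda>v W. v \<le> ?f (mu \<T> ?X W)" \<phi>] by simp
  have 2: "kcomp \<T> one_set ?X ?X (str X) \<phi> \<le> \<phi> \<longleftrightarrow>
    (\<forall>U\<in>Tob \<T> (cprod ?TX ?X). xm ?TX ?X (str X) U * ?f (T2 ?TX ?X U) \<le>
      ?f (mu \<T> ?X (T1 ?TX ?X U)))"
    using \<phi> s by (simp add: kcomp_le_iff one)
  have mu: "mu \<T> one_set (T1 ?O A U) = ?t" if "U \<in> Tob \<T> (cprod ?O A)" "small A" for U A
    using that by (intro O mu_in T1_in) auto
  have "kcomp \<T> ?X ?X one_set \<psi> (str X) \<le> \<psi> \<longleftrightarrow>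
    (\<forall>U\<in>Tob \<T> (cprod ?O ?X). \<forall>x\<in>?X. xm ?O ?X \<psi> U * str X (T2 ?O ?X U, x) \<le> ?g x)"
    using \<psi> s by (simp add: kcomp_le_iff mu)
  then have 3: "kcomp \<T> ?X ?X one_set \<psi> (str X) \<le> \<psi> \<longleftrightarrow> stable X ?g"
    using T_one_cprod[OF s(1), of "\<lambda>v w. \<forall>x\<in>?X. v * str X (w, x) \<le> ?g x" \<psi>]
    by (simp add: stable_def)
  have "xm ?O one_set (str (E_obj \<T>)) U = 1" if "U \<in> Tob \<T> (cprod ?O one_set)" for U
  proof -
    have "xm ?O one_set (str (E_obj \<T>)) U = xiT \<T> (cprod ?O one_set) (\<lambda>_. 1) U"
      using that by (intro xiT_cong) (auto simp: E_obj_def small_cprod elim!: cprodE)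
    then show ?thesis using that by (simp add: small_cprod)
  qed
  moreover have "T2 ?O one_set U = ?t" if "U \<in> Tob \<T> (cprod ?O one_set)" for U
    using that by (intro O T2_in) auto
  ultimately have 4: "kcomp \<T> ?X one_set one_set (str (E_obj \<T>)) \<psi> \<le> \<psi>"
    using \<psi> s by (simp add: kcomp_le_iff mu)
  \<comment> \<open>Everything in T(T 1 x X) lies over the only element of T 1, so the fibre in
    \<open>kcomp_apply\<close> is the whole set.\<close>
  have all: "{U \<in> Tob \<T> (cprod ?O ?X). mu \<T> one_set (T1 ?O ?X U) = ?t} = Tob \<T> (cprod ?O ?X)"
    using mu s by auto
  have "(SUP U\<in>{U \<in> Tob \<T> (cprod ?O ?X). mu \<T> one_set (T1 ?O ?X U) = ?t}.
      xm ?O ?X \<psi> U * \<phi> (T2 ?O ?X U, pt1)) =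
    (SUP w\<in>?TX. xiT \<T> ?X ?g w * ?f w)" (is "?S = ?R")
  proof (rule order_antisym)
    have "(\<forall>w\<in>?TX. xiT \<T> ?X ?g w * ?f w \<le> z) \<longleftrightarrow> ?S \<le> z" for z
      using T_one_cprod[OF s(1), of "\<lambda>v w. v * ?f w \<le> z" \<psi>]
      unfolding all SUP_le_iff by (rule sym)
    from this[of ?R] this[of ?S] show "?S \<le> ?R" "?R \<le> ?S"
      by (simp_all add: SUP_le_iff[symmetric])
  qed
  then have 5: "str (E_obj \<T>) \<le> kcomp \<T> one_set ?X one_set \<psi> \<phi> \<longleftrightarrow>
      1 \<le> (SUP w\<in>?TX. xiT \<T> ?X ?g w * ?f w)"
    unfolding extensional_le_iff[OF Eext kcomp_extensional]
    using s by (simp add: one Tob_one kcomp_apply E)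
  have "kcomp \<T> ?X one_set ?X \<phi> \<psi> \<le> str X \<longleftrightarrow>
    (\<forall>U\<in>Tob \<T> (cprod ?TX one_set). \<forall>x\<in>?X. xm ?TX one_set \<phi> U * ?g x \<le>
      str X (mu \<T> ?X (T1 ?TX one_set U), x))"
  proof -
    have "T2 ?TX one_set U = ?t" if "U \<in> Tob \<T> (cprod ?TX one_set)" for U
      using that s by (intro O T2_in) auto
    then show ?thesis using a s by (simp add: kcomp_le_iff)
  qed
  then have 6: "kcomp \<T> ?X one_set ?X \<phi> \<psi> \<le> str X \<longleftrightarrow>
    (\<forall>W\<in>Tob \<T> ?TX. \<forall>x\<in>?X. xiT \<T> ?TX ?f W * ?g x \<le> str X (mu \<T> ?X W, x))"
    using T_cprod_one[OF s(2), of "\<lambda>v W. \<forall>x\<in>?X. v * ?g x \<le> str X (mu \<T> ?X W, x)" \<phi>] by simp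
  \<comment> \<open>The counit quantifies over T T X, but in \<open>E_adj\<close> over T X: in one
    direction W is the unit at w, in the other the first clause of \<open>E_adj\<close> bounds \<xi>
    . T f at W by f at its multiplication.\<close>
  have 7: "(\<forall>W\<in>Tob \<T> ?TX. \<forall>x\<in>?X. xiT \<T> ?TX ?f W * ?g x \<le> str X (mu \<T> ?X W, x)) \<longleftrightarrow>
      (\<forall>w\<in>?TX. \<forall>x\<in>?X. ?f w * ?g x \<le> str X (w, x))"
    if f: "\<forall>W\<in>Tob \<T> ?TX. xiT \<T> ?TX ?f W \<le> ?f (mu \<T> ?X W)"
  proof (intro iffI ballI)
    fix w x assume *: "\<forall>W\<in>Tob \<T> ?TX. \<forall>x\<in>?X. xiT \<T> ?TX ?f W * ?g x \<le> str X (mu \<T> ?X W, x)"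
      "w \<in> ?TX" "x \<in> ?X"
    then show "?f w * ?g x \<le> str X (w, x)"
      using *(1)[rule_format, of "eta \<T> ?TX w" x] s by simp
  next
    fix W x assume *: "\<forall>w\<in>?TX. \<forall>x\<in>?X. ?f w * ?g x \<le> str X (w, x)"
      "W \<in> Tob \<T> ?TX" "x \<in> ?X"
    then have "?f (mu \<T> ?X W) * ?g x \<le> str X (mu \<T> ?X W, x)" using s by (simp add: mu_in)
    moreover have "xiT \<T> ?TX ?f W * ?g x \<le> ?f (mu \<T> ?X W) * ?g x"
      using f * by (intro quantale_mult_mono) auto
    ultimately show "xiT \<T> ?TX ?f W * ?g x \<le> str X (mu \<T> ?X W, x)" by (rule order_trans[rotated])
  qed
  have [simp]: "pts (E_obj \<T>) = one_set" by (simp add: E_obj_def)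
  show ?thesis
    unfolding T_adjunction_def T_distributor_def E_adj_def
    using \<phi> \<psi> 1 2 3 4 5 6 7 by auto
qed

lemma Map_E_iff:
  assumes X: "T_graph \<T> X"
  shows "\<phi> \<in> Map_E \<T> X \<longleftrightarrow> \<phi> \<in> extensional (Tob \<T> (pts X) \<times> one_set) \<and>
    (\<exists>g. E_adj X (\<lambda>w. \<phi> (w, pt1)) g)"
proof
  assume "\<phi> \<in> Map_E \<T> X"
  then obtain \<psi> where adj: "T_adjunction \<T> (E_obj \<T>) X \<phi> \<psi>" by (auto simp: Map_E_def)
  then have "\<phi> \<in> extensional (Tob \<T> (pts X) \<times> one_set)"
    "\<psi> \<in> extensional (Tob \<T> one_set \<times> pts X)"
    by (simp_all add: T_adjunction_def T_distributor_def E_obj_def)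
  with adj T_adjunction_E_iff[OF X] show "\<phi> \<in> extensional (Tob \<T> (pts X) \<times> one_set) \<and>
    (\<exists>g. E_adj X (\<lambda>w. \<phi> (w, pt1)) g)" by blast
next
  assume R: "\<phi> \<in> extensional (Tob \<T> (pts X) \<times> one_set) \<and>
    (\<exists>g. E_adj X (\<lambda>w. \<phi> (w, pt1)) g)"
  then obtain g where g: "E_adj X (\<lambda>w. \<phi> (w, pt1)) g" by blast
  \<comment> \<open>The witness g is an arbitrary function, whereas a matrix is
    \<open>extensional\<close>; \<open>stable\<close> and \<open>xiT\<close> see only the values of
    g on X.\<close>
  define \<psi> where "\<psi> = restrict (\<lambda>(t, x). g x) (Tob \<T> one_set \<times> pts X)"
  have X': "small (pts X)" using X by (simp add: T_graph_def)
  have \<psi>: "\<psi> (eta \<T> one_set pt1, x) = g x" if "x \<in> pts X" for x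
    using that by (simp add: \<psi>_def)
  have "xiT \<T> (pts X) (\<lambda>x. \<psi> (eta \<T> one_set pt1, x)) w = xiT \<T> (pts X) g w"
    if "w \<in> Tob \<T> (pts X)" for w
    using that X' \<psi> by (intro xiT_cong) auto
  with g \<psi> have "E_adj X (\<lambda>w. \<phi> (w, pt1)) (\<lambda>x. \<psi> (eta \<T> one_set pt1, x))"
    unfolding E_adj_def stable_def by simp
  moreover have "\<psi> \<in> extensional (Tob \<T> one_set \<times> pts X)" by (simp add: \<psi>_def)
  ultimately have "T_adjunction \<T> (E_obj \<T>) X \<phi> \<psi>"
    using T_adjunction_E_iff[OF X] R by blast
  then show "\<phi> \<in> Map_E \<T> X" by (auto simp: Map_E_def)
qed

end


section \<open>Enriched categories of quantale-valued functions\<close>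

text \<open>
  The points of \<open>A\<close> are functions on \<open>P\<close> (with values \<open>D p x\<close>), closed under pointwise weighted
  limits, and all evaluations are representable. Suprema that exist pointwise are then
  evaluations at representing points, so they commute with limits.
\<close>

locale eval_graph =
  fixes A :: "('a, 'v::comm_quantale) graph" and P :: "'b set" and D :: "'a \<Rightarrow> 'b \<Rightarrow> 'v"
  assumes str_eq: "\<lbrakk>p \<in> pts A; q \<in> pts A\<rbrakk> \<Longrightarrow> str A (p, q) = (INF x\<in>P. qhom (D p x) (D q x))"
    and sep: "\<lbrakk>p \<in> pts A; q \<in> pts A; \<And>x. x \<in> P \<Longrightarrow> D p x = D q x\<rbrakk> \<Longrightarrow> p = q"
    and lim_closed: "S \<subseteq> UNIV \<times> pts A \<Longrightarrow>
      \<exists>c\<in>pts A. \<forall>x\<in>P. D c x = (INF (v, p)\<in>S. qhom v (D p x))"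
    and tensor_closed: "p \<in> pts A \<Longrightarrow> \<exists>t\<in>pts A. \<forall>x\<in>P. D t x = v * D p x"
    and representable: "x \<in> P \<Longrightarrow> \<exists>r\<in>pts A. \<forall>p\<in>pts A. str A (r, p) = D p x"
begin

lemma le_str_iff:
  "\<lbrakk>p \<in> pts A; q \<in> pts A\<rbrakk> \<Longrightarrow> z \<le> str A (p, q) \<longleftrightarrow> (\<forall>x\<in>P. z * D p x \<le> D q x)"
  by (simp add: str_eq le_INF_iff le_qhom_iff)

lemma V_category: "V_category A"
proof -
  have "str A (p, q) * str A (q, r) \<le> str A (p, r)" if "p \<in> pts A" "q \<in> pts A" "r \<in> pts A" for p q r
    unfolding le_str_iff[OF that(1,3)]
  proof
    fix x assume x: "x \<in> P"
    have "str A (p, q) * D p x \<le> D q x" "str A (q, r) * D q x \<le> D r x"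
      using le_str_iff that x by blast+
    then have "str A (q, r) * (str A (p, q) * D p x) \<le> D r x"
      using quantale_mult_mono order_trans by blast
    then show "str A (p, q) * str A (q, r) * D p x \<le> D r x" by (simp add: ac_simps)
  qed
  then show ?thesis by (simp add: V_category_def le_str_iff)
qed

lemma str_refl: "p \<in> pts A \<Longrightarrow> 1 \<le> str A (p, p)"
  by (simp add: le_str_iff)

lemma le_antisym:
  assumes "p \<in> pts A" "q \<in> pts A" "1 \<le> str A (p, q)" "1 \<le> str A (q, p)"
  shows "p = q"
  using assms by (intro sep) (auto simp: le_str_iff intro!: order_antisym)

lemma is_limI:
  assumes h: "\<And>i. i \<in> I \<Longrightarrow> h i \<in> pts A" and c: "c \<in> pts A"
    and D: "\<And>x. x \<in> P \<Longrightarrow> D c x = (INF i\<in>I. qhom (\<phi> i) (D (h i) x))"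
  shows "is_lim A I \<phi> h c"
proof -
  have "str A (y, c) = (INF i\<in>I. qhom (\<phi> i) (str A (y, h i)))" if y: "y \<in> pts A" for y
  proof (rule eq_by_lower_bounds)
    fix z
    have "z \<le> str A (y, c) \<longleftrightarrow> (\<forall>x\<in>P. \<forall>i\<in>I. z * \<phi> i * D y x \<le> D (h i) x)"
      using y c by (simp add: le_str_iff D le_INF_iff le_qhom_iff[symmetric] ac_simps)
    also have "\<dots> \<longleftrightarrow> (\<forall>i\<in>I. z * \<phi> i \<le> str A (y, h i))"
      using y h by (auto simp: le_str_iff)
    also have "\<dots> \<longleftrightarrow> z \<le> (INF i\<in>I. qhom (\<phi> i) (str A (y, h i)))"
      by (simp add: le_INF_iff le_qhom_iff)
    finally show "z \<le> str A (y, c) \<longleftrightarrow> z \<le> (INF i\<in>I. qhom (\<phi> i) (str A (y, h i)))" .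
  qed
  with c show ?thesis by (simp add: is_lim_def)
qed

lemma lim_exists:
  assumes "\<And>i. i \<in> I \<Longrightarrow> h i \<in> pts A"
  obtains c where "c \<in> pts A" "\<And>x. x \<in> P \<Longrightarrow> D c x = (INF i\<in>I. qhom (\<phi> i) (D (h i) x))"
proof -
  have "(\<lambda>i. (\<phi> i, h i)) ` I \<subseteq> UNIV \<times> pts A" using assms by auto
  from lim_closed[OF this] that show ?thesis by (auto simp: image_image)
qed

lemma is_lim_unique:
  assumes "is_lim A I \<phi> h c" "is_lim A I \<phi> h c'"
  shows "c = c'"
proof -
  have c: "c \<in> pts A" "c' \<in> pts A" "\<And>y. y \<in> pts A \<Longrightarrow> str A (y, c) = str A (y, c')"
    using assms by (simp_all add: is_lim_def)
  with str_refl[OF c(1)] str_refl[OF c(2)] show ?thesis by (intro le_antisym) simp_all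
qed

text \<open>A pointwise limit always exists by \<open>lim_closed\<close>, and limits are unique
  because points with the same values coincide; hence any limit is the pointwise one.\<close>

lemma is_lim_iff:
  assumes h: "\<And>i. i \<in> I \<Longrightarrow> h i \<in> pts A"
  shows "is_lim A I \<phi> h c \<longleftrightarrow>
    c \<in> pts A \<and> (\<forall>x\<in>P. D c x = (INF i\<in>I. qhom (\<phi> i) (D (h i) x)))"
proof
  assume c: "is_lim A I \<phi> h c"
  obtain c' where c': "c' \<in> pts A" "\<And>x. x \<in> P \<Longrightarrow> D c' x = (INF i\<in>I. qhom (\<phi> i) (D (h i) x))"
    using lim_exists h by blast
  then have "is_lim A I \<phi> h c'" using h by (intro is_limI)
  with c have "c = c'" by (rule is_lim_unique)
  with c' show "c \<in> pts A \<and> (\<forall>x\<in>P. D c x = (INF i\<in>I. qhom (\<phi> i) (D (h i) x)))" by simp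
qed (use h in \<open>auto intro: is_limI\<close>)

lemma limit_exists:
  assumes "\<And>i. i \<in> I \<Longrightarrow> h i \<in> pts A"
  shows "\<exists>c. is_lim A I \<phi> h c"
proof -
  obtain c where "c \<in> pts A" "\<And>x. x \<in> P \<Longrightarrow> D c x = (INF i\<in>I. qhom (\<phi> i) (D (h i) x))"
    using lim_exists assms by blast
  with assms show ?thesis using is_limI by blast
qed

lemma is_colimI:
  assumes h: "\<And>i. i \<in> I \<Longrightarrow> h i \<in> pts A" and c: "c \<in> pts A"
    and D: "\<And>x. x \<in> P \<Longrightarrow> D c x = (SUP i\<in>I. \<psi> i * D (h i) x)"
  shows "is_colim A I \<psi> h c"
proof -
  have "str A (c, y) = (INF i\<in>I. qhom (\<psi> i) (str A (h i, y)))" if y: "y \<in> pts A" for y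
  proof (rule eq_by_lower_bounds)
    fix z
    have "z \<le> str A (c, y) \<longleftrightarrow> (\<forall>x\<in>P. \<forall>i\<in>I. z * \<psi> i * D (h i) x \<le> D y x)"
      using y c by (simp add: le_str_iff D quantale_mult_SUP SUP_le_iff ac_simps)
    also have "\<dots> \<longleftrightarrow> (\<forall>i\<in>I. z * \<psi> i \<le> str A (h i, y))"
      using y h by (auto simp: le_str_iff)
    also have "\<dots> \<longleftrightarrow> z \<le> (INF i\<in>I. qhom (\<psi> i) (str A (h i, y)))"
      by (simp add: le_INF_iff le_qhom_iff)
    finally show "z \<le> str A (c, y) \<longleftrightarrow> z \<le> (INF i\<in>I. qhom (\<psi> i) (str A (h i, y)))" .
  qed
  with c show ?thesis by (simp add: is_colim_def)
qed

lemma is_colim_unique: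
  assumes "is_colim A I \<psi> h c" "is_colim A I \<psi> h c'"
  shows "c = c'"
proof -
  have c: "c \<in> pts A" "c' \<in> pts A" "\<And>y. y \<in> pts A \<Longrightarrow> str A (c, y) = str A (c', y)"
    using assms by (simp_all add: is_colim_def)
  with str_refl[OF c(1)] str_refl[OF c(2)] show ?thesis by (intro le_antisym) simp_all
qed

lemma is_tensor_iff:
  assumes p: "p \<in> pts A"
  shows "is_tensor A v p t \<longleftrightarrow> t \<in> pts A \<and> (\<forall>x\<in>P. D t x = v * D p x)"
proof -
  \<comment> \<open>A tensor is a colimit over a one-element index set, which makes the uniqueness
    of colimits available.\<close>
  have eq: "is_tensor A v p t \<longleftrightarrow> is_colim A {()} (\<lambda>_. v) (\<lambda>_. p) t" for t
    by (simp add: is_tensor_def is_colim_def)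
  obtain t' where t': "t' \<in> pts A" "\<forall>x\<in>P. D t' x = v * D p x" using tensor_closed[OF p] by blast
  then have "is_colim A {()} (\<lambda>_. v) (\<lambda>_. p) t'" using p by (intro is_colimI) auto
  moreover have "is_colim A {()} (\<lambda>_. v) (\<lambda>_. p) t" if "t \<in> pts A" "\<forall>x\<in>P. D t x = v * D p x"
    using that p by (intro is_colimI) auto
  ultimately show ?thesis unfolding eq using t' is_colim_unique by blast
qed

section \<open>Suprema of distributors and their exchange with limits\<close>

lemma is_sup_iff_colim: "is_sup A L s \<longleftrightarrow> is_colim A (pts A) L (\<lambda>p. p) s"
  by (simp add: is_sup_def is_colim_def)

text \<open>Co-Yoneda: with \<open>D p x\<close> = A(r, p) each term is at most \<open>L r\<close>
  by the distributor law, and the term at p = r is at least \<open>L r\<close>.\<close>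

lemma sup_at_representing_point:
  assumes L: "V_dist_from_1 A L"
    and r: "r \<in> pts A" "\<And>p. p \<in> pts A \<Longrightarrow> str A (r, p) = D p x"
  shows "(SUP p\<in>pts A. L p * D p x) = L r"
proof (rule order_antisym)
  have "L p * D p x \<le> L r" if p: "p \<in> pts A" for p
  proof -
    have "str A (r, p) * L p \<le> L r" using L r(1) p unfolding V_dist_from_1_def by blast
    then show ?thesis unfolding r(2)[OF p] by (simp add: mult.commute)
  qed
  then show "(SUP p\<in>pts A. L p * D p x) \<le> L r" by (rule SUP_least)
  have "1 \<le> D r x" using r str_refl[of r] by simp
  then have "L r * 1 \<le> L r * D r x" by (intro quantale_mult_mono) auto
  then show "L r \<le> (SUP p\<in>pts A. L p * D p x)" using r(1) by (intro SUP_upper2[of r]) auto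
qed

text \<open>Closure under pointwise suprema is not part of \<open>eval_graph\<close>, so it is
  recorded as a property of the single distributor L; in \<open>Omega\<close> it comes from the
  diagram generating L.\<close>

definition pointwise_sup :: "('a \<Rightarrow> 'v) \<Rightarrow> bool" where
  "pointwise_sup L \<longleftrightarrow> (\<exists>s\<in>pts A. \<forall>x\<in>P. D s x = (SUP p\<in>pts A. L p * D p x))"

lemma is_sup_eval:
  assumes L: "V_dist_from_1 A L" "pointwise_sup L" and s: "is_sup A L s"
    and x: "x \<in> P" and r: "r \<in> pts A" "\<And>p. p \<in> pts A \<Longrightarrow> str A (r, p) = D p x"
  shows "D s x = L r"
proof -
  obtain s' where s': "s' \<in> pts A" "\<forall>x\<in>P. D s' x = (SUP p\<in>pts A. L p * D p x)"
    using L(2) by (auto simp: pointwise_sup_def)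
  then have "is_colim A (pts A) L (\<lambda>p. p) s'" by (intro is_colimI) auto
  with s have "s = s'" unfolding is_sup_iff_colim by (rule is_colim_unique)
  with s' x sup_at_representing_point[OF L(1) r] show ?thesis by simp
qed

text \<open>By the Yoneda lemma, evaluation at p is the hom out of the representable distributor
  A(-, p), and a limit is defined by its homs from all objects.\<close>

lemma presheaf_lim_pointwise:
  assumes L: "is_lim (P_obj A) I \<phi> h L" and h: "\<And>i. i \<in> I \<Longrightarrow> h i \<in> pts (P_obj A)"
    and p: "p \<in> pts A"
  shows "L p = (INF i\<in>I. qhom (\<phi> i) (h i p))"
proof -
  let ?y = "restrict (\<lambda>q. str A (q, p)) (pts A)"
  have y: "?y \<in> pts (P_obj A)"
    using p V_category by (simp add: P_obj_def V_dist_from_1_def V_category_def)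
  have yoneda: "str (P_obj A) (?y, M) = M p" if M: "M \<in> pts (P_obj A)" for M
  proof (rule order_antisym)
    have "(INF x\<in>pts A. qhom (?y x) (M x)) \<le> qhom (str A (p, p)) (M p)"
      using p by (intro INF_lower2[of p]) auto
    also have "\<dots> \<le> qhom 1 (M p)"
      using p by (intro qhom_antimono str_refl)
    finally show "str (P_obj A) (?y, M) \<le> M p" by (simp add: P_obj_def)
    have "M p * str A (x, p) \<le> M x" if "x \<in> pts A" for x
      using M p that by (simp add: P_obj_def V_dist_from_1_def mult.commute)
    then show "M p \<le> str (P_obj A) (?y, M)"
      by (simp add: P_obj_def le_INF_iff le_qhom_iff[symmetric])
  qed
  have "L \<in> pts (P_obj A)" using L by (simp add: is_lim_def)
  then have "L p = str (P_obj A) (?y, L)" by (simp add: yoneda)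
  also have "\<dots> = (INF i\<in>I. qhom (\<phi> i) (str (P_obj A) (?y, h i)))"
    using L y by (simp add: is_lim_def)
  also have "\<dots> = (INF i\<in>I. qhom (\<phi> i) (h i p))" using h by (simp add: yoneda)
  finally show ?thesis .
qed

text \<open>At a point x with representing r, each supremum takes the value of its distributor at r.
  The claim thus becomes the pointwise formula for limits in PA, read at r.\<close>

lemma sup_lim_commute:
  assumes h: "\<And>i. i \<in> I \<Longrightarrow> h i \<in> pts (P_obj A)" "\<And>i. i \<in> I \<Longrightarrow> pointwise_sup (h i)"
    and L: "is_lim (P_obj A) I \<phi> h L" "pointwise_sup L"
    and s: "is_sup A L s" and t: "\<And>i. i \<in> I \<Longrightarrow> is_sup A (h i) (t i)"
  shows "is_lim A I \<phi> t s"
proof (rule is_limI)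
  show "t i \<in> pts A" if "i \<in> I" for i using t[OF that] by (simp add: is_sup_def)
  show "s \<in> pts A" using s by (simp add: is_sup_def)
  fix x assume x: "x \<in> P"
  then obtain r where r: "r \<in> pts A" "\<And>p. p \<in> pts A \<Longrightarrow> str A (r, p) = D p x"
    using representable by blast
  have Lpts: "L \<in> pts (P_obj A)" using L(1) by (simp add: is_lim_def)
  have dist: "V_dist_from_1 A M" if "M \<in> pts (P_obj A)" for M using that by (simp add: P_obj_def)
  have "D s x = L r" using is_sup_eval[OF dist[OF Lpts] L(2) s x r] .
  also have "\<dots> = (INF i\<in>I. qhom (\<phi> i) (h i r))"
    using presheaf_lim_pointwise[OF L(1) h(1) r(1)] .
  also have "\<dots> = (INF i\<in>I. qhom (\<phi> i) (D (t i) x))"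
    using is_sup_eval[OF dist[OF h(1)] h(2) t x r] by simp
  finally show "D s x = (INF i\<in>I. qhom (\<phi> i) (D (t i) x))" .
qed

end

text \<open>Enrichment and completeness come with \<open>eval_graph\<close>. The distributors in the
  frame law are all T-generated, so pointwise suprema for these suffice.\<close>

lemma T_frameI:
  fixes \<T> :: "('u::set_universe, 'v::comm_quantale) theory_data"
  assumes A: "T_graph \<T> A" and "eval_graph (underlying \<T> A) P D"
    and sup: "\<And>L. T_generated \<T> A L \<Longrightarrow> eval_graph.pointwise_sup (underlying \<T> A) P D L"
  shows "T_frame \<T> A"
proof -
  interpret eval_graph "underlying \<T> A" P D by fact
  have "is_lim (underlying \<T> A) (pts I) \<phi> t s"
    if "limit_data I (P_obj (underlying \<T> A)) \<phi> h" "\<forall>i\<in>pts I. T_generated \<T> A (h i)"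
      "is_lim (P_obj (underlying \<T> A)) (pts I) \<phi> h L" "T_generated \<T> A L"
      "is_sup (underlying \<T> A) L s" "\<forall>i\<in>pts I. is_sup (underlying \<T> A) (h i) (t i)"
    for I :: "('u, 'v) graph" and \<phi> h L s t
    using that by (intro sup_lim_commute[of _ h _ L]) (auto simp: limit_data_def V_functor_def sup)
  moreover have "V_complete (underlying \<T> A)"
    unfolding V_complete_def
  proof (intro allI impI)
    fix I :: "('u, 'v) graph" and \<phi> h
    assume "limit_data I (underlying \<T> A) \<phi> h"
    then show "\<exists>c. is_lim (underlying \<T> A) (pts I) \<phi> h c"
      by (intro limit_exists) (auto simp: limit_data_def V_functor_def)
  qed
  ultimately show ?thesis
    unfolding T_frame_def by (intro conjI allI impI A V_category) blast+
qed


context strict_theory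
begin

section \<open>The quantale as a frame, and graph morphisms into it\<close>

lemma inj_fcode:
  assumes "small Y"
  shows "inj_on (fcode \<T> Y) (extensional Y)"
proof (rule inj_onI)
  fix f g :: "'u \<Rightarrow> 'v"
  assume fg: "f \<in> extensional Y" "g \<in> extensional Y" "fcode \<T> Y f = fcode \<T> Y g"
  then have eq: "(\<lambda>x. cpair x (val \<T> (f x))) ` Y = (\<lambda>x. cpair x (val \<T> (g x))) ` Y"
    using assms by (simp add: fcode_def code_eq_iff small_image)
  have "f x = g x" if "x \<in> Y" for x
  proof -
    have "cpair x (val \<T> (f x)) \<in> (\<lambda>x. cpair x (val \<T> (g x))) ` Y"
      using that unfolding eq[symmetric] by blast
    then show ?thesis using inj_val by (auto simp: inj_eq)
  qed
  with fg show "f = g" by (intro extensionalityI) auto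
qed

lemma xi_eq_xiT: "w \<in> Tob \<T> (Vset \<T>) \<Longrightarrow> xi \<T> w = xiT \<T> (Vset \<T>) (unval \<T>) w"
  unfolding xiT_def
  by (subst Tmap_cong[of _ _ "\<lambda>x. x"]) (auto simp: Tmap_ident)

lemma T_graph_V: "T_graph \<T> (V_obj \<T>)"
  by (auto simp: T_graph_def V_obj_def xi_eq_xiT)

lemma pts_V [simp]: "pts (V_obj \<T>) = Vset \<T>"
  and pts_underlying [simp]: "pts (underlying \<T> A) = pts A"
  by (simp_all add: V_obj_def underlying_def)

lemma str_underlying_V:
  "\<lbrakk>u \<in> Vset \<T>; v \<in> Vset \<T>\<rbrakk> \<Longrightarrow>
   str (underlying \<T> (V_obj \<T>)) (u, v) = qhom (unval \<T> u) (unval \<T> v)"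
  by (simp add: underlying_def V_obj_def xi_eq_xiT)

text \<open>V is regarded as functions on a single point. Evaluation there is represented by the
  unit, since hom(k, v) = v.\<close>

lemma eval_graph_V:
  "eval_graph (underlying \<T> (V_obj \<T>)) (UNIV :: unit set) (\<lambda>u _. unval \<T> u)"
proof
  fix p q assume pq: "p \<in> pts (underlying \<T> (V_obj \<T>))" "q \<in> pts (underlying \<T> (V_obj \<T>))"
  then show "str (underlying \<T> (V_obj \<T>)) (p, q) =
      (INF x\<in>UNIV. qhom (unval \<T> p) (unval \<T> q))"
    by (simp add: str_underlying_V)
  assume "\<And>x::unit. x \<in> UNIV \<Longrightarrow> unval \<T> p = unval \<T> q"
  then have "val \<T> (unval \<T> p) = val \<T> (unval \<T> q)" by simp
  then show "p = q" using pq by simp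
next
  fix S
  have "\<exists>c\<in>Vset \<T>. unval \<T> c = z" for z by (rule bexI[of _ "val \<T> z"]) simp_all
  then show "\<exists>c\<in>pts (underlying \<T> (V_obj \<T>)). \<forall>x\<in>(UNIV :: unit set).
      unval \<T> c = (INF (v, p)\<in>S. qhom v (unval \<T> p))" by simp
next
  fix p v
  have "\<exists>c\<in>Vset \<T>. unval \<T> c = z" for z by (rule bexI[of _ "val \<T> z"]) simp_all
  then show "\<exists>c\<in>pts (underlying \<T> (V_obj \<T>)). \<forall>x\<in>(UNIV :: unit set).
      unval \<T> c = v * unval \<T> p" by simp
next
  show "\<exists>r\<in>pts (underlying \<T> (V_obj \<T>)). \<forall>p\<in>pts (underlying \<T> (V_obj \<T>)).
      str (underlying \<T> (V_obj \<T>)) (r, p) = unval \<T> p"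
    by (rule bexI[of _ "val \<T> 1"]) (simp_all add: str_underlying_V)
qed

lemma T_frame_V: "T_frame \<T> (V_obj \<T>)"
proof (rule T_frameI[OF T_graph_V eval_graph_V])
  fix L
  show "eval_graph.pointwise_sup (underlying \<T> (V_obj \<T>)) (UNIV :: unit set) (\<lambda>u _. unval \<T> u) L"
    unfolding eval_graph.pointwise_sup_def[OF eval_graph_V]
    by (rule bexI[of _ "val \<T> (SUP p\<in>Vset \<T>. L p * unval \<T> p)"]) simp_all
qed

lemma T_morphism_V_iff:
  assumes "small (pts Y)"
  shows "T_morphism \<T> Y (V_obj \<T>) (\<lambda>x. val \<T> (p x)) \<longleftrightarrow> stable Y p"
proof -
  have "str (V_obj \<T>) (Tmap \<T> (pts Y) (Vset \<T>) (\<lambda>x. val \<T> (p x)) w, val \<T> (p x)) =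
      qhom (xiT \<T> (pts Y) p w) (p x)" if "w \<in> Tob \<T> (pts Y)" for w x
    using assms that by (simp add: V_obj_def xiT_def Tmap_in)
  then show ?thesis
    by (simp add: T_morphism_def stable_def le_qhom_iff[symmetric] mult.commute)
qed

text \<open>The structure of \<open>alg_graph\<close> is k at the pairs (w, \<alpha> w) and bottom
  elsewhere, which leaves one test for each w.\<close>

lemma T_morphism_alg_iff:
  assumes "T_algebra \<T> I \<alpha>"
  shows "T_morphism \<T> (alg_graph \<T> I \<alpha>) B g \<longleftrightarrow> g \<in> I \<rightarrow> pts B \<and>
    (\<forall>w\<in>Tob \<T> I. 1 \<le> str B (Tmap \<T> I (pts B) g w, g (\<alpha> w)))"
proof -
  have "\<alpha> w \<in> I" if "w \<in> Tob \<T> I" for w using assms that by (auto simp: T_algebra_def)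
  then show ?thesis by (auto simp: T_morphism_def alg_graph_def)
qed

lemma T_morphism_alg_V_iff:
  assumes "T_algebra \<T> I \<alpha>"
  shows "T_morphism \<T> (alg_graph \<T> I \<alpha>) (V_obj \<T>) (\<lambda>i. val \<T> (p i)) \<longleftrightarrow>
    (\<forall>w\<in>Tob \<T> I. xiT \<T> I p w \<le> p (\<alpha> w))"
proof -
  have "small I" using assms by (simp add: T_algebra_def)
  then have "str (V_obj \<T>) (Tmap \<T> I (Vset \<T>) (\<lambda>i. val \<T> (p i)) w, val \<T> (p i)) =
      qhom (xiT \<T> I p w) (p i)" if "w \<in> Tob \<T> I" for w i
    using that by (simp add: V_obj_def xiT_def Tmap_in)
  then show ?thesis by (simp add: T_morphism_alg_iff[OF assms])
qed

lemma T_morphism_cong: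
  assumes "\<And>x. x \<in> pts Y \<Longrightarrow> f x = g x" "small (pts Y)" "small (pts Z)" "T_morphism \<T> Y Z g"
  shows "T_morphism \<T> Y Z f"
proof -
  have g: "g \<in> pts Y \<rightarrow> pts Z" using assms(4) by (simp add: T_morphism_def)
  then have f: "f \<in> pts Y \<rightarrow> pts Z" using assms(1) by auto
  have "Tmap \<T> (pts Y) (pts Z) f w = Tmap \<T> (pts Y) (pts Z) g w" if "w \<in> Tob \<T> (pts Y)" for w
    using that assms(1-3) f by (intro Tmap_cong) auto
  then show ?thesis using assms(1,4) f by (auto simp: T_morphism_def)
qed

text \<open>\<open>r\<close> is obtained from \<open>W\<close> by the strength \<open>T A \<times> B \<rightarrow> T (A \<times> B)\<close> and the multiplication.\<close>

lemma strength:
  assumes W: "W \<in> Tob \<T> (cprod (Tob \<T> A) B)" and s: "small A" "small B"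
  obtains r where "r \<in> Tob \<T> (cprod A B)"
    "T1 A B r = mu \<T> A (T1 (Tob \<T> A) B W)" "T2 A B r = T2 (Tob \<T> A) B W"
    "\<forall>t. xiT \<T> (cprod A B) t r =
      xiT \<T> (cprod (Tob \<T> A) B) (\<lambda>z. xiT \<T> A (\<lambda>x. t (cpair x (csnd z))) (cfst z)) W"
proof -
  let ?AB = "cprod A B" and ?TAB = "cprod (Tob \<T> A) B"
  define st where "st z = Tmap \<T> A ?AB (\<lambda>x. cpair x (csnd z)) (cfst z)" for z
  have sm: "small ?AB" "small ?TAB" "small (Tob \<T> ?AB)" using s by (simp_all add: small_cprod)
  have st: "st z \<in> Tob \<T> ?AB" "T1 A B (st z) = cfst z" "T2 A B (st z) = eta \<T> B (csnd z)"
    "xiT \<T> ?AB t (st z) = xiT \<T> A (\<lambda>x. t (cpair x (csnd z))) (cfst z)"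
    if "z \<in> ?TAB" for z and t :: "'u \<Rightarrow> 'v"
  proof -
    have z: "cfst z \<in> Tob \<T> A" "csnd z \<in> B" using that by auto
    show "st z \<in> Tob \<T> ?AB" "T1 A B (st z) = cfst z" "T2 A B (st z) = eta \<T> B (csnd z)"
      using pairing(1-3)[of "cfst z" A "\<lambda>x. x" A "\<lambda>_. csnd z" B] z s
      by (simp_all add: st_def Tmap_ident Tmap_const)
    show "xiT \<T> ?AB t (st z) = xiT \<T> A (\<lambda>x. t (cpair x (csnd z))) (cfst z)"
      unfolding st_def using z s sm by (subst xiT_Tmap) auto
  qed
  have st_fun: "st \<in> ?TAB \<rightarrow> Tob \<T> ?AB" using st(1) by blast
  have fs: "cfst \<in> ?AB \<rightarrow> A" "csnd \<in> ?AB \<rightarrow> B" by auto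
  have Tfs: "T1 A B \<in> Tob \<T> ?AB \<rightarrow> Tob \<T> A" "T2 A B \<in> Tob \<T> ?AB \<rightarrow> Tob \<T> B"
    using s by (auto intro!: T1_in T2_in)
  define R where "R = Tmap \<T> ?TAB (Tob \<T> ?AB) st W"
  have R: "R \<in> Tob \<T> (Tob \<T> ?AB)" unfolding R_def using W st_fun sm by (intro Tmap_in)
  show ?thesis
  proof (rule that[of "mu \<T> ?AB R"])
    show "mu \<T> ?AB R \<in> Tob \<T> ?AB" using R sm by (intro mu_in)
    have "T1 A B (mu \<T> ?AB R) = mu \<T> A (Tmap \<T> (Tob \<T> ?AB) (Tob \<T> A) (T1 A B) R)"
      using fs sm s R by (intro Tmap_mu) auto
    also have "Tmap \<T> (Tob \<T> ?AB) (Tob \<T> A) (T1 A B) R =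
        Tmap \<T> ?TAB (Tob \<T> A) (\<lambda>z. T1 A B (st z)) W"
      unfolding R_def using W st_fun Tfs sm s by (intro Tmap_Tmap) auto
    also have "\<dots> = T1 (Tob \<T> A) B W"
      using W st(2) sm s by (intro Tmap_cong) auto
    finally show "T1 A B (mu \<T> ?AB R) = mu \<T> A (T1 (Tob \<T> A) B W)" .
    have "T2 A B (mu \<T> ?AB R) = mu \<T> B (Tmap \<T> (Tob \<T> ?AB) (Tob \<T> B) (T2 A B) R)"
      using fs sm s R by (intro Tmap_mu) auto
    also have "Tmap \<T> (Tob \<T> ?AB) (Tob \<T> B) (T2 A B) R =
        Tmap \<T> ?TAB (Tob \<T> B) (\<lambda>z. T2 A B (st z)) W"
      unfolding R_def using W st_fun Tfs sm s by (intro Tmap_Tmap) auto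
    also have "\<dots> = Tmap \<T> ?TAB (Tob \<T> B) (\<lambda>z. eta \<T> B (csnd z)) W"
      using W st(3) sm s by (intro Tmap_cong) (auto intro!: eta_in)
    also have "\<dots> = Tmap \<T> B (Tob \<T> B) (eta \<T> B) (T2 (Tob \<T> A) B W)"
      using W sm s by (intro Tmap_Tmap[symmetric]) (auto intro!: eta_in)
    also have "mu \<T> B \<dots> = T2 (Tob \<T> A) B W" using W s by (intro mu_Tmap_eta T2_in) auto
    finally show "T2 A B (mu \<T> ?AB R) = T2 (Tob \<T> A) B W" .
    show "\<forall>t. xiT \<T> ?AB t (mu \<T> ?AB R) =
      xiT \<T> ?TAB (\<lambda>z. xiT \<T> A (\<lambda>x. t (cpair x (csnd z))) (cfst z)) W"
    proof
      fix t
      have "xiT \<T> ?AB t (mu \<T> ?AB R) = xiT \<T> (Tob \<T> ?AB) (xiT \<T> ?AB t) R"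
        using R sm by (intro xiT_mu)
      also have "\<dots> = xiT \<T> ?TAB (\<lambda>z. xiT \<T> ?AB t (st z)) W"
        unfolding R_def using W st_fun sm by (intro xiT_Tmap)
      also have "\<dots> = xiT \<T> ?TAB (\<lambda>z. xiT \<T> A (\<lambda>x. t (cpair x (csnd z))) (cfst z)) W"
        using W sm st(4) by (intro xiT_cong) auto
      finally show "xiT \<T> ?AB t (mu \<T> ?AB R) =
        xiT \<T> ?TAB (\<lambda>z. xiT \<T> A (\<lambda>x. t (cpair x (csnd z))) (cfst z)) W" .
    qed
  qed
qed

text \<open>The function on the left is the push-forward of t along the projection from A x B to A,
  so this is the naturality of \<phi> \<mapsto> \<xi> . T \<phi> at that projection.\<close>

lemma xiT_SUP_fst:
  assumes "w \<in> Tob \<T> A" "small A" "small B"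
  shows "xiT \<T> A (\<lambda>x. SUP y\<in>B. t (cpair x y)) w =
    (SUP r\<in>{r \<in> Tob \<T> (cprod A B). T1 A B r = w}. xiT \<T> (cprod A B) t r)"
proof -
  have "xiT \<T> A (\<lambda>x. SUP y\<in>B. t (cpair x y)) w =
      xiT \<T> A (\<lambda>x. Sup {t z |z. z \<in> cprod A B \<and> cfst z = x}) w"
    using assms by (intro xiT_cong arg_cong[of _ _ Sup]) (auto elim!: cprodE)
  also have "\<dots> = Sup {xiT \<T> (cprod A B) t r |r. r \<in> Tob \<T> (cprod A B) \<and> T1 A B r = w}"
    using assms by (intro xiT_push) (auto simp: small_cprod)
  finally show ?thesis by (simp add: setcompr_eq_image)
qed

lemma xiT_SUP_snd:
  assumes "w \<in> Tob \<T> B" "small A" "small B"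
  shows "xiT \<T> B (\<lambda>y. SUP x\<in>A. t (cpair x y)) w =
    (SUP r\<in>{r \<in> Tob \<T> (cprod A B). T2 A B r = w}. xiT \<T> (cprod A B) t r)"
proof -
  have "xiT \<T> B (\<lambda>y. SUP x\<in>A. t (cpair x y)) w =
      xiT \<T> B (\<lambda>y. Sup {t z |z. z \<in> cprod A B \<and> csnd z = y}) w"
    using assms by (intro xiT_cong arg_cong[of _ _ Sup]) (auto elim!: cprodE)
  also have "\<dots> = Sup {xiT \<T> (cprod A B) t r |r. r \<in> Tob \<T> (cprod A B) \<and> T2 A B r = w}"
    using assms by (intro xiT_push) (auto simp: small_cprod)
  finally show ?thesis by (simp add: setcompr_eq_image)
qed

end

section \<open>The frame of a category\<close>

locale T_cat = strict_theory \<T> for \<T> :: "('u::set_universe, 'v::comm_quantale) theory_data" +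
  fixes X :: "('u, 'v) graph"
  assumes cat: "T_category \<T> X"
begin

abbreviation P :: "'u set" where "P \<equiv> pts X"
abbreviation TP :: "'u set" where "TP \<equiv> Tob \<T> P"
abbreviation a :: "'u \<Rightarrow> 'u \<Rightarrow> 'v" where "a w x \<equiv> str X (w, x)"
abbreviation Om :: "'u set" where "Om \<equiv> Omega_pts \<T> X"
abbreviation D :: "'u \<Rightarrow> 'u \<Rightarrow> 'v" where "D \<equiv> fdec \<T> P"

lemma T_graph_X: "T_graph \<T> X"
  using cat by (simp add: T_category_def)

lemma small_P [simp]: "small P"
  and a_refl: "x \<in> P \<Longrightarrow> 1 \<le> a (eta \<T> P x) x"
  using T_graph_X by (simp_all add: T_graph_def)

lemma a_trans:
  "\<lbrakk>U \<in> Tob \<T> (cprod TP P); x \<in> P\<rbrakk> \<Longrightarrow> xm TP P (str X) U * a (T2 TP P U) x \<le> a (mu \<T> P (T1 TP P U)) x"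
  using cat by (simp add: T_category_iff)

lemma stableD: "\<lbrakk>stable X p; w \<in> TP; x \<in> P\<rbrakk> \<Longrightarrow> xiT \<T> P p w * a w x \<le> p x"
  by (simp add: stable_def)

text \<open>Transitivity of the structure is applied to T(w, -)(v). Its first component is the unit
  at w because constants are preserved, and the multiplication returns w.\<close>

lemma stable_column:
  assumes w: "w \<in> TP"
  shows "stable X (a w)"
proof -
  have "xiT \<T> P (a w) v * a v x \<le> a w x" if v: "v \<in> TP" "x \<in> P" for v x
  proof -
    note pr = pairing[of v P "\<lambda>_. w" TP "\<lambda>y. y" P]
    let ?U = "Tmap \<T> P (cprod TP P) (\<lambda>y. cpair w y) v"
    have "?U \<in> Tob \<T> (cprod TP P)" "T1 TP P ?U = eta \<T> TP w" "T2 TP P ?U = v"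
      "xm TP P (str X) ?U = xiT \<T> P (a w) v"
      using pr v w by (simp_all add: Tmap_const Tmap_ident)
    with a_trans[of ?U x] v w show ?thesis by simp
  qed
  then show ?thesis by (simp add: stable_def)
qed

text \<open>Dual to \<open>stable_column\<close>: now the point x is constant, and the factor a(e x,
  x) is removed by reflexivity. The result is the first clause of \<open>E_adj\<close> for f = a(-,
  x).\<close>

lemma xiT_row:
  assumes W: "W \<in> Tob \<T> TP" and x: "x \<in> P"
  shows "xiT \<T> TP (\<lambda>w. a w x) W \<le> a (mu \<T> P W) x"
proof -
  note pr = pairing[of W TP "\<lambda>w. w" TP "\<lambda>_. x" P]
  let ?U = "Tmap \<T> TP (cprod TP P) (\<lambda>w. cpair w x) W"
  have "?U \<in> Tob \<T> (cprod TP P)" "T1 TP P ?U = W" "T2 TP P ?U = eta \<T> P x"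
    "xm TP P (str X) ?U = xiT \<T> TP (\<lambda>w. a w x) W"
    using pr W x by (simp_all add: Tmap_const Tmap_ident)
  with a_trans[of ?U x] x have "xiT \<T> TP (\<lambda>w. a w x) W * a (eta \<T> P x) x \<le> a (mu \<T> P W) x"
    by simp
  moreover have "xiT \<T> TP (\<lambda>w. a w x) W * 1 \<le> xiT \<T> TP (\<lambda>w. a w x) W * a (eta \<T> P x) x"
    using a_refl[OF x] by (intro quantale_mult_mono) auto
  ultimately show ?thesis by simp
qed

lemma stable_cong: "(\<And>x. x \<in> P \<Longrightarrow> p x = q x) \<Longrightarrow> stable X p \<longleftrightarrow> stable X q"
  using xiT_cong[of P p q] by (simp add: stable_def)

lemma stable_INF:
  assumes "\<And>i. i \<in> I \<Longrightarrow> stable X (p i)"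
  shows "stable X (\<lambda>x. INF i\<in>I. p i x)"
  unfolding stable_def
proof (intro ballI INF_greatest)
  fix w x i assume *: "w \<in> TP" "x \<in> P" "i \<in> I"
  have "xiT \<T> P (\<lambda>x. INF i\<in>I. p i x) w \<le> xiT \<T> P (p i) w"
    using * by (intro xiT_mono INF_lower) auto
  then have "xiT \<T> P (\<lambda>x. INF i\<in>I. p i x) w * a w x \<le> xiT \<T> P (p i) w * a w x"
    by (intro quantale_mult_mono) auto
  also have "\<dots> \<le> p i x" using * by (intro stableD assms)
  finally show "xiT \<T> P (\<lambda>x. INF i\<in>I. p i x) w * a w x \<le> p i x" .
qed

lemma xiT_const_mult: "\<lbrakk>small A; w \<in> Tob \<T> A\<rbrakk> \<Longrightarrow> xiT \<T> A (\<lambda>x. v * p x) w = v * xiT \<T> A p w"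
  by (simp add: xiT_mult)

lemma stable_mult:
  assumes "stable X p"
  shows "stable X (\<lambda>x. v * p x)"
  using assms unfolding stable_def
  by (auto simp: xiT_const_mult mult.assoc intro!: quantale_mult_mono)

text \<open>The constant v passes through \<xi> . T, so v tensored with the image of hom(v, p) lies
  below the image of p; stability of p and adjunction finish.\<close>

lemma stable_qhom:
  assumes p: "stable X p"
  shows "stable X (\<lambda>x. qhom v (p x))"
  unfolding stable_def
proof (intro ballI)
  fix w x assume *: "w \<in> TP" "x \<in> P"
  have "xiT \<T> P (\<lambda>x. v * qhom v (p x)) w \<le> xiT \<T> P p w"
    using * by (intro xiT_mono mult_qhom_le) auto
  then have "v * xiT \<T> P (\<lambda>x. qhom v (p x)) w * a w x \<le> xiT \<T> P p w * a w x"
    using * by (intro quantale_mult_mono) (auto simp: xiT_const_mult)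
  also have "\<dots> \<le> p x" using stableD[OF p *] .
  finally show "xiT \<T> P (\<lambda>x. qhom v (p x)) w * a w x \<le> qhom v (p x)"
    by (simp add: le_qhom_iff[symmetric] ac_simps)
qed

lemma D_fcode: "p \<in> extensional P \<Longrightarrow> D (fcode \<T> P p) = p"
  unfolding fdec_def by (rule inv_into_f_f[OF inj_fcode[OF small_P]])

text \<open>\<open>fdec\<close> inverts \<open>fcode\<close> only on extensional functions. The
  restriction lets any p that is stable on X, whatever its values elsewhere, name an element of
  \<open>Omega\<close>.\<close>

definition C :: "('u \<Rightarrow> 'v) \<Rightarrow> 'u" where "C p = fcode \<T> P (restrict p P)"

lemma Om_eq: "Om = fcode \<T> P ` {p \<in> extensional P. stable X p}"
  by (simp add: Omega_pts_def T_morphism_V_iff)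

lemma D_C [simp]: "x \<in> P \<Longrightarrow> D (C p) x = p x"
  by (simp add: C_def D_fcode)

lemma C_in: "stable X p \<Longrightarrow> C p \<in> Om"
  unfolding Om_eq C_def using stable_cong[of "restrict p P" p] by auto

lemma stable_D: "p \<in> Om \<Longrightarrow> stable X (D p)"
  by (auto simp: Om_eq D_fcode)

lemma Om_eqI: "\<lbrakk>p \<in> Om; q \<in> Om; \<And>x. x \<in> P \<Longrightarrow> D p x = D q x\<rbrakk> \<Longrightarrow> p = q"
  by (auto simp: Om_eq D_fcode intro!: arg_cong[of _ _ "fcode \<T> P"] extensionalityI)

lemma small_Om [simp]: "small Om"
proof -
  have "fcode \<T> P p \<in> code ` Pow (cprod P (Vset \<T>))" for p
    unfolding fcode_def by (intro imageI) auto
  then have "Om \<subseteq> code ` Pow (cprod P (Vset \<T>))" by (auto simp: Om_eq)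
  then show ?thesis
    using small_subset[OF small_Pow[OF small_cprod[OF small_P small_Vset]]] by blast
qed

abbreviation ev :: "'u \<Rightarrow> 'v" where
  "ev \<equiv> xiT \<T> (cprod P Om) (\<lambda>r. D (csnd r) (cfst r))"

lemma pts_Omega [simp]: "pts (Omega \<T> X) = Om"
  by (simp add: Omega_def)

lemma le_str_Omega_iff:
  assumes "\<pp> \<in> Tob \<T> Om" "p \<in> Om"
  shows "z \<le> str (Omega \<T> X) (\<pp>, p) \<longleftrightarrow>
    (\<forall>q\<in>Tob \<T> (cprod P Om). T2 P Om q = \<pp> \<longrightarrow>
      (\<forall>x\<in>P. z * (ev q * a (T1 P Om q) x) \<le> D p x))"
proof -
  have "z \<le> str (Omega \<T> X) (\<pp>, p) \<longleftrightarrow>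
    (\<forall>q\<in>Tob \<T> (cprod P Om). T2 P Om q = \<pp> \<longrightarrow>
      (\<forall>x\<in>P. z \<le> qhom (a (T1 P Om q) x) (qhom (ev q) (D p x))))"
    using assms by (auto simp: Omega_def le_Inf_iff)
  then show ?thesis by (simp add: le_qhom_iff[symmetric] ac_simps)
qed

text \<open>Elements of T(X x V^X) over e(p) are exactly the T(-, p)(w), by
  \<open>T_cprod_eta_snd\<close>. The infimum therefore runs over w and x and tests \<xi>(T p(w))
  \<otimes> a(w, x) against q(x). Stability of p bounds this term by p(x), and w = e(x) attains
  it.\<close>

lemma str_underlying_Omega:
  assumes p: "p \<in> Om" and q: "q \<in> Om"
  shows "str (underlying \<T> (Omega \<T> X)) (p, q) = (INF x\<in>P. qhom (D p x) (D q x))"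
proof (rule eq_by_lower_bounds)
  fix z
  have pr: "Tmap \<T> P (cprod P Om) (\<lambda>y. cpair y p) w \<in> Tob \<T> (cprod P Om)"
    "T1 P Om (Tmap \<T> P (cprod P Om) (\<lambda>y. cpair y p) w) = w"
    "T2 P Om (Tmap \<T> P (cprod P Om) (\<lambda>y. cpair y p) w) = eta \<T> Om p"
    "ev (Tmap \<T> P (cprod P Om) (\<lambda>y. cpair y p) w) = xiT \<T> P (D p) w" if "w \<in> TP" for w
    using pairing(1-3)[of w P "\<lambda>y. y" P "\<lambda>_. p" Om]
      pairing(4)[of w P "\<lambda>y. y" P "\<lambda>_. p" Om "\<lambda>(x, p). D p x"] that p
    by (simp_all add: Tmap_const Tmap_ident)
  have "z \<le> str (underlying \<T> (Omega \<T> X)) (p, q) \<longleftrightarrow>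
    (\<forall>r\<in>Tob \<T> (cprod P Om). T2 P Om r = eta \<T> Om p \<longrightarrow>
      (\<forall>x\<in>P. z * (ev r * a (T1 P Om r) x) \<le> D q x))"
    using p q by (simp add: underlying_def le_str_Omega_iff)
  also have "\<dots> \<longleftrightarrow> (\<forall>w\<in>TP. \<forall>x\<in>P. z * (xiT \<T> P (D p) w * a w x) \<le> D q x)" (is "?L \<longleftrightarrow> ?R")
  proof
    assume L: ?L
    show ?R
    proof (intro ballI)
      fix w x assume w: "w \<in> TP" and x: "x \<in> P"
      show "z * (xiT \<T> P (D p) w * a w x) \<le> D q x"
        using L[rule_format, OF pr(1)[OF w] pr(3)[OF w] x] unfolding pr(2,4)[OF w] .
    qed
  next
    assume R: ?R
    show ?L
    proof (intro ballI impI)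
      fix r x assume r: "r \<in> Tob \<T> (cprod P Om)" "T2 P Om r = eta \<T> Om p" and x: "x \<in> P"
      let ?w = "T1 P Om r"
      have w: "?w \<in> TP" using r by (simp add: T1_in)
      have "r = Tmap \<T> P (cprod P Om) (\<lambda>y. cpair y p) ?w"
        by (rule T_cprod_eta_snd[OF r(1) p small_P small_Om r(2)])
      then have "ev r = xiT \<T> P (D p) ?w" using pr(4)[OF w] by metis
      with R w x show "z * (ev r * a (T1 P Om r) x) \<le> D q x" by simp
    qed
  qed
  also have "\<dots> \<longleftrightarrow> (\<forall>x\<in>P. z * D p x \<le> D q x)" (is "?L \<longleftrightarrow> ?R")
  proof
    assume L: ?L
    show ?R
    proof
      fix x assume x: "x \<in> P"
      have "z * (D p x * 1) \<le> z * (D p x * a (eta \<T> P x) x)"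
        using a_refl[OF x] by (intro quantale_mult_mono) auto
      also have "\<dots> \<le> D q x"
        using L[rule_format, of "eta \<T> P x" x] x by simp
      finally show "z * D p x \<le> D q x" by simp
    qed
  next
    assume R: ?R
    show ?L
    proof (intro ballI)
      fix w x assume *: "w \<in> TP" "x \<in> P"
      have "z * (xiT \<T> P (D p) w * a w x) \<le> z * D p x"
        using stableD[OF stable_D[OF p] *] by (intro quantale_mult_mono) auto
      with R * show "z * (xiT \<T> P (D p) w * a w x) \<le> D q x" by (meson order_trans)
    qed
  qed
  also have "\<dots> \<longleftrightarrow> z \<le> (INF x\<in>P. qhom (D p x) (D q x))"
    by (simp add: le_INF_iff le_qhom_iff)
  finally show "z \<le> str (underlying \<T> (Omega \<T> X)) (p, q) \<longleftrightarrow>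
    z \<le> (INF x\<in>P. qhom (D p x) (D q x))" .
qed

text \<open>Yoneda for the column at e(x): reflexivity at y = x gives one inequality, stability of p
  at e(x) the other.\<close>

lemma eval_at_representing_point:
  assumes x: "x \<in> P" and p: "stable X p"
  shows "(INF y\<in>P. qhom (a (eta \<T> P x) y) (p y)) = p x"
proof (rule order_antisym)
  have "(INF y\<in>P. qhom (a (eta \<T> P x) y) (p y)) \<le> qhom (a (eta \<T> P x) x) (p x)"
    using x by (rule INF_lower)
  also have "\<dots> \<le> qhom 1 (p x)" using a_refl[OF x] by (rule qhom_antimono)
  finally show "(INF y\<in>P. qhom (a (eta \<T> P x) y) (p y)) \<le> p x" by simp
  have "p x * a (eta \<T> P x) y \<le> p y" if "y \<in> P" for y
    using stableD[OF p, of "eta \<T> P x" y] x that by simp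
  then show "p x \<le> (INF y\<in>P. qhom (a (eta \<T> P x) y) (p y))"
    by (intro INF_greatest) (simp add: le_qhom_iff[symmetric])
qed

sublocale \<Omega>: eval_graph "underlying \<T> (Omega \<T> X)" P D
proof
  fix p q assume pq: "p \<in> pts (underlying \<T> (Omega \<T> X))" "q \<in> pts (underlying \<T> (Omega \<T> X))"
  then show "str (underlying \<T> (Omega \<T> X)) (p, q) = (INF x\<in>P. qhom (D p x) (D q x))"
    by (simp add: str_underlying_Omega)
  assume "\<And>x. x \<in> P \<Longrightarrow> D p x = D q x"
  then show "p = q" using pq by (simp add: Om_eqI)
next
  fix S :: "('v \<times> 'u) set" assume S: "S \<subseteq> UNIV \<times> pts (underlying \<T> (Omega \<T> X))"
  have "stable X (\<lambda>x. INF i\<in>S. (case i of (v, p) \<Rightarrow> qhom v (D p x)))"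
  proof (rule stable_INF)
    fix i assume "i \<in> S"
    then obtain v p where "i = (v, p)" "p \<in> Om" using S by auto
    then show "stable X (\<lambda>x. case i of (v, p) \<Rightarrow> qhom v (D p x))"
      by (simp add: stable_qhom stable_D)
  qed
  then show "\<exists>c\<in>pts (underlying \<T> (Omega \<T> X)). \<forall>x\<in>P. D c x = (INF (v, p)\<in>S. qhom v (D p x))"
    by (intro bexI[of _ "C (\<lambda>x. INF (v, p)\<in>S. qhom v (D p x))"]) (simp_all add: C_in)
next
  fix p v assume "p \<in> pts (underlying \<T> (Omega \<T> X))"
  then show "\<exists>t\<in>pts (underlying \<T> (Omega \<T> X)). \<forall>x\<in>P. D t x = v * D p x"
    by (intro bexI[of _ "C (\<lambda>x. v * D p x)"]) (simp_all add: C_in stable_mult stable_D)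
next
  fix x assume x: "x \<in> P"
  have "C (a (eta \<T> P x)) \<in> Om" using x by (intro C_in stable_column) simp
  moreover have "str (underlying \<T> (Omega \<T> X)) (C (a (eta \<T> P x)), p) = D p x" if "p \<in> Om" for p
    using that x calculation by (simp add: str_underlying_Omega eval_at_representing_point stable_D)
  ultimately show "\<exists>r\<in>pts (underlying \<T> (Omega \<T> X)). \<forall>p\<in>pts (underlying \<T> (Omega \<T> X)).
      str (underlying \<T> (Omega \<T> X)) (r, p) = D p x"
    by auto
qed


text \<open>\<open>t\<close>, uncurried, is a functor from the product of \<open>X\<close> and the algebra \<open>I\<close> to \<open>V\<close>.\<close>

definition joint :: "'u set \<Rightarrow> ('u \<Rightarrow> 'u) \<Rightarrow> ('u \<Rightarrow> 'u \<Rightarrow> 'v) \<Rightarrow> bool" where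
  "joint I \<alpha> t \<longleftrightarrow> (\<forall>r\<in>Tob \<T> (cprod P I). \<forall>x\<in>P.
    xiT \<T> (cprod P I) (\<lambda>z. t (cfst z) (csnd z)) r * a (T1 P I r) x \<le> t x (\<alpha> (T2 P I r)))"

text \<open>This is transposition for the exponential V^X. The structure of \<open>Omega\<close>
  tests all q over T g(w), and the weak pullback lifts each such q to some r in T(X x I) over w;
  conversely every r has such an image.\<close>

lemma T_morphism_Omega_iff:
  assumes \<alpha>: "T_algebra \<T> I \<alpha>" and g: "g \<in> I \<rightarrow> Om"
  shows "T_morphism \<T> (alg_graph \<T> I \<alpha>) (Omega \<T> X) g \<longleftrightarrow> joint I \<alpha> (\<lambda>x i. D (g i) x)"
proof -
  have I: "small I" "\<And>w. w \<in> Tob \<T> I \<Longrightarrow> \<alpha> w \<in> I" using \<alpha> by (auto simp: T_algebra_def)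
  have gc: "cfst \<in> cprod P I \<rightarrow> P" "csnd \<in> cprod P I \<rightarrow> I"
    "(\<lambda>z. g (csnd z)) \<in> cprod P I \<rightarrow> Om" using g by auto
  let ?q = "Tmap \<T> (cprod P I) (cprod P Om) (\<lambda>z. cpair (cfst z) (g (csnd z)))"
  have q: "?q r \<in> Tob \<T> (cprod P Om)" "T1 P Om (?q r) = T1 P I r"
    "T2 P Om (?q r) = Tmap \<T> I Om g (T2 P I r)"
    "ev (?q r) = xiT \<T> (cprod P I) (\<lambda>z. D (g (csnd z)) (cfst z)) r"
    if r: "r \<in> Tob \<T> (cprod P I)" for r
  proof -
    show "?q r \<in> Tob \<T> (cprod P Om)" "T1 P Om (?q r) = T1 P I r"
      using pairing(1,2)[OF r gc(1,3)] I by (auto simp: small_cprod)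
    show "T2 P Om (?q r) = Tmap \<T> I Om g (T2 P I r)"
      using pairing(3)[OF r gc(1,3)] Tmap_Tmap[OF r gc(2) g] I
      by (auto simp: small_cprod)
    show "ev (?q r) = xiT \<T> (cprod P I) (\<lambda>z. D (g (csnd z)) (cfst z)) r"
      using pairing(4)[OF r gc(1,3), of "\<lambda>(x, p). D p x"] I by (auto simp: small_cprod)
  qed
  have "T_morphism \<T> (alg_graph \<T> I \<alpha>) (Omega \<T> X) g \<longleftrightarrow>
    (\<forall>w\<in>Tob \<T> I. \<forall>q\<in>Tob \<T> (cprod P Om). T2 P Om q = Tmap \<T> I Om g w \<longrightarrow>
      (\<forall>x\<in>P. ev q * a (T1 P Om q) x \<le> D (g (\<alpha> w)) x))"
  proof -
    have "Tmap \<T> I Om g w \<in> Tob \<T> Om" "g (\<alpha> w) \<in> Om" if "w \<in> Tob \<T> I" for w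
      using that I g by (auto intro: Tmap_in)
    then show ?thesis using g by (simp add: T_morphism_alg_iff[OF \<alpha>] le_str_Omega_iff)
  qed
  also have "\<dots> \<longleftrightarrow> joint I \<alpha> (\<lambda>x i. D (g i) x)" (is "?L \<longleftrightarrow> ?R")
  proof
    assume L: ?L
    show ?R unfolding joint_def
    proof (intro ballI)
      fix r x assume r: "r \<in> Tob \<T> (cprod P I)" and x: "x \<in> P"
      have "T2 P I r \<in> Tob \<T> I" using r I by (intro T2_in) auto
      from L[rule_format, OF this q(1)[OF r] q(3)[OF r] x]
      show "xiT \<T> (cprod P I) (\<lambda>z. D (g (csnd z)) (cfst z)) r * a (T1 P I r) x \<le>
        D (g (\<alpha> (T2 P I r))) x"
        unfolding q(2,4)[OF r] .
    qed
  next
    assume R: ?R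
    show ?L
    proof (intro ballI impI)
      fix w q' x assume w: "w \<in> Tob \<T> I" "q' \<in> Tob \<T> (cprod P Om)"
        "T2 P Om q' = Tmap \<T> I Om g w" and x: "x \<in> P"
      obtain r where r: "r \<in> Tob \<T> (cprod P I)" "T2 P I r = w" "q' = ?q r"
        using T_cprod_lift_snd[OF w(2,1) g small_P small_Om I(1) w(3)] by blast
      show "ev q' * a (T1 P Om q') x \<le> D (g (\<alpha> w)) x"
        using R[unfolded joint_def, rule_format, OF r(1) x]
        unfolding r(3) q(2,4)[OF r(1)] r(2) .
    qed
  qed
  finally show ?thesis .
qed

lemma joint_cong:
  assumes "T_algebra \<T> I \<alpha>" "\<And>x i. x \<in> P \<Longrightarrow> i \<in> I \<Longrightarrow> t x i = t' x i" "joint I \<alpha> t"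
  shows "joint I \<alpha> t'"
proof -
  have I: "small I" "\<And>w. w \<in> Tob \<T> I \<Longrightarrow> \<alpha> w \<in> I" using assms(1) by (auto simp: T_algebra_def)
  have "xiT \<T> (cprod P I) (\<lambda>z. t' (cfst z) (csnd z)) r =
    xiT \<T> (cprod P I) (\<lambda>z. t (cfst z) (csnd z)) r" if "r \<in> Tob \<T> (cprod P I)" for r
    using that assms(2) I by (intro xiT_cong) (auto simp: small_cprod elim!: cprodE)
  then show ?thesis
    using assms(2,3) I by (simp add: joint_def T2_in flip: assms(2))
qed

text \<open>\<xi> . T of the supremum is a supremum over those r in T(X x I) with first component w.
  By \<open>joint\<close>, each r contributes at most the term with index
  \<open>\<alpha> (T2 P I r)\<close>, so the algebra structure selects an index.\<close>

lemma stable_SUP: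
  assumes \<alpha>: "T_algebra \<T> I \<alpha>" and t: "joint I \<alpha> t"
  shows "stable X (\<lambda>x. SUP i\<in>I. t x i)"
proof -
  have I: "small I" "\<And>w. w \<in> Tob \<T> I \<Longrightarrow> \<alpha> w \<in> I" using \<alpha> by (auto simp: T_algebra_def)
  have "xiT \<T> P (\<lambda>x. SUP i\<in>I. t x i) w * a w x \<le> (SUP i\<in>I. t x i)"
    if w: "w \<in> TP" and x: "x \<in> P" for w x
  proof -
    have "xiT \<T> P (\<lambda>x. SUP i\<in>I. t x i) w = (SUP r\<in>{r \<in> Tob \<T> (cprod P I). T1 P I r = w}.
        xiT \<T> (cprod P I) (\<lambda>z. t (cfst z) (csnd z)) r)"
      using xiT_SUP_fst[OF w small_P I(1), of "\<lambda>z. t (cfst z) (csnd z)"] by simp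
    also have "\<dots> * a w x \<le> (SUP i\<in>I. t x i)"
      unfolding quantale_SUP_mult
    proof (rule SUP_least)
      fix r assume "r \<in> {r \<in> Tob \<T> (cprod P I). T1 P I r = w}"
      then have r: "r \<in> Tob \<T> (cprod P I)" "T1 P I r = w" by auto
      have "xiT \<T> (cprod P I) (\<lambda>z. t (cfst z) (csnd z)) r * a w x \<le> t x (\<alpha> (T2 P I r))"
        using t[unfolded joint_def, rule_format, OF r(1) x] unfolding r(2) .
      also have "\<dots> \<le> (SUP i\<in>I. t x i)"
        using r(1) I by (intro SUP_upper I(2) T2_in) auto
      finally show "xiT \<T> (cprod P I) (\<lambda>z. t (cfst z) (csnd z)) r * a w x \<le> (SUP i\<in>I. t x i)" .
    qed
    finally show ?thesis .
  qed
  then show ?thesis by (simp add: stable_def)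
qed

text \<open>Tensors in \<open>Omega\<close> are pointwise and unique, so the choice of tensors
  disappears and the morphism condition becomes \<open>joint\<close> for their values.\<close>

lemma T_diagram_Omega_iff:
  "T_diagram \<T> (Omega \<T> X) I \<alpha> h \<psi> \<longleftrightarrow>
    T_algebra \<T> (pts I) \<alpha> \<and> V_category I \<and> V_functor I (underlying \<T> (Omega \<T> X)) h \<and>
    V_dist_from_1 I \<psi> \<and> joint (pts I) \<alpha> (\<lambda>x i. \<psi> i * D (h i) x)" (is "?L \<longleftrightarrow> ?R")
proof
  assume L: ?L
  then obtain t where \<alpha>: "T_algebra \<T> (pts I) \<alpha>" and V: "V_category I"
    "V_functor I (underlying \<T> (Omega \<T> X)) h" "V_dist_from_1 I \<psi>"
    and t: "\<And>i. i \<in> pts I \<Longrightarrow> is_tensor (underlying \<T> (Omega \<T> X)) (\<psi> i) (h i) (t i)"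
      "T_morphism \<T> (alg_graph \<T> (pts I) \<alpha>) (Omega \<T> X) t"
    unfolding T_diagram_def by blast
  have h: "h \<in> pts I \<rightarrow> Om" using V(2) by (simp add: V_functor_def)
  have t': "t i \<in> Om" "\<And>x. x \<in> P \<Longrightarrow> D (t i) x = \<psi> i * D (h i) x" if "i \<in> pts I" for i
    using t(1)[OF that] h that \<Omega>.is_tensor_iff[of "h i"] by auto
  then have "t \<in> pts I \<rightarrow> Om" by blast
  from T_morphism_Omega_iff[OF \<alpha> this] t(2) have "joint (pts I) \<alpha> (\<lambda>x i. D (t i) x)" by blast
  from joint_cong[OF \<alpha> _ this] t'(2) \<alpha> V show ?R by simp
next
  assume R: ?R
  let ?t = "\<lambda>i. C (\<lambda>x. \<psi> i * D (h i) x)"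
  from R have h: "h \<in> pts I \<rightarrow> Om" and \<alpha>: "T_algebra \<T> (pts I) \<alpha>"
    and j: "joint (pts I) \<alpha> (\<lambda>x i. \<psi> i * D (h i) x)"
    by (simp_all add: V_functor_def)
  have "stable X (\<lambda>x. \<psi> i * D (h i) x)" if "i \<in> pts I" for i
    using h that by (intro stable_mult stable_D) auto
  then have t: "?t \<in> pts I \<rightarrow> Om" by (auto intro: C_in)
  have "is_tensor (underlying \<T> (Omega \<T> X)) (\<psi> i) (h i) (?t i)" if "i \<in> pts I" for i
    using funcset_mem[OF h that] funcset_mem[OF t that] by (simp add: \<Omega>.is_tensor_iff)
  moreover have "joint (pts I) \<alpha> (\<lambda>x i. D (?t i) x)"
    by (rule joint_cong[OF \<alpha> _ j]) simp
  then have "T_morphism \<T> (alg_graph \<T> (pts I) \<alpha>) (Omega \<T> X) ?t"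
    using T_morphism_Omega_iff[OF \<alpha> t] by blast
  ultimately have "\<exists>t. (\<forall>i\<in>pts I. is_tensor (underlying \<T> (Omega \<T> X)) (\<psi> i) (h i) (t i)) \<and>
      T_morphism \<T> (alg_graph \<T> (pts I) \<alpha>) (Omega \<T> X) t"
    by (intro exI[of _ ?t]) simp
  with R show ?L unfolding T_diagram_def by (elim conjE) (intro conjI)
qed

lemma T_graph_Omega: "T_graph \<T> (Omega \<T> X)"
proof -
  have "1 \<le> str (Omega \<T> X) (eta \<T> Om p, p)" if "p \<in> Om" for p
    using \<Omega>.str_refl[of p] that by (simp add: underlying_def)
  then show ?thesis by (simp add: T_graph_def) (simp add: Omega_def)
qed

text \<open>A T-generated L has the same weighted supremum as the diagram that generates it: the
  terms p = h i give one inequality, [p, h i] \<otimes> p \<le> h i the other.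
  \<open>stable_SUP\<close> places this supremum in \<open>Omega\<close>.\<close>

lemma T_frame_Omega: "T_frame \<T> (Omega \<T> X)"
proof (rule T_frameI[OF T_graph_Omega \<Omega>.eval_graph_axioms])
  let ?A = "underlying \<T> (Omega \<T> X)"
  fix L assume "T_generated \<T> (Omega \<T> X) L"
  then obtain I \<alpha> h \<psi> where d: "T_diagram \<T> (Omega \<T> X) I \<alpha> h \<psi>"
    and L: "\<And>p. p \<in> Om \<Longrightarrow> L p = (SUP i\<in>pts I. str ?A (p, h i) * \<psi> i)"
    unfolding T_generated_def by auto
  have \<alpha>: "T_algebra \<T> (pts I) \<alpha>" and h: "h \<in> pts I \<rightarrow> Om"
    and j: "joint (pts I) \<alpha> (\<lambda>x i. \<psi> i * D (h i) x)"
    using d unfolding T_diagram_Omega_iff by (auto simp: V_functor_def)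
  let ?s = "\<lambda>x. SUP i\<in>pts I. \<psi> i * D (h i) x"
  have "?s x = (SUP p\<in>Om. L p * D p x)" if x: "x \<in> P" for x
  proof (rule order_antisym)
    show "?s x \<le> (SUP p\<in>Om. L p * D p x)"
    proof (rule SUP_least)
      fix i assume i: "i \<in> pts I"
      then have hi: "h i \<in> Om" using h by blast
      have "1 * \<psi> i \<le> str ?A (h i, h i) * \<psi> i"
        using \<Omega>.str_refl[of "h i"] hi by (intro quantale_mult_mono) auto
      also have "\<dots> \<le> L (h i)" unfolding L[OF hi] using i by (rule SUP_upper)
      finally have "\<psi> i * D (h i) x \<le> L (h i) * D (h i) x"
        by (intro quantale_mult_mono) auto
      also have "\<dots> \<le> (SUP p\<in>Om. L p * D p x)" using hi by (rule SUP_upper)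
      finally show "\<psi> i * D (h i) x \<le> (SUP p\<in>Om. L p * D p x)" .
    qed
    have "str ?A (p, h i) * \<psi> i * D p x \<le> ?s x" if p: "p \<in> Om" and i: "i \<in> pts I" for p i
    proof -
      have hi: "h i \<in> Om" using h i by blast
      have "str ?A (p, h i) * D p x \<le> D (h i) x"
        using \<Omega>.le_str_iff[of p "h i" "str ?A (p, h i)"] p hi x by simp
      then have "\<psi> i * (str ?A (p, h i) * D p x) \<le> \<psi> i * D (h i) x"
        by (intro quantale_mult_mono) auto
      also have "\<dots> \<le> ?s x" using i by (rule SUP_upper)
      finally show ?thesis by (simp add: ac_simps)
    qed
    then show "(SUP p\<in>Om. L p * D p x) \<le> ?s x"
      by (auto simp: L quantale_SUP_mult intro!: SUP_least)
  qed
  then show "\<Omega>.pointwise_sup L"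
    unfolding \<Omega>.pointwise_sup_def
    by (intro bexI[of _ "C ?s"]) (simp_all add: C_in stable_SUP[OF \<alpha> j])
qed


section \<open>Frame homomorphisms to \<open>V\<close>\<close>

text \<open>The value of the Kleisli composite of f from E to X with p from X to E.\<close>

definition act :: "('u \<Rightarrow> 'v) \<Rightarrow> ('u \<Rightarrow> 'v) \<Rightarrow> 'v" where
  "act f p = (SUP w\<in>TP. xiT \<T> P p w * f w)"

definition hom_of :: "('u \<Rightarrow> 'v) \<Rightarrow> 'u \<Rightarrow> 'u" where
  "hom_of f = (\<lambda>p\<in>Om. val \<T> (act f (D p)))"

lemma act_cong: "(\<And>x. x \<in> P \<Longrightarrow> p x = q x) \<Longrightarrow> act f p = act f q"
  unfolding act_def by (intro SUP_cong refl arg_cong2[of _ _ _ _ "(*)"] xiT_cong) auto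

lemma E_adjD:
  assumes "E_adj X f g"
  shows "W \<in> Tob \<T> TP \<Longrightarrow> xiT \<T> TP f W \<le> f (mu \<T> P W)"
    and "U \<in> Tob \<T> (cprod TP P) \<Longrightarrow>
      xm TP P (str X) U * f (T2 TP P U) \<le> f (mu \<T> P (T1 TP P U))"
    and "stable X g"
    and "1 \<le> act f g"
    and "\<lbrakk>w \<in> TP; x \<in> P\<rbrakk> \<Longrightarrow> f w * g x \<le> a w x"
  using assms unfolding E_adj_def act_def by blast+

text \<open>The counit and stability of p give one inequality. For the other, h = [g, p] satisfies h
  \<otimes> g \<le> p; the constant h passes through \<xi> . T, so h \<otimes>
  \<open>act f g\<close> is at most \<open>act f p\<close>, and the unit says that
  \<open>act f g\<close> is at least k.\<close>

lemma act_eq_INF: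
  assumes adj: "E_adj X f g" and p: "stable X p"
  shows "act f p = (INF x\<in>P. qhom (g x) (p x))"
proof (rule order_antisym)
  show "act f p \<le> (INF x\<in>P. qhom (g x) (p x))"
    unfolding act_def
  proof (intro INF_greatest SUP_least)
    fix w x assume *: "w \<in> TP" "x \<in> P"
    have "xiT \<T> P p w * (f w * g x) \<le> xiT \<T> P p w * a w x"
      using E_adjD(5)[OF adj *] by (intro quantale_mult_mono) auto
    also have "\<dots> \<le> p x" using stableD[OF p *] .
    finally show "xiT \<T> P p w * f w \<le> qhom (g x) (p x)"
      by (simp add: le_qhom_iff[symmetric] mult.assoc)
  qed
  let ?h = "INF x\<in>P. qhom (g x) (p x)"
  have "?h * g x \<le> p x" if "x \<in> P" for x
    unfolding le_qhom_iff using that by (rule INF_lower)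
  then have "?h * xiT \<T> P g w \<le> xiT \<T> P p w" if "w \<in> TP" for w
    using that by (simp add: xiT_mono flip: xiT_const_mult)
  then have "?h * xiT \<T> P g w * f w \<le> xiT \<T> P p w * f w" if "w \<in> TP" for w
    using that by (intro quantale_mult_mono) auto
  then have "?h * act f g \<le> act f p"
    by (auto simp: act_def quantale_mult_SUP mult.assoc intro!: SUP_mono)
  moreover have "?h * 1 \<le> ?h * act f g" using E_adjD(4)[OF adj] by (intro quantale_mult_mono) auto
  ultimately show "?h \<le> act f p" by simp
qed

text \<open>One inequality is the action of the structure of X on f, taken at T(w, -)(v); the other
  is the counit read through \<open>act_eq_INF\<close>.\<close>

lemma act_column:
  assumes adj: "E_adj X f g" and w: "w \<in> TP"
  shows "act f (a w) = f w"
proof (rule order_antisym)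
  show "f w \<le> act f (a w)"
    unfolding act_eq_INF[OF adj stable_column[OF w]]
    using E_adjD(5)[OF adj w] by (auto simp: le_qhom_iff[symmetric] intro!: INF_greatest)
  have "xiT \<T> P (a w) v * f v \<le> f w" if v: "v \<in> TP" for v
  proof -
    let ?U = "Tmap \<T> P (cprod TP P) (\<lambda>y. cpair w y) v"
    have "?U \<in> Tob \<T> (cprod TP P)" "T1 TP P ?U = eta \<T> TP w" "T2 TP P ?U = v"
      "xm TP P (str X) ?U = xiT \<T> P (a w) v"
      using pairing[of v P "\<lambda>_. w" TP "\<lambda>y. y" P] v w by (simp_all add: Tmap_const Tmap_ident)
    with E_adjD(2)[OF adj, of ?U] w show ?thesis by simp
  qed
  then show "act f (a w) \<le> f w" by (auto simp: act_def intro!: SUP_least)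
qed

text \<open>\<xi> . T of the supremum in \<open>act\<close> becomes a supremum over W in T(T X x I).
  Each W is flattened to T(X x I), and the resulting term is compared with the infimum form of
  \<open>act\<close> on the right.\<close>

lemma hom_of_compatible:
  assumes adj: "E_adj X f g" and \<alpha>: "T_algebra \<T> I \<alpha>" and t: "joint I \<alpha> t"
    and st: "\<And>i. i \<in> I \<Longrightarrow> stable X (\<lambda>x. t x i)" and w: "w \<in> Tob \<T> I"
  shows "xiT \<T> I (\<lambda>i. act f (\<lambda>x. t x i)) w \<le> act f (\<lambda>x. t x (\<alpha> w))"
proof -
  have I: "small I" "\<And>w. w \<in> Tob \<T> I \<Longrightarrow> \<alpha> w \<in> I" using \<alpha> by (auto simp: T_algebra_def)
  have sm: "small (cprod TP I)" using I by (simp add: small_cprod)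
  let ?G = "\<lambda>z. xiT \<T> P (\<lambda>x. t x (csnd z)) (cfst z) * f (cfst z)"
  have "xiT \<T> I (\<lambda>i. act f (\<lambda>x. t x i)) w =
      (SUP W\<in>{W \<in> Tob \<T> (cprod TP I). T2 TP I W = w}. xiT \<T> (cprod TP I) ?G W)"
    using xiT_SUP_snd[OF w _ I(1), of TP ?G] by (simp add: act_def)
  also have "\<dots> \<le> (INF x\<in>P. qhom (g x) (t x (\<alpha> w)))"
  proof (intro SUP_least INF_greatest)
    fix W x assume "W \<in> {W \<in> Tob \<T> (cprod TP I). T2 TP I W = w}" and x: "x \<in> P"
    then have W: "W \<in> Tob \<T> (cprod TP I)" "T2 TP I W = w" by auto
    \<comment> \<open>Evaluating t along r is iterated evaluation along W, and the X-component of r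
      is the multiplication of that of W. So the first clause of \<open>E_adj\<close> can bound the
      factor coming from f.\<close>
    obtain r where r: "r \<in> Tob \<T> (cprod P I)" "T1 P I r = mu \<T> P (T1 TP I W)" "T2 P I r = T2 TP I W"
      "\<forall>t. xiT \<T> (cprod P I) t r =
        xiT \<T> (cprod TP I) (\<lambda>z. xiT \<T> P (\<lambda>x. t (cpair x (csnd z))) (cfst z)) W"
      using strength[OF W(1) small_P I(1)] .
    let ?t = "xiT \<T> (cprod P I) (\<lambda>z. t (cfst z) (csnd z)) r" and ?w = "T1 P I r"
    have TW: "T1 TP I W \<in> Tob \<T> TP" using W(1) I by (intro T1_in) auto
    have "xiT \<T> (cprod TP I) (\<lambda>z. f (cfst z)) W = xiT \<T> TP f (T1 TP I W)"
      using W(1) sm by (intro xiT_Tmap[symmetric]) auto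
    also have "\<dots> \<le> f ?w" unfolding r(2) by (rule E_adjD(1)[OF adj TW])
    finally have "xiT \<T> (cprod TP I) ?G W \<le> ?t * f ?w"
      using W(1) sm by (simp add: xiT_mult r(4) quantale_mult_mono)
    then have "xiT \<T> (cprod TP I) ?G W * g x \<le> ?t * f ?w * g x"
      by (intro quantale_mult_mono) auto
    also have "\<dots> \<le> ?t * a ?w x"
      unfolding mult.assoc
      by (intro quantale_mult_mono order_refl E_adjD(5)[OF adj T1_in[OF r(1) small_P I(1)] x])
    also have "\<dots> \<le> t x (\<alpha> w)"
      using t[unfolded joint_def, rule_format, OF r(1) x] unfolding r(3) W(2) .
    finally show "xiT \<T> (cprod TP I) ?G W \<le> qhom (g x) (t x (\<alpha> w))"
      by (simp add: le_qhom_iff[symmetric])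
  qed
  also have "\<dots> = act f (\<lambda>x. t x (\<alpha> w))"
    using act_eq_INF[OF adj st] I w by simp
  finally show ?thesis .
qed

text \<open>Naturality rewrites \<xi> . T of the supremum as a supremum over r in T(X x I). The
  counit and \<open>joint\<close> put the term of r below [g, t(-, i)] with i =
  \<open>\<alpha> (T2 P I r)\<close>, which is \<open>act\<close> at a single index.\<close>

lemma act_SUP:
  assumes adj: "E_adj X f g" and \<alpha>: "T_algebra \<T> I \<alpha>" and t: "joint I \<alpha> t"
    and st: "\<And>i. i \<in> I \<Longrightarrow> stable X (\<lambda>x. t x i)"
  shows "act f (\<lambda>x. SUP i\<in>I. t x i) = (SUP i\<in>I. act f (\<lambda>x. t x i))"
proof (rule order_antisym)
  have I: "small I" "\<And>w. w \<in> Tob \<T> I \<Longrightarrow> \<alpha> w \<in> I" using \<alpha> by (auto simp: T_algebra_def)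
  have "xiT \<T> P (\<lambda>x. SUP i\<in>I. t x i) w * f w \<le> (SUP i\<in>I. act f (\<lambda>x. t x i))" if w: "w \<in> TP" for w
  proof -
    have "xiT \<T> P (\<lambda>x. SUP i\<in>I. t x i) w = (SUP r\<in>{r \<in> Tob \<T> (cprod P I). T1 P I r = w}.
        xiT \<T> (cprod P I) (\<lambda>z. t (cfst z) (csnd z)) r)"
      using xiT_SUP_fst[OF w small_P I(1), of "\<lambda>z. t (cfst z) (csnd z)"] by simp
    also have "\<dots> * f w \<le> (SUP i\<in>I. act f (\<lambda>x. t x i))"
      unfolding quantale_SUP_mult
    proof (rule SUP_least)
      fix r assume "r \<in> {r \<in> Tob \<T> (cprod P I). T1 P I r = w}"
      then have r: "r \<in> Tob \<T> (cprod P I)" "T1 P I r = w" by auto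
      let ?t = "xiT \<T> (cprod P I) (\<lambda>z. t (cfst z) (csnd z)) r"
      have i: "\<alpha> (T2 P I r) \<in> I" using r(1) I by (intro I(2) T2_in) auto
      have "?t * f w * g x \<le> t x (\<alpha> (T2 P I r))" if x: "x \<in> P" for x
      proof -
        have "?t * (f w * g x) \<le> ?t * a w x"
          using E_adjD(5)[OF adj w x] by (intro quantale_mult_mono) auto
        also have "\<dots> \<le> t x (\<alpha> (T2 P I r))"
          using t[unfolded joint_def, rule_format, OF r(1) x] unfolding r(2) .
        finally show ?thesis by (simp add: mult.assoc)
      qed
      then have "?t * f w \<le> act f (\<lambda>x. t x (\<alpha> (T2 P I r)))"
        unfolding act_eq_INF[OF adj st[OF i]]
        by (intro INF_greatest) (simp add: le_qhom_iff[symmetric])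
      also have "\<dots> \<le> (SUP i\<in>I. act f (\<lambda>x. t x i))" using i by (rule SUP_upper)
      finally show "?t * f w \<le> (SUP i\<in>I. act f (\<lambda>x. t x i))" .
    qed
    finally show ?thesis .
  qed
  then show "act f (\<lambda>x. SUP i\<in>I. t x i) \<le> (SUP i\<in>I. act f (\<lambda>x. t x i))"
    unfolding act_def[of f "\<lambda>x. SUP i\<in>I. t x i"] by (rule SUP_least)
  have "xiT \<T> P (\<lambda>x. t x i) w * f w \<le> xiT \<T> P (\<lambda>x. SUP i\<in>I. t x i) w * f w"
    if "i \<in> I" "w \<in> TP" for i w
    using that by (intro quantale_mult_mono xiT_mono SUP_upper) auto
  then show "(SUP i\<in>I. act f (\<lambda>x. t x i)) \<le> act f (\<lambda>x. SUP i\<in>I. t x i)"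
    unfolding act_def by (intro SUP_least SUP_subset_mono subset_refl)
qed

lemma act_mult: "act f (\<lambda>x. v * p x) = v * act f p"
  by (simp add: act_def quantale_mult_SUP mult.assoc xiT_const_mult)

lemma unval_hom_of [simp]: "p \<in> Om \<Longrightarrow> unval \<T> (hom_of f p) = act f (D p)"
  by (simp add: hom_of_def)

lemma hom_of_in_V [simp]: "p \<in> Om \<Longrightarrow> hom_of f p \<in> Vset \<T>"
  by (simp add: hom_of_def)

lemma hom_of_in_T_Frm:
  assumes adj: "E_adj X f g"
  shows "hom_of f \<in> T_Frm \<T> (Omega \<T> X) (V_obj \<T>)"
proof -
  let ?U = "underlying \<T> (Omega \<T> X)" and ?V = "underlying \<T> (V_obj \<T>)"
  interpret V: eval_graph ?V "UNIV :: unit set" "\<lambda>u _. unval \<T> u" by (rule eval_graph_V)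
  have act: "act f (D p) = (INF x\<in>P. qhom (g x) (D p x))" if "p \<in> Om" for p
    using act_eq_INF[OF adj stable_D[OF that]] .
  have "V_functor ?U ?V (hom_of f)"
  proof -
    have "str ?U (p, q) \<le> str ?V (hom_of f p, hom_of f q)" if p: "p \<in> Om" and q: "q \<in> Om" for p q
    proof -
      have "str ?U (p, q) * act f (D p) * g x \<le> D q x" if x: "x \<in> P" for x
      proof -
        have "act f (D p) * g x \<le> D p x"
          unfolding act[OF p] le_qhom_iff using x by (rule INF_lower)
        then have "str ?U (p, q) * (act f (D p) * g x) \<le> str ?U (p, q) * D p x"
          by (intro quantale_mult_mono) auto
        also have "\<dots> \<le> D q x" using \<Omega>.le_str_iff[of p q "str ?U (p, q)"] p q x by simp
        finally show ?thesis by (simp add: mult.assoc)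
      qed
      then have "str ?U (p, q) * act f (D p) \<le> act f (D q)"
        unfolding act[OF q] by (intro INF_greatest) (simp add: le_qhom_iff[symmetric])
      then show ?thesis using p q by (simp add: str_underlying_V le_qhom_iff)
    qed
    then show ?thesis by (simp add: V_functor_def)
  qed
  moreover have "T_compatible \<T> (Omega \<T> X) (V_obj \<T>) (hom_of f)"
    unfolding T_compatible_def
  proof (intro allI impI)
    fix I \<alpha> h assume "T_algebra \<T> I \<alpha> \<and> T_morphism \<T> (alg_graph \<T> I \<alpha>) (Omega \<T> X) h"
    then have \<alpha>: "T_algebra \<T> I \<alpha>" and h: "T_morphism \<T> (alg_graph \<T> I \<alpha>) (Omega \<T> X) h" by auto
    have I: "small I" using \<alpha> by (simp add: T_algebra_def)
    have hO: "h \<in> I \<rightarrow> Om" using h by (simp add: T_morphism_def alg_graph_def)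
    have j: "joint I \<alpha> (\<lambda>x i. D (h i) x)" using h T_morphism_Omega_iff[OF \<alpha> hO] by blast
    have st: "stable X (\<lambda>x. D (h i) x)" if "i \<in> I" for i
      using stable_D[OF funcset_mem[OF hO that]] .
    have "T_morphism \<T> (alg_graph \<T> I \<alpha>) (V_obj \<T>) (\<lambda>i. val \<T> (act f (D (h i))))"
      unfolding T_morphism_alg_V_iff[OF \<alpha>] using hom_of_compatible[OF adj \<alpha> j st] by blast
    then show "T_morphism \<T> (alg_graph \<T> I \<alpha>) (V_obj \<T>) (\<lambda>i. hom_of f (h i))"
      using I hO by (elim T_morphism_cong[rotated 3]) (auto simp: alg_graph_def hom_of_def)
  qed
  moreover have "is_lim ?V (pts I) \<phi> (\<lambda>i. hom_of f (h i)) (hom_of f c)"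
    if "limit_data I ?U \<phi> h" "is_lim ?U (pts I) \<phi> h c" for I :: "('u, 'v) graph" and \<phi> h c
  proof -
    have h: "h i \<in> Om" if "i \<in> pts I" for i
      using \<open>limit_data I ?U \<phi> h\<close> that by (auto simp: limit_data_def V_functor_def)
    then have c: "c \<in> Om" "\<And>x. x \<in> P \<Longrightarrow> D c x = (INF i\<in>pts I. qhom (\<phi> i) (D (h i) x))"
      using that(2) \<Omega>.is_lim_iff[of "pts I" h \<phi> c] by auto
    have "act f (D c) = (INF i\<in>pts I. qhom (\<phi> i) (act f (D (h i))))"
    proof (rule eq_by_lower_bounds)
      fix z
      show "z \<le> act f (D c) \<longleftrightarrow> z \<le> (INF i\<in>pts I. qhom (\<phi> i) (act f (D (h i))))"
        using h by (auto simp: act c le_INF_iff le_qhom_iff[symmetric] ac_simps)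
    qed
    then show ?thesis using h c by (intro V.is_limI) simp_all
  qed
  moreover have "is_colim ?V (pts I) \<psi> (\<lambda>i. hom_of f (h i)) (hom_of f c)"
    if d: "T_diagram \<T> (Omega \<T> X) I \<alpha> h \<psi>" and c: "is_colim ?U (pts I) \<psi> h c"
    for I :: "('u, 'v) graph" and \<alpha> \<psi> h c
  proof -
    have \<alpha>: "T_algebra \<T> (pts I) \<alpha>" and hO: "h \<in> pts I \<rightarrow> Om"
      and j: "joint (pts I) \<alpha> (\<lambda>x i. \<psi> i * D (h i) x)"
      using d unfolding T_diagram_Omega_iff by (auto simp: V_functor_def)
    have h: "h i \<in> Om" if "i \<in> pts I" for i using hO that by blast
    let ?s = "\<lambda>x. SUP i\<in>pts I. \<psi> i * D (h i) x"
    \<comment> \<open>The pointwise supremum belongs to \<open>Omega\<close>, so it is a colimit,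
      and uniqueness forces c to be it.\<close>
    have C: "C ?s \<in> Om" using stable_SUP[OF \<alpha> j] by (rule C_in)
    then have "is_colim ?U (pts I) \<psi> h (C ?s)" using h by (intro \<Omega>.is_colimI) auto
    with c have eq: "c = C ?s" by (rule \<Omega>.is_colim_unique)
    have "act f (D c) = act f ?s" unfolding eq by (rule act_cong) simp
    also have "\<dots> = (SUP i\<in>pts I. \<psi> i * act f (D (h i)))"
      using act_SUP[OF adj \<alpha> j] h by (simp add: stable_mult stable_D act_mult)
    finally show ?thesis using h C eq by (intro V.is_colimI) simp_all
  qed
  ultimately have "T_frame_hom \<T> (Omega \<T> X) (V_obj \<T>) (hom_of f)"
    unfolding T_frame_hom_def using T_frame_Omega T_frame_V by blast
  then show ?thesis by (simp add: T_Frm_def hom_of_def)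
qed


section \<open>Adjunctions from frame homomorphisms\<close>

text \<open>Transitivity of the structure with the two factors exchanged: the columns form a family
  indexed by the free algebra T X.\<close>

lemma joint_column:
  "joint TP (mu \<T> P) (\<lambda>x w. a w x)"
  unfolding joint_def
proof (intro ballI)
  fix r x assume r: "r \<in> Tob \<T> (cprod P TP)" and x: "x \<in> P"
  let ?U = "Tmap \<T> (cprod P TP) (cprod TP P) (\<lambda>z. cpair (csnd z) (cfst z)) r"
  have fs: "csnd \<in> cprod P TP \<rightarrow> TP" "cfst \<in> cprod P TP \<rightarrow> P" by auto
  have sm: "small (cprod P TP)" by (simp add: small_cprod)
  note pr = pairing(1-3)[OF r fs _ _ sm] pairing(4)[OF r fs _ _ sm, of "str X"]
  have "xm TP P (str X) ?U * a (T2 TP P ?U) x \<le> a (mu \<T> P (T1 TP P ?U)) x"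
    using pr(1) x by (intro a_trans) auto
  then show "xiT \<T> (cprod P TP) (\<lambda>z. a (csnd z) (cfst z)) r * a (T1 P TP r) x \<le>
    a (mu \<T> P (T2 P TP r)) x"
    by (simp add: pr)
qed

text \<open>The weight \<xi> . T p is a homomorphism on the free algebra by \<open>xiT_mu\<close>,
  so along r it contributes exactly its value at the multiplication.\<close>

lemma joint_column_weighted:
  "joint TP (mu \<T> P) (\<lambda>x w. xiT \<T> P p w * a w x)"
  unfolding joint_def
proof (intro ballI)
  fix r x assume r: "r \<in> Tob \<T> (cprod P TP)" and x: "x \<in> P"
  have sm: "small (cprod P TP)" by (simp add: small_cprod)
  have T2: "T2 P TP r \<in> Tob \<T> TP" using r by (intro T2_in) auto
  have "xiT \<T> (cprod P TP) (\<lambda>z. xiT \<T> P p (csnd z)) r = xiT \<T> TP (xiT \<T> P p) (T2 P TP r)"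
    using r sm by (intro xiT_Tmap[symmetric]) auto
  also have "\<dots> = xiT \<T> P p (mu \<T> P (T2 P TP r))" using T2 by (intro xiT_mu[symmetric]) auto
  finally have "xiT \<T> (cprod P TP) (\<lambda>z. xiT \<T> P p (csnd z) * a (csnd z) (cfst z)) r * a (T1 P TP r) x =
    xiT \<T> P p (mu \<T> P (T2 P TP r)) *
      (xiT \<T> (cprod P TP) (\<lambda>z. a (csnd z) (cfst z)) r * a (T1 P TP r) x)"
    using r sm by (simp add: xiT_mult mult.assoc)
  also have "\<dots> \<le> xiT \<T> P p (mu \<T> P (T2 P TP r)) * a (mu \<T> P (T2 P TP r)) x"
    using joint_column[unfolded joint_def, rule_format, OF r x] by (intro quantale_mult_mono) auto
  finally show "xiT \<T> (cprod P TP) (\<lambda>z. xiT \<T> P p (csnd z) * a (csnd z) (cfst z)) r *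
    a (T1 P TP r) x \<le> xiT \<T> P p (mu \<T> P (T2 P TP r)) * a (mu \<T> P (T2 P TP r)) x" .
qed

text \<open>The lower bound is the term at w = e(x). This is density of the columns: with
  \<open>joint_column_weighted\<close> it presents each element of \<open>Omega\<close> as a
  T-weighted colimit of columns.\<close>

lemma stable_eq_SUP:
  assumes p: "stable X p" and x: "x \<in> P"
  shows "p x = (SUP w\<in>TP. xiT \<T> P p w * a w x)"
proof (rule order_antisym)
  have "p x * 1 \<le> xiT \<T> P p (eta \<T> P x) * a (eta \<T> P x) x"
    using x a_refl[OF x] by (intro quantale_mult_mono) auto
  also have "\<dots> \<le> (SUP w\<in>TP. xiT \<T> P p w * a w x)" using x by (intro SUP_upper) auto
  finally show "p x \<le> (SUP w\<in>TP. xiT \<T> P p w * a w x)" by simp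
  show "(SUP w\<in>TP. xiT \<T> P p w * a w x) \<le> p x" using x by (intro SUP_least stableD[OF p])
qed

lemma T_Frm_from_E_adj:
  assumes F: "F \<in> T_Frm \<T> (Omega \<T> X) (V_obj \<T>)"
  obtains f g where "E_adj X f g" "hom_of f = F"
proof -
  let ?U = "underlying \<T> (Omega \<T> X)" and ?V = "underlying \<T> (V_obj \<T>)"
  interpret V: eval_graph ?V "UNIV :: unit set" "\<lambda>u _. unval \<T> u" by (rule eval_graph_V)
  have Fext: "F \<in> extensional Om" and hom: "T_frame_hom \<T> (Omega \<T> X) (V_obj \<T>) F"
    using F by (simp_all add: T_Frm_def)
  have funF: "V_functor ?U ?V F" and comp: "T_compatible \<T> (Omega \<T> X) (V_obj \<T>) F"
    and lim: "\<And>(I :: ('u, 'v) graph) \<phi> h c. limit_data I ?U \<phi> h \<Longrightarrow> is_lim ?U (pts I) \<phi> h c \<Longrightarrow>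
      is_lim ?V (pts I) \<phi> (\<lambda>i. F (h i)) (F c)"
    and colim: "\<And>(I :: ('u, 'v) graph) \<alpha> \<psi> h c. T_diagram \<T> (Omega \<T> X) I \<alpha> h \<psi> \<Longrightarrow>
      is_colim ?U (pts I) \<psi> h c \<Longrightarrow> is_colim ?V (pts I) \<psi> (\<lambda>i. F (h i)) (F c)"
    using hom unfolding T_frame_hom_def by (elim conjE; simp)+
  define u where "u p = unval \<T> (F p)" for p
  have FV: "F p \<in> Vset \<T>" if "p \<in> Om" for p using funF that by (auto simp: V_functor_def)
  have F_eq: "F p = val \<T> (u p)" if "p \<in> Om" for p using FV[OF that] by (simp add: u_def)
  have u_mono: "str ?U (p, q) * u p \<le> u q" if p: "p \<in> Om" and q: "q \<in> Om" for p q
  proof -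
    have "str ?U (p, q) \<le> str ?V (F p, F q)" using funF p q by (simp add: V_functor_def)
    then show ?thesis using FV p q by (simp add: str_underlying_V u_def le_qhom_iff)
  qed
  \<comment> \<open>G is the limit of the identity diagram of \<open>Omega\<close> with weight u.
    The diagram is small because \<open>Omega\<close> is, and u is a distributor because F is a
    V-functor, so F preserves this limit.\<close>
  obtain G where G: "G \<in> pts ?U" "\<And>x. x \<in> P \<Longrightarrow> D G x = (INF p\<in>Om. qhom (u p) (D p x))"
    using \<Omega>.lim_exists[of Om "\<lambda>p. p" u] by auto
  have "is_lim ?U (pts ?U) u (\<lambda>p. p) G" using G by (intro \<Omega>.is_limI) auto
  moreover have "limit_data ?U ?U u (\<lambda>p. p)"
    using u_mono \<Omega>.V_category
    by (simp add: limit_data_def V_dist_to_1_def V_functor_def mult.commute)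
  ultimately have "is_lim ?V Om u F (F G)" using lim[of ?U u "\<lambda>p. p" G] by simp
  then have "u G = (INF p\<in>Om. qhom (u p) (u p))"
    using V.is_lim_iff[of Om F u "F G"] FV by (simp add: u_def)
  then have uG: "1 \<le> u G" by (simp add: le_INF_iff)
  have uD: "u p * D G x \<le> D p x" if p: "p \<in> Om" and x: "x \<in> P" for p x
  proof -
    have "D G x \<le> qhom (u p) (D p x)" unfolding G(2)[OF x] using p by (rule INF_lower)
    then show ?thesis by (simp add: le_qhom_iff[symmetric] mult.commute)
  qed
  have u_eq: "u p = (INF x\<in>P. qhom (D G x) (D p x))" if p: "p \<in> Om" for p
  proof (rule order_antisym)
    show "u p \<le> (INF x\<in>P. qhom (D G x) (D p x))"
      using uD[OF p] by (auto simp: le_qhom_iff[symmetric] intro!: INF_greatest)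
    \<comment> \<open>Yoneda with G as universal element: k \<le> \<open>u G\<close>, and the
      functor F carries [G, p] \<otimes> \<open>u G\<close> below \<open>u p\<close>.\<close>
    have "str ?U (G, p) * 1 \<le> str ?U (G, p) * u G"
      using uG by (intro quantale_mult_mono) auto
    also have "\<dots> \<le> u p" using u_mono[OF _ p, of G] G(1) by simp
    finally show "(INF x\<in>P. qhom (D G x) (D p x)) \<le> u p"
      using G(1) p by (simp add: str_underlying_Omega)
  qed
  define f where "f w = u (C (a w))" for w
  have col: "C (a w) \<in> Om" if "w \<in> TP" for w using that by (intro C_in stable_column)
  then have colf: "(\<lambda>w. C (a w)) \<in> TP \<rightarrow> Om" by blast
  have fg: "f w * D G x \<le> a w x" if "w \<in> TP" "x \<in> P" for w x
    using uD[OF col[OF that(1)] that(2)] that by (simp add: f_def)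
  have f_eq: "f w = (INF x\<in>P. qhom (D G x) (a w x))" if "w \<in> TP" for w
    using u_eq[OF col[OF that]] by (simp add: f_def)
  have alg: "T_algebra \<T> TP (mu \<T> P)" by (simp add: T_algebra_free)
  have 1: "xiT \<T> TP f W \<le> f (mu \<T> P W)" if "W \<in> Tob \<T> TP" for W
  proof -
    have "joint TP (mu \<T> P) (\<lambda>x w. D (C (a w)) x)"
      by (rule joint_cong[OF alg _ joint_column]) simp
    then have "T_morphism \<T> (alg_graph \<T> TP (mu \<T> P)) (Omega \<T> X) (\<lambda>w. C (a w))"
      using T_morphism_Omega_iff[OF alg colf] by blast
    then have "T_morphism \<T> (alg_graph \<T> TP (mu \<T> P)) (V_obj \<T>) (\<lambda>w. F (C (a w)))"
      using comp alg unfolding T_compatible_def by blast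
    then have "T_morphism \<T> (alg_graph \<T> TP (mu \<T> P)) (V_obj \<T>) (\<lambda>w. val \<T> (f w))"
      by (rule T_morphism_cong[rotated 3]) (simp_all add: alg_graph_def f_def F_eq col)
    then show ?thesis using T_morphism_alg_V_iff[OF alg] that by blast
  qed
  \<comment> \<open>Since \<open>f w\<close> is [G, a(w, -)], an inequality into f can be tested
    after tensoring with G, where it reduces to the transitivity of a.\<close>
  have 2: "xm TP P (str X) U * f (T2 TP P U) \<le> f (mu \<T> P (T1 TP P U))"
    if U: "U \<in> Tob \<T> (cprod TP P)" for U
  proof -
    have i: "mu \<T> P (T1 TP P U) \<in> TP" "T2 TP P U \<in> TP"
      using U by (auto intro!: mu_in T1_in T2_in)
    have "xm TP P (str X) U * f (T2 TP P U) * D G x \<le> a (mu \<T> P (T1 TP P U)) x" if x: "x \<in> P" for x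
    proof -
      have "xm TP P (str X) U * (f (T2 TP P U) * D G x) \<le> xm TP P (str X) U * a (T2 TP P U) x"
        using fg[OF i(2) x] by (intro quantale_mult_mono) auto
      also have "\<dots> \<le> a (mu \<T> P (T1 TP P U)) x" using a_trans[OF U x] .
      finally show ?thesis by (simp add: mult.assoc)
    qed
    then show ?thesis
      unfolding f_eq[OF i(1)] by (intro INF_greatest) (simp add: le_qhom_iff[symmetric])
  qed
  have stG: "stable X (D G)" using G(1) by (simp add: stable_D)
  have 4: "1 \<le> (SUP w\<in>TP. xiT \<T> P (D G) w * f w)"
  proof -
    \<comment> \<open>The discrete enrichment on the free algebra makes every map out of it a
      V-functor and every weight a distributor; only \<open>joint\<close> then remains to be
      checked.\<close>
    let ?I = "\<lparr>pts = TP, str = \<lambda>(u, v). if u = v then 1 else bot\<rparr> :: ('u, 'v) graph"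
    let ?\<psi> = "xiT \<T> P (D G)" and ?h = "\<lambda>w. C (a w)"
    have "joint TP (mu \<T> P) (\<lambda>x w. ?\<psi> w * D (?h w) x)"
      by (rule joint_cong[OF alg _ joint_column_weighted]) simp
    moreover have "V_functor ?I ?U ?h"
      using \<Omega>.str_refl col by (auto simp: V_functor_def)
    moreover have "V_category ?I" "V_dist_from_1 ?I ?\<psi>"
      by (auto simp: V_category_def V_dist_from_1_def)
    ultimately have "T_diagram \<T> (Omega \<T> X) ?I (mu \<T> P) ?h ?\<psi>"
      using alg by (simp add: T_diagram_Omega_iff)
    moreover have "is_colim ?U (pts ?I) ?\<psi> ?h G"
      using G(1) col stable_eq_SUP[OF stG] by (intro \<Omega>.is_colimI) auto
    ultimately have "is_colim ?V (pts ?I) ?\<psi> (\<lambda>w. F (?h w)) (F G)" by (rule colim)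
    moreover have "is_colim ?V (pts ?I) ?\<psi> (\<lambda>w. F (?h w)) (val \<T> (SUP w\<in>TP. ?\<psi> w * f w))"
      using FV col by (intro V.is_colimI) (simp_all add: f_def u_def)
    ultimately have "F G = val \<T> (SUP w\<in>TP. ?\<psi> w * f w)" by (rule V.is_colim_unique)
    with uG show ?thesis by (simp add: u_def)
  qed
  have adj: "E_adj X f (D G)"
    unfolding E_adj_def using 1 2 stG 4 fg by blast
  have "hom_of f = F"
  proof (rule extensionalityI[OF _ Fext])
    show "hom_of f \<in> extensional Om" by (simp add: hom_of_def)
    fix p assume p: "p \<in> Om"
    then show "hom_of f p = F p"
      by (simp add: hom_of_def F_eq act_eq_INF[OF adj stable_D] u_eq)
  qed
  with adj show ?thesis by (rule that)
qed

lemma E_adj_cong: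
  assumes "\<And>w. w \<in> TP \<Longrightarrow> f w = f' w" "E_adj X f g"
  shows "E_adj X f' g"
proof -
  have "xiT \<T> TP f' W = xiT \<T> TP f W" if "W \<in> Tob \<T> TP" for W
    using that assms(1) by (intro xiT_cong) auto
  moreover have "T2 TP P U \<in> TP" "T1 TP P U \<in> Tob \<T> TP" if "U \<in> Tob \<T> (cprod TP P)" for U
    using that by (auto intro!: T1_in T2_in)
  ultimately show ?thesis
    using assms(2) unfolding E_adj_def by (simp add: assms(1)[symmetric] mu_in cong: SUP_cong_simp)
qed

lemma act_point: "\<lbrakk>stable X p; x \<in> P\<rbrakk> \<Longrightarrow> act (\<lambda>w. a w x) p = p x"
  by (simp add: act_def stable_eq_SUP[symmetric])

text \<open>The pair consists of \<open>x_*\<close> and \<open>x^*\<close>. Its unit is reflexivity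
  at x, its counit the stability of the columns.\<close>

lemma E_adj_point:
  assumes x: "x \<in> P"
  shows "E_adj X (\<lambda>w. a w x) (a (eta \<T> P x))"
proof -
  have st: "stable X (a (eta \<T> P x))" using x by (intro stable_column) simp
  have "1 \<le> act (\<lambda>w. a w x) (a (eta \<T> P x))" using act_point[OF st x] a_refl[OF x] by simp
  moreover have "a w x * a (eta \<T> P x) y \<le> a w y" if w: "w \<in> TP" and y: "y \<in> P" for w y
    using stableD[OF stable_column[OF w], of "eta \<T> P x" y] x y by simp
  ultimately show ?thesis
    unfolding E_adj_def act_def[symmetric] using xiT_row[OF _ x] a_trans[OF _ x] st by blast
qed


section \<open>The isomorphism and Cauchy completeness\<close>

definition Phi :: "('u \<times> 'u \<Rightarrow> 'v) \<Rightarrow> 'u \<Rightarrow> 'u" where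
  "Phi \<phi> = hom_of (\<lambda>w. \<phi> (w, pt1))"

lemma Map_E_extensional: "\<phi> \<in> Map_E \<T> X \<Longrightarrow> \<phi> \<in> extensional (TP \<times> one_set)"
  by (simp add: Map_E_iff[OF T_graph_X])

lemma Map_E_adj:
  assumes "\<phi> \<in> Map_E \<T> X"
  obtains g where "E_adj X (\<lambda>w. \<phi> (w, pt1)) g"
  using assms Map_E_iff[OF T_graph_X] by blast

lemma Phi_le_iff:
  assumes \<phi>: "\<phi> \<in> Map_E \<T> X" and \<phi>': "\<phi>' \<in> Map_E \<T> X"
  shows "\<phi> \<le> \<phi>' \<longleftrightarrow> frm_le \<T> (Omega \<T> X) (Phi \<phi>) (Phi \<phi>')"
proof
  assume "\<phi> \<le> \<phi>'"
  then have "act (\<lambda>w. \<phi> (w, pt1)) p \<le> act (\<lambda>w. \<phi>' (w, pt1)) p" for p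
    unfolding act_def
    by (intro SUP_subset_mono subset_refl quantale_mult_mono order_refl) (simp add: le_fun_def)
  then show "frm_le \<T> (Omega \<T> X) (Phi \<phi>) (Phi \<phi>')"
    by (simp add: frm_le_def Phi_def)
next
  assume le: "frm_le \<T> (Omega \<T> X) (Phi \<phi>) (Phi \<phi>')"
  have act: "act (\<lambda>w. \<theta> (w, pt1)) (D (C (a w))) = \<theta> (w, pt1)"
    if \<theta>: "\<theta> \<in> Map_E \<T> X" and w: "w \<in> TP" for \<theta> w
  proof -
    obtain g where "E_adj X (\<lambda>w. \<theta> (w, pt1)) g" using \<theta> by (rule Map_E_adj)
    then have "act (\<lambda>w. \<theta> (w, pt1)) (a w) = \<theta> (w, pt1)" using w by (rule act_column)
    moreover have "act (\<lambda>w. \<theta> (w, pt1)) (D (C (a w))) = act (\<lambda>w. \<theta> (w, pt1)) (a w)"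
      by (rule act_cong) simp
    ultimately show ?thesis by simp
  qed
  have "\<phi> (w, pt1) \<le> \<phi>' (w, pt1)" if w: "w \<in> TP" for w
  proof -
    have C: "C (a w) \<in> Om" using w by (intro C_in stable_column)
    with le have "act (\<lambda>w. \<phi> (w, pt1)) (D (C (a w))) \<le> act (\<lambda>w. \<phi>' (w, pt1)) (D (C (a w)))"
      by (simp add: frm_le_def Phi_def)
    then show ?thesis by (simp only: act[OF \<phi> w] act[OF \<phi>' w])
  qed
  then show "\<phi> \<le> \<phi>'"
    unfolding extensional_le_iff[OF \<phi>[THEN Map_E_extensional] \<phi>'[THEN Map_E_extensional]]
    by (simp add: one_set_def)
qed

text \<open>Injectivity follows from order reflection. For surjectivity, the function f obtained
  from F is turned into an extensional matrix, which changes nothing on T X.\<close>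

lemma bij_betw_Phi: "bij_betw Phi (Map_E \<T> X) (T_Frm \<T> (Omega \<T> X) (V_obj \<T>))"
  unfolding bij_betw_def
proof (intro conjI equalityI subsetI)
  show "inj_on Phi (Map_E \<T> X)"
  proof (rule inj_onI)
    fix \<phi> \<phi>' assume *: "\<phi> \<in> Map_E \<T> X" "\<phi>' \<in> Map_E \<T> X" "Phi \<phi> = Phi \<phi>'"
    have "frm_le \<T> (Omega \<T> X) (Phi \<phi>) (Phi \<phi>')" "frm_le \<T> (Omega \<T> X) (Phi \<phi>') (Phi \<phi>)"
      using *(3) by (simp_all add: frm_le_def)
    with *(1,2) show "\<phi> = \<phi>'" by (intro order_antisym) (simp_all add: Phi_le_iff)
  qed
next
  fix F assume "F \<in> Phi ` Map_E \<T> X"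
  then obtain \<phi> where "\<phi> \<in> Map_E \<T> X" "F = Phi \<phi>" by blast
  then show "F \<in> T_Frm \<T> (Omega \<T> X) (V_obj \<T>)"
    unfolding Phi_def using Map_E_adj hom_of_in_T_Frm by metis
next
  fix F assume "F \<in> T_Frm \<T> (Omega \<T> X) (V_obj \<T>)"
  then obtain f g where adj: "E_adj X f g" and F: "hom_of f = F" by (rule T_Frm_from_E_adj)
  define \<phi> :: "'u \<times> 'u \<Rightarrow> 'v" where "\<phi> = restrict (\<lambda>(w, t). f w) (TP \<times> one_set)"
  have \<phi>f: "\<phi> (w, pt1) = f w" if "w \<in> TP" for w using that by (simp add: \<phi>_def)
  have "E_adj X (\<lambda>w. \<phi> (w, pt1)) g" by (rule E_adj_cong[OF _ adj]) (simp add: \<phi>f)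
  then have "\<phi> \<in> Map_E \<T> X" unfolding Map_E_iff[OF T_graph_X] by (auto simp: \<phi>_def)
  moreover have "act (\<lambda>w. \<phi> (w, pt1)) p = act f p" for p
    unfolding act_def by (intro SUP_cong refl) (simp add: \<phi>f)
  then have "Phi \<phi> = F" by (simp add: Phi_def hom_of_def flip: F)
  ultimately show "F \<in> Phi ` Map_E \<T> X" by blast
qed

lemma point_star_in_Map_E:
  assumes x: "x \<in> P"
  shows "point_star \<T> X x \<in> Map_E \<T> X"
proof -
  have "E_adj X (\<lambda>w. point_star \<T> X x (w, pt1)) (a (eta \<T> P x))"
    by (rule E_adj_cong[OF _ E_adj_point[OF x]])
      (simp add: point_star_def lower_star_def E_obj_def)
  moreover have "point_star \<T> X x \<in> extensional (TP \<times> one_set)"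
    by (simp add: point_star_def lower_star_def E_obj_def)
  ultimately show ?thesis unfolding Map_E_iff[OF T_graph_X] by blast
qed

lemma Phi_point_star:
  assumes x: "x \<in> P"
  shows "Phi (point_star \<T> X x) = eta_pt \<T> X x"
proof -
  have "act (\<lambda>w. point_star \<T> X x (w, pt1)) (D p) = D p x" if p: "p \<in> Om" for p
  proof -
    have "act (\<lambda>w. point_star \<T> X x (w, pt1)) (D p) = act (\<lambda>w. a w x) (D p)"
      unfolding act_def
      by (intro SUP_cong refl) (simp add: point_star_def lower_star_def E_obj_def)
    then show ?thesis using act_point[OF stable_D[OF p] x] by simp
  qed
  then show ?thesis by (auto simp: Phi_def hom_of_def eta_pt_def)
qed

text \<open>A frame homomorphism is extensional with values in \<open>Vset\<close>, so passing to
  quantale values and coding the graph loses nothing.\<close>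

lemma bij_betw_pt:
  "bij_betw (\<lambda>\<phi>. hom_code \<T> (Omega \<T> X) (Phi \<phi>)) (Map_E \<T> X) (pts (pt \<T> (Omega \<T> X)))"
proof -
  have "inj_on (hom_code \<T> (Omega \<T> X)) (T_Frm \<T> (Omega \<T> X) (V_obj \<T>))"
  proof (rule inj_onI)
    fix F F' assume F: "F \<in> T_Frm \<T> (Omega \<T> X) (V_obj \<T>)" and F': "F' \<in> T_Frm \<T> (Omega \<T> X) (V_obj \<T>)"
      and eq: "hom_code \<T> (Omega \<T> X) F = hom_code \<T> (Omega \<T> X) F'"
    have V: "H p \<in> Vset \<T>" if "H \<in> T_Frm \<T> (Omega \<T> X) (V_obj \<T>)" "p \<in> Om" for H p
      using that by (auto simp: T_Frm_def T_frame_hom_def V_functor_def)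
    have "(\<lambda>p\<in>Om. unval \<T> (F p)) = (\<lambda>p\<in>Om. unval \<T> (F' p))"
      using eq by (intro inj_onD[OF inj_fcode[OF small_Om]]) (simp_all add: hom_code_def)
    then have "unval \<T> (F p) = unval \<T> (F' p)" if "p \<in> Om" for p
      using that by (auto dest: fun_cong[of _ _ p])
    then have "F p = F' p" if "p \<in> Om" for p
      using that V[OF F that] V[OF F' that] by (metis val_unval)
    then show "F = F'" using F F' by (auto simp: T_Frm_def intro: extensionalityI)
  qed
  then have "bij_betw (hom_code \<T> (Omega \<T> X)) (T_Frm \<T> (Omega \<T> X) (V_obj \<T>))
      (pts (pt \<T> (Omega \<T> X)))"
    by (simp add: bij_betw_def pt_def pt_pts_def)
  from bij_betw_trans[OF bij_betw_Phi this] show ?thesis by (simp add: comp_def)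
qed

section \<open>Cauchy completeness tested on adjunctions with E\<close>

lemma Cauchy_completeD:
  assumes cc: "Cauchy_complete \<T> X" and \<phi>: "\<phi> \<in> Map_E \<T> X"
  shows "\<exists>x\<in>P. \<phi> = point_star \<T> X x"
proof -
  obtain \<psi> where "T_adjunction \<T> (E_obj \<T>) X \<phi> \<psi>" using \<phi> by (auto simp: Map_E_def)
  then obtain f where f: "T_morphism \<T> (E_obj \<T>) X f" "\<phi> = lower_star \<T> (E_obj \<T>) X f"
    using cc T_category_E unfolding Cauchy_complete_def by blast
  have "f pt1 \<in> P" using f(1) by (auto simp: T_morphism_def E_obj_def)
  moreover have "\<phi> = point_star \<T> X (f pt1)"
    unfolding f(2) point_star_def lower_star_def
    by (rule restrict_ext) (auto simp: E_obj_def one_set_def)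
  ultimately show ?thesis by blast
qed

text \<open>These are the composites of \<phi> with \<open>y_*\<close> and of \<open>y^*\<close>
  with \<psi>. Constant maps at y and at e(y) specialize each inequality; the unit, a supremum over
  a fibre of m, needs that fibre to be determined.\<close>

lemma adjunction_at_point:
  assumes Y: "T_category \<T> Y" and adj: "T_adjunction \<T> Y X \<phi> \<psi>" and y: "y \<in> pts Y"
  shows "E_adj X (\<lambda>w. \<phi> (w, y)) (\<lambda>x. \<psi> (eta \<T> (pts Y) y, x))"
proof -
  let ?Q = "pts Y" let ?TQ = "Tob \<T> ?Q" let ?f = "\<lambda>w. \<phi> (w, y)"
  let ?e = "eta \<T> ?Q y" let ?g = "\<lambda>x. \<psi> (?e, x)"
  have Q [simp]: "small ?Q" and b_refl: "1 \<le> str Y (?e, y)" and b: "str Y \<in> extensional (?TQ \<times> ?Q)"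
    using Y y by (simp_all add: T_category_def T_graph_def)
  have e [simp]: "?e \<in> ?TQ" using y by simp
  have aext: "str X \<in> extensional (TP \<times> P)" using T_graph_X by (simp add: T_graph_def)
  have ext: "\<phi> \<in> extensional (TP \<times> ?Q)" "\<psi> \<in> extensional (?TQ \<times> P)"
    using adj by (simp_all add: T_adjunction_def T_distributor_def)
  have 1: "xm TP ?Q \<phi> U * str Y (T2 TP ?Q U, z) \<le> \<phi> (mu \<T> P (T1 TP ?Q U), z)"
    if "U \<in> Tob \<T> (cprod TP ?Q)" "z \<in> ?Q" for U z
    using adj that ext by (simp add: T_adjunction_def T_distributor_def kcomp_le_iff)
  have 2: "xm TP P (str X) U * \<phi> (T2 TP P U, z) \<le> \<phi> (mu \<T> P (T1 TP P U), z)"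
    if "U \<in> Tob \<T> (cprod TP P)" "z \<in> ?Q" for U z
    using adj that ext by (simp add: T_adjunction_def T_distributor_def kcomp_le_iff)
  have 3: "xm ?TQ P \<psi> U * a (T2 ?TQ P U) x \<le> \<psi> (mu \<T> ?Q (T1 ?TQ P U), x)"
    if "U \<in> Tob \<T> (cprod ?TQ P)" "x \<in> P" for U x
    using adj that ext by (simp add: T_adjunction_def T_distributor_def kcomp_le_iff)
  have 6: "xm TP ?Q \<phi> U * \<psi> (T2 TP ?Q U, x) \<le> a (mu \<T> P (T1 TP ?Q U)) x"
    if "U \<in> Tob \<T> (cprod TP ?Q)" "x \<in> P" for U x
    using adj that aext by (simp add: T_adjunction_def kcomp_le_iff)
  have "str Y (?e, y) \<le> kcomp \<T> ?Q P ?Q \<psi> \<phi> (?e, y)"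
    using adj by (simp add: T_adjunction_def le_fun_def)
  then have 5: "1 \<le> (SUP U\<in>{U \<in> Tob \<T> (cprod ?TQ P). mu \<T> ?Q (T1 ?TQ P U) = ?e}.
      xm ?TQ P \<psi> U * \<phi> (T2 ?TQ P U, y))"
    using b_refl y by (simp add: kcomp_apply)
  have left: "Tmap \<T> TP (cprod TP ?Q) (\<lambda>w. cpair w y) W \<in> Tob \<T> (cprod TP ?Q)"
    "T1 TP ?Q (Tmap \<T> TP (cprod TP ?Q) (\<lambda>w. cpair w y) W) = W"
    "T2 TP ?Q (Tmap \<T> TP (cprod TP ?Q) (\<lambda>w. cpair w y) W) = ?e"
    "xm TP ?Q \<phi> (Tmap \<T> TP (cprod TP ?Q) (\<lambda>w. cpair w y) W) = xiT \<T> TP ?f W"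
    if "W \<in> Tob \<T> TP" for W
    using pairing[of W TP "\<lambda>w. w" TP "\<lambda>_. y" ?Q] that y by (simp_all add: Tmap_const Tmap_ident)
  have right: "Tmap \<T> P (cprod ?TQ P) (\<lambda>x. cpair ?e x) w \<in> Tob \<T> (cprod ?TQ P)"
    "T1 ?TQ P (Tmap \<T> P (cprod ?TQ P) (\<lambda>x. cpair ?e x) w) = eta \<T> ?TQ ?e"
    "T2 ?TQ P (Tmap \<T> P (cprod ?TQ P) (\<lambda>x. cpair ?e x) w) = w"
    "xm ?TQ P \<psi> (Tmap \<T> P (cprod ?TQ P) (\<lambda>x. cpair ?e x) w) = xiT \<T> P ?g w"
    if "w \<in> TP" for w
    using pairing[of w P "\<lambda>_. ?e" ?TQ "\<lambda>x. x" P] that y by (simp_all add: Tmap_const Tmap_ident)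
  have A1: "xiT \<T> TP ?f W \<le> ?f (mu \<T> P W)" if W: "W \<in> Tob \<T> TP" for W
  proof -
    have "xiT \<T> TP ?f W * 1 \<le> xiT \<T> TP ?f W * str Y (?e, y)"
      using b_refl by (intro quantale_mult_mono) auto
    also have "\<dots> \<le> ?f (mu \<T> P W)" using 1[OF left(1)[OF W] y] unfolding left(2-4)[OF W] .
    finally show ?thesis by simp
  qed
  have A3: "stable X ?g"
    unfolding stable_def
  proof (intro ballI)
    fix w x assume w: "w \<in> TP" and x: "x \<in> P"
    show "xiT \<T> P ?g w * a w x \<le> ?g x"
      using 3[OF right(1)[OF w] x] unfolding right(2-4)[OF w] by (simp add: mu_eta)
  qed
  have A5: "?f w * ?g x \<le> a w x" if w: "w \<in> TP" and x: "x \<in> P" for w x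
  proof -
    have W: "eta \<T> TP w \<in> Tob \<T> TP" using w by simp
    show ?thesis using 6[OF left(1)[OF W] x] w unfolding left(2-4)[OF W] by simp
  qed
  have "(SUP U\<in>{U \<in> Tob \<T> (cprod ?TQ P). mu \<T> ?Q (T1 ?TQ P U) = ?e}.
      xm ?TQ P \<psi> U * \<phi> (T2 ?TQ P U, y)) \<le> (SUP w\<in>TP. xiT \<T> P ?g w * ?f w)"
  proof (rule SUP_least)
    fix U assume "U \<in> {U \<in> Tob \<T> (cprod ?TQ P). mu \<T> ?Q (T1 ?TQ P U) = ?e}"
    then have U: "U \<in> Tob \<T> (cprod ?TQ P)" "mu \<T> ?Q (T1 ?TQ P U) = ?e" by auto
    have w: "T2 ?TQ P U \<in> TP" using U(1) by (intro T2_in) auto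
    \<comment> \<open>The fibre of m over e(y) contains only the unit at e(y), so U lies in the
      slice over e(y) and is determined by its component in T X.\<close>
    have "T1 ?TQ P U = eta \<T> ?TQ ?e"
      using U y by (intro mu_eq_eta T1_in) auto
    then have "U = Tmap \<T> P (cprod ?TQ P) (\<lambda>x. cpair ?e x) (T2 ?TQ P U)"
      using U(1) by (intro T_cprod_eta_fst) auto
    with right(4)[OF w] have "xm ?TQ P \<psi> U = xiT \<T> P ?g (T2 ?TQ P U)" by metis
    then show "xm ?TQ P \<psi> U * \<phi> (T2 ?TQ P U, y) \<le> (SUP w\<in>TP. xiT \<T> P ?g w * ?f w)"
      using w by (intro SUP_upper2[of "T2 ?TQ P U"]) auto
  qed
  with 5 have A4: "1 \<le> (SUP w\<in>TP. xiT \<T> P ?g w * ?f w)" by (rule order_trans)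
  show ?thesis
    unfolding E_adj_def using A1 2[OF _ y] A3 A4 A5 by blast
qed

text \<open>Choosing for each y a point f(y) that represents \<phi>(-, y) gives a map of sets. What
  remains is that \<psi> agrees with \<open>f^*\<close>, and from this the functor property of f
  follows.\<close>

lemma Cauchy_completeI:
  assumes pts: "\<And>\<phi>. \<phi> \<in> Map_E \<T> X \<Longrightarrow> \<exists>x\<in>P. \<phi> = point_star \<T> X x"
  shows "Cauchy_complete \<T> X"
  unfolding Cauchy_complete_def
proof (intro allI impI)
  fix Y \<phi> \<psi>
  assume "T_category \<T> Y \<and> T_adjunction \<T> Y X \<phi> \<psi>"
  then have Y: "T_category \<T> Y" and adj: "T_adjunction \<T> Y X \<phi> \<psi>" by auto
  let ?Q = "pts Y" let ?TQ = "Tob \<T> ?Q" let ?e = "eta \<T> ?Q"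
  have Q [simp]: "small ?Q" and b: "str Y \<in> extensional (?TQ \<times> ?Q)"
    using Y by (simp_all add: T_category_def T_graph_def)
  have aext: "str X \<in> extensional (TP \<times> P)" using T_graph_X by (simp add: T_graph_def)
  have ext: "\<phi> \<in> extensional (TP \<times> ?Q)" "\<psi> \<in> extensional (?TQ \<times> P)"
    using adj by (simp_all add: T_adjunction_def T_distributor_def)
  have 3: "xm ?TQ P \<psi> U * a (T2 ?TQ P U) x \<le> \<psi> (mu \<T> ?Q (T1 ?TQ P U), x)"
    if "U \<in> Tob \<T> (cprod ?TQ P)" "x \<in> P" for U x
    using adj that ext by (simp add: T_adjunction_def T_distributor_def kcomp_le_iff)
  have 6: "xm TP ?Q \<phi> U * \<psi> (T2 TP ?Q U, x) \<le> a (mu \<T> P (T1 TP ?Q U)) x"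
    if "U \<in> Tob \<T> (cprod TP ?Q)" "x \<in> P" for U x
    using adj that aext by (simp add: T_adjunction_def kcomp_le_iff)
  have "\<exists>x\<in>P. \<forall>w\<in>TP. \<phi> (w, y) = a w x" if y: "y \<in> ?Q" for y
  proof -
    define \<theta> :: "'u \<times> 'u \<Rightarrow> 'v" where "\<theta> = restrict (\<lambda>(w, t). \<phi> (w, y)) (TP \<times> one_set)"
    have "E_adj X (\<lambda>w. \<theta> (w, pt1)) (\<lambda>x. \<psi> (?e y, x))"
      by (rule E_adj_cong[OF _ adjunction_at_point[OF Y adj y]]) (simp add: \<theta>_def)
    then have "\<theta> \<in> Map_E \<T> X" unfolding Map_E_iff[OF T_graph_X] by (auto simp: \<theta>_def)
    then obtain x where x: "x \<in> P" "\<theta> = point_star \<T> X x" using pts by blast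
    have "\<phi> (w, y) = a w x" if "w \<in> TP" for w
      using fun_cong[OF x(2), of "(w, pt1)"] that
      by (simp add: \<theta>_def point_star_def lower_star_def E_obj_def)
    with x(1) show ?thesis by blast
  qed
  then obtain f where f: "\<And>y. y \<in> ?Q \<Longrightarrow> f y \<in> P"
    and \<phi>f: "\<And>y w. y \<in> ?Q \<Longrightarrow> w \<in> TP \<Longrightarrow> \<phi> (w, y) = a w (f y)"
    by metis
  have fQ: "f \<in> ?Q \<rightarrow> P" using f by blast
  \<comment> \<open>The unit of the adjunction at y, with \<phi>(-, y) replaced by the row of f(y):
    \<open>act\<close> with that row is evaluation at f(y).\<close>
  have unit: "1 \<le> \<psi> (?e y, f y)" if y: "y \<in> ?Q" for y
  proof -
    let ?g = "\<lambda>x. \<psi> (?e y, x)"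
    have ad: "E_adj X (\<lambda>w. \<phi> (w, y)) ?g" using adjunction_at_point[OF Y adj y] .
    have "1 \<le> act (\<lambda>w. \<phi> (w, y)) ?g" using E_adjD(4)[OF ad] .
    also have "\<dots> = act (\<lambda>w. a w (f y)) ?g"
      unfolding act_def using \<phi>f[OF y] by (intro SUP_cong refl) simp
    also have "\<dots> = ?g (f y)" using act_point[OF E_adjD(3)[OF ad] f[OF y]] .
    finally show ?thesis .
  qed
  \<comment> \<open>The counit is taken at T(e . f, id)(v). There \<phi> is at least k by
    reflexivity at f(y), and the first component multiplies to T f(v).\<close>
  have \<psi>_le: "\<psi> (v, x) \<le> a (Tmap \<T> ?Q P f v) x" if v: "v \<in> ?TQ" and x: "x \<in> P" for v x
  proof -
    have ef: "(\<lambda>y. eta \<T> P (f y)) \<in> ?Q \<rightarrow> TP" using f by simp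
    have idQ: "(\<lambda>y. y) \<in> ?Q \<rightarrow> ?Q" by simp
    note pr = pairing[OF v ef idQ small_T[OF small_P] Q Q]
    let ?U = "Tmap \<T> ?Q (cprod TP ?Q) (\<lambda>y. cpair (eta \<T> P (f y)) y) v"
    have "xiT \<T> ?Q (\<lambda>_. 1) v \<le> xiT \<T> ?Q (\<lambda>y. \<phi> (eta \<T> P (f y), y)) v"
      using v f a_refl by (intro xiT_mono) (simp_all add: \<phi>f)
    then have "1 \<le> xm TP ?Q \<phi> ?U" using v by (simp add: pr(4)[of \<phi>])
    then have "1 * \<psi> (v, x) \<le> xm TP ?Q \<phi> ?U * \<psi> (T2 TP ?Q ?U, x)"
      using v by (intro quantale_mult_mono) (simp_all add: pr(3) Tmap_ident)
    also have "\<dots> \<le> a (mu \<T> P (T1 TP ?Q ?U)) x" using 6[OF pr(1) x] .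
    also have "T1 TP ?Q ?U = Tmap \<T> P TP (eta \<T> P) (Tmap \<T> ?Q P f v)"
      unfolding pr(2) using v fQ by (intro Tmap_Tmap[symmetric]) auto
    also have "mu \<T> P \<dots> = Tmap \<T> ?Q P f v" using v fQ by (intro mu_Tmap_eta Tmap_in) auto
    finally show ?thesis by simp
  qed
  \<comment> \<open>The action of X on \<psi> is taken at T(e, f)(v). There \<open>unit\<close>
    makes \<psi> at least k, the second component is T f(v), and the first multiplies to v.\<close>
  have \<psi>_ge: "a (Tmap \<T> ?Q P f v) x \<le> \<psi> (v, x)" if v: "v \<in> ?TQ" and x: "x \<in> P" for v x
  proof -
    have eQ: "(\<lambda>y. ?e y) \<in> ?Q \<rightarrow> ?TQ" by simp
    note pr = pairing[OF v eQ fQ small_T[OF Q] small_P Q]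
    let ?U = "Tmap \<T> ?Q (cprod ?TQ P) (\<lambda>y. cpair (?e y) (f y)) v"
    have "xiT \<T> ?Q (\<lambda>_. 1) v \<le> xiT \<T> ?Q (\<lambda>y. \<psi> (?e y, f y)) v"
      using v unit by (intro xiT_mono) simp_all
    then have "1 \<le> xm ?TQ P \<psi> ?U" using v by (simp add: pr(4)[of \<psi>])
    then have "1 * a (Tmap \<T> ?Q P f v) x \<le> xm ?TQ P \<psi> ?U * a (T2 ?TQ P ?U) x"
      by (intro quantale_mult_mono) (simp_all add: pr(3))
    also have "\<dots> \<le> \<psi> (mu \<T> ?Q (T1 ?TQ P ?U), x)" using 3[OF pr(1) x] .
    also have "mu \<T> ?Q (T1 ?TQ P ?U) = v" using v by (simp add: pr(2) mu_Tmap_eta)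
    finally show ?thesis by simp
  qed
  have \<psi>_eq: "\<psi> (v, x) = a (Tmap \<T> ?Q P f v) x" if "v \<in> ?TQ" "x \<in> P" for v x
    using \<psi>_le[OF that] \<psi>_ge[OF that] by (rule order_antisym)
  \<comment> \<open>The structure of Y lies below the composite of \<phi> and \<psi>. Since
    \<phi>(-, y) is the row of f(y), the action of X on \<psi> bounds that composite by \<psi>(v,
    f(y)).\<close>
  have "str Y (v, y) \<le> a (Tmap \<T> ?Q P f v) (f y)" if v: "v \<in> ?TQ" and y: "y \<in> ?Q" for v y
  proof -
    have "str Y (v, y) \<le> kcomp \<T> ?Q P ?Q \<psi> \<phi> (v, y)"
      using adj by (simp add: T_adjunction_def le_fun_def)
    also have "\<dots> = (SUP U\<in>{U \<in> Tob \<T> (cprod ?TQ P). mu \<T> ?Q (T1 ?TQ P U) = v}.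
        xm ?TQ P \<psi> U * \<phi> (T2 ?TQ P U, y))"
      using v y by (simp add: kcomp_apply)
    also have "\<dots> \<le> \<psi> (v, f y)"
    proof (rule SUP_least)
      fix U assume "U \<in> {U \<in> Tob \<T> (cprod ?TQ P). mu \<T> ?Q (T1 ?TQ P U) = v}"
      then have U: "U \<in> Tob \<T> (cprod ?TQ P)" "mu \<T> ?Q (T1 ?TQ P U) = v" by auto
      have "T2 ?TQ P U \<in> TP" using U(1) by (intro T2_in) auto
      then show "xm ?TQ P \<psi> U * \<phi> (T2 ?TQ P U, y) \<le> \<psi> (v, f y)"
        using 3[OF U(1) f[OF y]] U(2) by (simp add: \<phi>f[OF y])
    qed
    also have "\<dots> = a (Tmap \<T> ?Q P f v) (f y)" using v f[OF y] by (rule \<psi>_eq)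
    finally show ?thesis .
  qed
  then have "T_morphism \<T> Y X f" using fQ by (simp add: T_morphism_def)
  moreover have "\<phi> = lower_star \<T> Y X f"
    by (rule extensionalityI[OF ext(1)]) (auto simp: lower_star_def \<phi>f)
  moreover have "\<psi> = upper_star \<T> Y X f"
    by (rule extensionalityI[OF ext(2)]) (auto simp: upper_star_def \<psi>_eq)
  ultimately show "\<exists>f. T_morphism \<T> Y X f \<and> \<phi> = lower_star \<T> Y X f \<and> \<psi> = upper_star \<T> Y X f"
    by blast
qed

text \<open>Both sets are images under the injective \<open>Phi\<close>, so surjectivity of the unit
  says that every element of \<open>Map_E\<close> is some \<open>x_*\<close>.\<close>

lemma Cauchy_complete_iff:
  "Cauchy_complete \<T> X \<longleftrightarrow> eta_pt \<T> X ` P = T_Frm \<T> (Omega \<T> X) (V_obj \<T>)"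
proof -
  have "eta_pt \<T> X ` P = Phi ` (point_star \<T> X ` P)"
    by (simp add: image_image Phi_point_star)
  moreover have "T_Frm \<T> (Omega \<T> X) (V_obj \<T>) = Phi ` Map_E \<T> X"
    using bij_betw_Phi by (simp add: bij_betw_def)
  moreover have sub: "point_star \<T> X ` P \<subseteq> Map_E \<T> X" using point_star_in_Map_E by blast
  ultimately have "eta_pt \<T> X ` P = T_Frm \<T> (Omega \<T> X) (V_obj \<T>) \<longleftrightarrow>
      point_star \<T> X ` P = Map_E \<T> X"
    using bij_betw_Phi by (simp add: bij_betw_def inj_on_image_eq_iff)
  also have "\<dots> \<longleftrightarrow> Cauchy_complete \<T> X"
  proof
    assume "point_star \<T> X ` P = Map_E \<T> X"
    then show "Cauchy_complete \<T> X" by (intro Cauchy_completeI) blast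
  next
    assume "Cauchy_complete \<T> X"
    from Cauchy_completeD[OF this] have "Map_E \<T> X \<subseteq> point_star \<T> X ` P" by blast
    with sub show "point_star \<T> X ` P = Map_E \<T> X" by (rule equalityI)
  qed
  finally show ?thesis by (rule sym)
qed

end

theorem theorem2p13:
  fixes \<T> :: "('u::set_universe, 'v::comm_quantale) theory_data"
    and X :: "('u, 'v) graph"
  assumes "strict_topological_theory \<T>"
    and "T_one \<T>"
    and "T_category \<T> X"
  shows "(\<exists>\<Phi>. bij_betw \<Phi> (Map_E \<T> X) (T_Frm \<T> (Omega \<T> X) (V_obj \<T>))
      \<and> (\<forall>\<phi>\<in>Map_E \<T> X. \<forall>\<phi>'\<in>Map_E \<T> X. \<phi> \<le> \<phi>' \<longleftrightarrow> frm_le \<T> (Omega \<T> X) (\<Phi> \<phi>) (\<Phi> \<phi>'))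
      \<and> (\<forall>x\<in>pts X. point_star \<T> X x \<in> Map_E \<T> X \<and> \<Phi> (point_star \<T> X x) = eta_pt \<T> X x)
      \<and> bij_betw (\<lambda>\<phi>. hom_code \<T> (Omega \<T> X) (\<Phi> \<phi>)) (Map_E \<T> X) (pts (pt \<T> (Omega \<T> X))))
    \<and> (Cauchy_complete \<T> X \<longleftrightarrow> eta_pt \<T> X ` pts X = T_Frm \<T> (Omega \<T> X) (V_obj \<T>))"
proof -
  interpret T_cat \<T> X
    by unfold_locales (use assms in auto)
  show ?thesis
    using bij_betw_Phi Phi_le_iff point_star_in_Map_E Phi_point_star bij_betw_pt Cauchy_complete_iff
    by (intro conjI exI[of _ Phi]) simp_all
qed

end
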